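(* Let $G$ be a reasonably homogeneous countable abelian group. If $S\subseteq G$ is measure expanding, then there is a subset $S'\subseteq S$ and a continuous Borel probability measure $\sigma$ on $\widehat G$ such that (i) $S'$ is measure expanding; (ii) $\lim_{n\to\infty}\hat\sigma(s_n)=1$, where $(s_n)_{n\in\mathbb N}$ enumerates $S'$; (iii) $\sigma(U)>0$ for every nonempty open $U\subseteq\widehat G$.
   Context: Let $G$ be a countable abelian group (discrete, written additively). A $G$-system is a triple $(X,\mu,T)$ where $(X,\mu)$ is a probability measure space and $T$ is an action of $G$ on $X$ by measure preserving transformations: $\mu(T^gD)=\mu(D)$ for every measurable $D\subseteq X$ and all $g\in G$. $S\subseteq G$ is a set of recurrence if for every $G$-system $(X,\mu,T)$ and every measurable $D\subseteq X$ with $\mu(D)>0$ there is $g\in S$ with $\mu(D\cap T^gD)>0$. $S$ is measure expanding if $S+h$ is a set of recurrence for every $h\in G$. $\widehat G$ is the Pontryagin dual of $G$: the compact group of homomorphisms $\chi:G\to\mathcal S^1=\{z\in\mathbb C:|z|=1\}$ with the topology of pointwise convergence. For a measure $\sigma$ on $\widehat G$, $\hat\sigma(g):=\int\chi(g)\,d\sigma(\chi)$ for $g\in G$; $\sigma$ is continuous if $\sigma(\{\chi\})=0$ for all $\chi\in\widehat G$. For an integer $q\ge 2$, $\Sigma_q:=\bigoplus_{n=1}^\infty \mathbb Z/q\mathbb Z$. A countably infinite abelian group $G$ is reasonably homogeneous if either $G$ has infinite exponent (there is no $n\in\mathbb N$ with $ng=0$ for all $g\in G$), or $G$ is (isomorphic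 to) $\Sigma_{q_1}\oplus\cdots\oplus\Sigma_{q_r}$ for some $r\in\mathbb N$ and integers $q_i\ge2$. *)

theory Defs
  imports "HOL-Algebra.Product_Groups" "HOL-Probability.Probability_Measure"
begin

text \<open>The countable abelian group G is the whole of a type
  \<open>'g :: {ab_group_add, countable}\<close>.\<close>

definition G_system :: "'x measure \<Rightarrow> ('g::ab_group_add \<Rightarrow> 'x \<Rightarrow> 'x) \<Rightarrow> bool" where
  "G_system M T \<longleftrightarrow>
     prob_space M \<and>
     (\<forall>g. T g \<in> measurable M M) \<and>
     (\<forall>x\<in>space M. T 0 x = x) \<and>
     (\<forall>g h. \<forall>x\<in>space M. T (g + h) x = T g (T h x)) \<and>
     (\<forall>g. \<forall>D\<in>sets M. emeasure M (T g ` D) = emeasure M D)"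

definition recurrent_on :: "'x itself \<Rightarrow> 'g::ab_group_add set \<Rightarrow> bool" where
  "recurrent_on _ S \<longleftrightarrow>
     (\<forall>(M :: 'x measure) T. G_system M T \<longrightarrow>
        (\<forall>D\<in>sets M. emeasure M D > 0 \<longrightarrow> (\<exists>g\<in>S. emeasure M (D \<inter> T g ` D) > 0)))"

text \<open>A definition in HOL cannot quantify over the type of the points of X.  It is enough to
  take \<open>'g \<Rightarrow> bool\<close> for this type: by \<open>set_of_recurrence_all_types\<close> below, a set of recurrence
  in the sense of the next definition is recurrent for the G-systems on every type.\<close>

definition set_of_recurrence :: "'g::ab_group_add set \<Rightarrow> bool" where
  "set_of_recurrence S \<longleftrightarrow> recurrent_on TYPE('g \<Rightarrow> bool) S"

definition measure_expanding :: "'g::ab_group_add set \<Rightarrow> bool" where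
  "measure_expanding S \<longleftrightarrow> (\<forall>h. set_of_recurrence ((\<lambda>s. s + h) ` S))"

lemma set_of_recurrence_all_types:
  fixes S :: "'g::{ab_group_add, countable} set"
  assumes S: "set_of_recurrence S"
  shows "recurrent_on TYPE('x) S"
  unfolding recurrent_on_def
proof (intro allI impI ballI)
  fix M :: "'x measure" and T :: "'g \<Rightarrow> 'x \<Rightarrow> 'x" and D
  assume sys: "G_system M T" and D: "D \<in> sets M" and Dpos: "emeasure M D > 0"
  have meas: "\<And>g. T g \<in> measurable M M"
    and T0: "\<And>x. x \<in> space M \<Longrightarrow> T 0 x = x"
    and Tadd: "\<And>g h x. x \<in> space M \<Longrightarrow> T (g + h) x = T g (T h x)"
    and pres: "\<And>g E. E \<in> sets M \<Longrightarrow> emeasure M (T g ` E) = emeasure M E"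
    and prob: "prob_space M"
    using sys unfolding G_system_def by blast+
  have Tsp: "T g x \<in> space M" if "x \<in> space M" for g x
    using meas that by (rule measurable_space)
  have img: "T g ` E = T (- g) -` E \<inter> space M" if "E \<subseteq> space M" for g E
  proof (intro equalityI subsetI)
    fix y assume "y \<in> T g ` E"
    then obtain x where x: "x \<in> E" "y = T g x" by auto
    then show "y \<in> T (- g) -` E \<inter> space M"
      using that Tsp Tadd[of x "- g" g] T0[of x] by auto
  next
    fix y assume y: "y \<in> T (- g) -` E \<inter> space M"
    then have "y = T g (T (- g) y)" using Tadd[of y g "- g"] T0[of y] by auto
    then show "y \<in> T g ` E" using y by blast
  qed
  define P :: "('g \<Rightarrow> bool) measure" where "P = PiM UNIV (\<lambda>_. count_space UNIV)"
  define \<phi> where "\<phi> = (\<lambda>x g. T g x \<in> D)"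
  define U :: "'g \<Rightarrow> ('g \<Rightarrow> bool) \<Rightarrow> ('g \<Rightarrow> bool)" where "U = (\<lambda>h w g. w (g + h))"
  define N where "N = distr M P \<phi>"
  have coord: "(\<lambda>w. w g) \<in> measurable P (count_space UNIV)" for g
    unfolding P_def by (rule measurable_component_singleton) simp
  have spP: "space P = UNIV" by (simp add: P_def space_PiM)
  have intoP: "f \<in> measurable A P"
    if "\<And>g. (\<lambda>x. f x g) \<in> measurable A (count_space UNIV)" for f and A :: "'z measure"
    unfolding P_def by (rule measurable_PiM_single') (use that in auto)
  have \<phi>: "\<phi> \<in> measurable M P"
  proof (rule intoP)
    fix g
    show "(\<lambda>x. \<phi> x g) \<in> measurable M (count_space UNIV)"
      unfolding \<phi>_def using measurable_sets[OF meas[of g] D]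
      by (auto simp: pred_def[symmetric] vimage_def Int_def conj_commute
          intro!: pred_sets2[OF D meas])
  qed
  have UP: "U h \<in> measurable P P" for h
    unfolding U_def by (rule intoP) (rule coord)
  have Uimg: "U h ` E = U (- h) -` E" for h E
  proof (intro equalityI subsetI)
    fix w assume "w \<in> U (- h) -` E"
    moreover have "w = U h (U (- h) w)" by (auto simp: U_def)
    ultimately show "w \<in> U h ` E" by blast
  qed (auto simp: U_def)
  have equiv: "\<phi> (T h x) = U h (\<phi> x)" if "x \<in> space M" for h x
    using that by (auto simp: \<phi>_def U_def Tadd)
  have setsN: "sets N = sets P" "space N = UNIV" by (auto simp: N_def spP)
  have UE: "U h ` E \<in> sets P" if "E \<in> sets P" for h E
    using measurable_sets[OF UP[of "- h"] that] by (simp add: Uimg spP)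
  have emN: "emeasure N E = emeasure M (\<phi> -` E \<inter> space M)" if "E \<in> sets P" for E
    unfolding N_def using \<phi> that by (rule emeasure_distr)
  have pre: "\<phi> -` (U h ` E) \<inter> space M = T h ` (\<phi> -` E \<inter> space M)" for h E
    using equiv[of _ "- h"] Tsp by (auto simp: Uimg img)
  have "G_system N U"
    unfolding G_system_def
  proof (intro conjI allI ballI)
    show "prob_space N" unfolding N_def using prob \<phi> by (rule prob_space.prob_space_distr)
    show "U g \<in> measurable N N" for g
      using UP setsN by (simp cong: measurable_cong_sets)
    show "U 0 w = w" for w by (simp add: U_def)
    show "U (g + h) w = U g (U h w)" for g h w by (simp add: U_def ac_simps)
    show "emeasure N (U g ` E) = emeasure N E" if "E \<in> sets N" for g E
      using that measurable_sets[OF \<phi>, of E] by (simp add: setsN emN UE pre pres)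
  qed
  moreover define D' where "D' = {w :: 'g \<Rightarrow> bool. w 0}"
  moreover have D': "D' \<in> sets P"
    using measurable_sets[OF coord[of 0], of "{True}"] by (simp add: D'_def spP vimage_def)
  moreover have \<phi>D: "\<phi> -` D' \<inter> space M = D"
    using T0 sets.sets_into_space[OF D] by (auto simp: D'_def \<phi>_def)
  ultimately obtain g where g: "g \<in> S" "emeasure N (D' \<inter> U g ` D') > 0"
    using S Dpos unfolding set_of_recurrence_def recurrent_on_def
    by (metis emN setsN(1))
  have "\<phi> -` (D' \<inter> U g ` D') \<inter> space M = D \<inter> T g ` D"
    using pre[of g D'] unfolding \<phi>D vimage_Int using \<phi>D by blast
  then have "emeasure N (D' \<inter> U g ` D') = emeasure M (D \<inter> T g ` D)"
    using emN[of "D' \<inter> U g ` D'"] D' UE[of D' g] by auto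
  then show "\<exists>g\<in>S. emeasure M (D \<inter> T g ` D) > 0" using g by auto
qed

text \<open>The topology on \<open>'g \<Rightarrow> complex\<close> in the library is the product topology, that is,
  pointwise convergence.\<close>

definition dual :: "('g::ab_group_add \<Rightarrow> complex) set" where
  "dual = {\<gamma>. (\<forall>g. cmod (\<gamma> g) = 1) \<and> (\<forall>g h. \<gamma> (g + h) = \<gamma> g * \<gamma> h)}"

definition dual_topology :: "('g::ab_group_add \<Rightarrow> complex) topology" where
  "dual_topology = top_of_set dual"

definition borel_prob_on_dual :: "('g::ab_group_add \<Rightarrow> complex) measure \<Rightarrow> bool" where
  "borel_prob_on_dual \<sigma> \<longleftrightarrow>
     prob_space \<sigma> \<and> space \<sigma> = dual \<and> sets \<sigma> = sigma_sets dual {U. openin dual_topology U}"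

definition continuous_measure :: "('g::ab_group_add \<Rightarrow> complex) measure \<Rightarrow> bool" where
  "continuous_measure \<sigma> \<longleftrightarrow> (\<forall>\<gamma>\<in>dual. emeasure \<sigma> {\<gamma>} = 0)"

definition fourier :: "('g::ab_group_add \<Rightarrow> complex) measure \<Rightarrow> 'g \<Rightarrow> complex" where
  "fourier \<sigma> g = (\<integral>\<gamma>. \<gamma> g \<partial>\<sigma>)"

definition additive_group :: "'g::ab_group_add monoid" where
  "additive_group = \<lparr>carrier = UNIV, monoid.mult = (+), one = 0\<rparr>"

definition Sigma_group :: "nat \<Rightarrow> (nat \<Rightarrow> int) monoid" where
  "Sigma_group q = sum_group {1..} (\<lambda>_. integer_mod_group q)"

definition infinite_exponent :: "'g::ab_group_add itself \<Rightarrow> bool" where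
  "infinite_exponent _ \<longleftrightarrow> \<not> (\<exists>n::nat. n \<ge> 1 \<and> (\<forall>g::'g. (\<Sum>_<n. g) = 0))"

definition reasonably_homogeneous :: "'g::{ab_group_add, countable} itself \<Rightarrow> bool" where
  "reasonably_homogeneous _ \<longleftrightarrow>
     infinite (UNIV :: 'g set) \<and>
     (infinite_exponent TYPE('g) \<or>
      (\<exists>(r::nat) (q :: nat \<Rightarrow> nat). (\<forall>i\<in>{1..r}. q i \<ge> 2) \<and>
         (additive_group :: 'g monoid) \<cong> sum_group {1..r} (\<lambda>i. Sigma_group (q i))))"

end

theory Submission
  imports Defs "HOL-Probability.Probability" "HOL-Analysis.Kronecker_Approximation_Theorem"
begin

text \<open>
The set \<open>S'\<close> is a union of finite pieces \<open>S0 j\<close> of \<open>S\<close>, and \<open>\<sigma>\<close> is the limit of uniform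
measures on finite families of characters, where the family of stage \<open>j + 1\<close> refines that of
stage \<open>j\<close>.

Let \<open>\<kappa> 0, \<dots>, \<kappa> (N - 1)\<close> be characters.  Their Bohr-Hamming ball consists of the \<open>s\<close> with
\<open>\<kappa> i s\<close> close to 1 for all but a small proportion of the indices \<open>i\<close>; on this ball the uniform
measure on the family has Fourier transform close to 1.  Suppose that there are \<open>g 0, \<dots>, g (N - 1)\<close>
in the group with \<open>\<kappa> i (g i)\<close> close to \<open>exp (2 \<pi> \<i> / M)\<close> and \<open>\<kappa> j (g i)\<close> close to 1 for \<open>j \<noteq> i\<close>, and
that all values of characters are close to \<open>M\<close>-th roots of unity.  Then the sums \<open>\<Sum>i. z i * g i\<close> behave
like the cube \<open>(\<int>/M)^N\<close>, and concentration of measure on this cube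
(\<open>dense_words_close\<close>) shows that every translate of the Bohr-Hamming ball meets the return times of
every set of measure greater than \<open>\<delta>\<close>, once \<open>N\<close> is large (\<open>Bohr_Hamming_recurrence\<close>).

Now let \<open>S\<close> be measure expanding and let \<open>h\<close> be given.  If \<open>D\<close> has measure greater than \<open>\<delta>\<close>, take \<open>m\<close>
in the translate by \<open>h\<close> of the ball such that \<open>D \<inter> T m ` D\<close> has positive measure.  The translate of \<open>S\<close>
by \<open>h - m\<close> is a set of recurrence, and remains one when it is intersected with a Bohr neighbourhood
of 0 (\<open>set_of_recurrence_Bohr\<close>); applied to \<open>D \<inter> T m ` D\<close> this gives an \<open>s \<in> S\<close> in the ball for which
\<open>D \<inter> T (s + h) ` D\<close> has positive measure
(\<open>density_recurrent_Bohr_Hamming_translate\<close>).  Compactness makes finitely many such \<open>s\<close> sufficient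
(\<open>density_recurrent_finite_subset\<close>), and these form a piece \<open>S0 j\<close>.

Homogeneity of the group is what provides \<open>\<kappa>\<close> and \<open>g\<close> in every neighbourhood of arbitrary
prescribed characters (\<open>reasonably_homogeneous_free_directions\<close>, \<open>dual_system_exists\<close>).  This
freedom lets each character of stage \<open>j\<close> have several children at stage \<open>j + 1\<close>, all close to it on a
finite set that contains the earlier pieces, and mutually distinct.  The branches of the resulting
tree converge pointwise, and \<open>\<sigma>\<close> is the distribution of the limit of a random branch.  Separation of
the children makes \<open>\<sigma>\<close> continuous.  A branch may start late: a set of branches of measure
\<open>1 / 2 ^ Suc j\<close> starts at stage \<open>j > 0\<close> close to the \<open>j\<close>-th term of a dense sequence of characters, so
that \<open>\<sigma>\<close> has full support.  For \<open>s\<close> in \<open>S0 j\<close> the branches that have started satisfy \<open>\<gamma> s \<approx> 1\<close>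
with probability close to 1, so that the Fourier transform tends to 1 along \<open>S'\<close>.
\<close>

section \<open>Extension of homomorphisms\<close>

text \<open>The group power of the library, in additive notation: the laws of integer multiples are inherited
from there.\<close>

definition int_mult :: "int \<Rightarrow> 'g::ab_group_add \<Rightarrow> 'g" where
  "int_mult n x = x [^]\<^bsub>additive_group\<^esub> n"

lemma comm_group_additive_group: "comm_group (additive_group :: 'g::ab_group_add monoid)"
  by (rule comm_groupI)
    (auto simp: additive_group_def algebra_simps intro: exI[of _ "- x" for x] left_minus)

lemma int_mult_add: "int_mult (m + n) x = int_mult m x + int_mult n x"
  using group.int_pow_mult[OF comm_group.axioms(2)[OF comm_group_additive_group], of x m n]
  by (simp add: int_mult_def additive_group_def)

lemma int_mult_0 [simp]: "int_mult 0 x = 0"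
  using int_mult_add[of 0 0 x] by simp

lemma int_mult_1 [simp]: "int_mult 1 x = x"
  using group.int_pow_1[OF comm_group.axioms(2)[OF comm_group_additive_group], of x]
  by (simp add: int_mult_def additive_group_def)

lemma int_mult_minus: "int_mult (- n) x = - int_mult n x"
  using int_mult_add[of n "- n" x] by (simp add: eq_neg_iff_add_eq_0 add.commute)

lemma int_mult_diff: "int_mult (m - n) x = int_mult m x - int_mult n x"
  using int_mult_add[of m "- n" x] by (simp add: int_mult_minus)

lemma int_mult_int_mult: "int_mult m (int_mult n x) = int_mult (m * n) x"
  using group.int_pow_pow[OF comm_group.axioms(2)[OF comm_group_additive_group], of x n m]
  by (simp add: int_mult_def additive_group_def mult.commute)

lemma int_mult_distrib: "int_mult n (x + y) = int_mult n x + int_mult n y"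
  using comm_group.int_pow_distrib[OF comm_group_additive_group, of x y n]
  by (simp add: int_mult_def additive_group_def)

lemma int_mult_zero [simp]: "int_mult n 0 = 0"
  using int_mult_distrib[of n 0 0] by simp

lemma int_mult_of_nat: "int_mult (int n) x = (\<Sum>_<n. x)"
  by (induction n) (auto simp: int_mult_add)

text \<open>Only the values on \<open>H\<close> matter.  The target is the group of nonzero complex numbers because it is
divisible and contains both the circle and the positive reals: one extension theorem then yields
characters and homomorphisms to the reals.\<close>

definition hom_on :: "'g::ab_group_add set \<Rightarrow> ('g \<Rightarrow> complex) \<Rightarrow> bool" where
  "hom_on H f \<longleftrightarrow> 0 \<in> H \<and> (\<forall>x\<in>H. \<forall>y\<in>H. x - y \<in> H) \<and>
     (\<forall>x\<in>H. f x \<noteq> 0) \<and> (\<forall>x\<in>H. \<forall>y\<in>H. f (x + y) = f x * f y)"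

lemma hom_onD:
  assumes "hom_on H f"
  shows "0 \<in> H" "\<And>x y. x \<in> H \<Longrightarrow> y \<in> H \<Longrightarrow> x - y \<in> H"
    "\<And>x y. x \<in> H \<Longrightarrow> y \<in> H \<Longrightarrow> x + y \<in> H" "\<And>x. x \<in> H \<Longrightarrow> - x \<in> H"
    "\<And>x. x \<in> H \<Longrightarrow> f x \<noteq> 0" "\<And>x y. x \<in> H \<Longrightarrow> y \<in> H \<Longrightarrow> f (x + y) = f x * f y"
    "f 0 = 1"
proof -
  note a = assms[unfolded hom_on_def]
  show 1: "0 \<in> H" "\<And>x y. x \<in> H \<Longrightarrow> y \<in> H \<Longrightarrow> x - y \<in> H" "\<And>x. x \<in> H \<Longrightarrow> f x \<noteq> 0"
    "\<And>x y. x \<in> H \<Longrightarrow> y \<in> H \<Longrightarrow> f (x + y) = f x * f y" using a by auto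
  show n: "\<And>x. x \<in> H \<Longrightarrow> - x \<in> H" using 1(1,2) by (metis diff_0)
  show "x + y \<in> H" if "x \<in> H" "y \<in> H" for x y using 1(2)[of x "- y"] n that by simp
  show "f 0 = 1" using 1(4)[of 0 0] 1(1,3) by simp
qed

lemma hom_on_int_mult:
  assumes "hom_on H f" "x \<in> H"
  shows "int_mult n x \<in> H" "f (int_mult n x) = f x powi n"
proof -
  note H = hom_onD[OF assms(1)]
  have *: "int_mult (int k) x \<in> H \<and> f (int_mult (int k) x) = f x ^ k" for k
    by (induction k) (auto simp: H int_mult_add assms)
  have neg: "f (- y) = inverse (f y)" if "y \<in> H" for y
    using H(6)[of y "- y"] H(4,5,7) that by (simp add: field_simps)
  consider k where "n = int k" | k where "n = - int k" by (metis int_cases2)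
  then have "int_mult n x \<in> H \<and> f (int_mult n x) = f x powi n"
  proof cases
    case 1 then show ?thesis using * by simp
  next
    case 2 then show ?thesis using * H(4) neg by (simp add: int_mult_minus power_int_minus)
  qed
  then show "int_mult n x \<in> H" "f (int_mult n x) = f x powi n" by auto
qed

text \<open>The integers \<open>n\<close> with \<open>n g \<in> H\<close> form an ideal.\<close>

lemma least_multiple_dvd:
  assumes f: "hom_on H f" and n: "int_mult n g \<in> H"
    and k: "k > 0" "int_mult (int k) g \<in> H"
    and min: "\<And>j. j > 0 \<Longrightarrow> int_mult (int j) g \<in> H \<Longrightarrow> k \<le> j"
  shows "int k dvd n"
proof -
  have e: "n = n div int k * int k + n mod int k" by simp
  have "int_mult (n mod int k) g = int_mult n g - int_mult (n div int k) (int_mult (int k) g)"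
    using e by (metis int_mult_int_mult add_diff_cancel_left' int_mult_diff)
  then have "int_mult (n mod int k) g \<in> H"
    using hom_onD(2)[OF f n hom_on_int_mult(1)[OF f k(2)]] by simp
  then have "n mod int k = 0"
  proof (rule contrapos_pp)
    assume "n mod int k \<noteq> 0"
    then have "n mod int k > 0" "n mod int k < int k"
      using pos_mod_bound[of "int k" n] pos_mod_sign[of "int k" n] k(1) by linarith+
    then show "int_mult (n mod int k) g \<notin> H" using min[of "nat (n mod int k)"] by auto
  qed
  then show ?thesis by (simp add: dvd_eq_mod_eq_0)
qed

text \<open>The extension is \<open>h + n g \<mapsto> f h * u ^ n\<close>; the condition on \<open>u\<close> is exactly what makes it well
defined.\<close>

lemma hom_on_extend_one_to:
  assumes f: "hom_on H f" and u: "u \<noteq> 0"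
    and c: "\<And>n. int_mult n g \<in> H \<Longrightarrow> f (int_mult n g) = u powi n"
  shows "\<exists>H' f'. hom_on H' f' \<and> H \<subseteq> H' \<and> g \<in> H' \<and> f' g = u \<and> (\<forall>x\<in>H. f' x = f x)"
proof -
  note H = hom_onD[OF f]
  define H' where "H' = {h + int_mult n g | h n. h \<in> H}"
  define f' where "f' x = (let p = SOME p. fst p \<in> H \<and> x = fst p + int_mult (snd p) g
    in f (fst p) * u powi snd p)" for x
  have key: "f' (h + int_mult n g) = f h * u powi n" if h: "h \<in> H" for h n
  proof -
    define p where "p = (SOME p. fst p \<in> H \<and> h + int_mult n g = fst p + int_mult (snd p) g)"
    have p: "fst p \<in> H" "h + int_mult n g = fst p + int_mult (snd p) g"
      using someI[of "\<lambda>p. fst p \<in> H \<and> h + int_mult n g = fst p + int_mult (snd p) g" "(h, n)"] h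
      unfolding p_def by auto
    have d: "int_mult (snd p - n) g = h - fst p"
      using p(2) by (simp add: int_mult_diff algebra_simps)
    have "f h = f (fst p + int_mult (snd p - n) g)" by (simp add: d)
    also have "\<dots> = f (fst p) * u powi (snd p - n)"
      using H(2)[OF h p(1)] d H(6)[OF p(1)] c[of "snd p - n"] by metis
    finally have "f h * u powi n = f (fst p) * (u powi (snd p - n) * u powi n)" by simp
    also have "u powi (snd p - n) * u powi n = u powi (snd p)"
      using u by (simp add: power_int_add[symmetric])
    finally show ?thesis unfolding f'_def p_def[symmetric] by (simp add: Let_def)
  qed
  have sub: "h \<in> H'" if "h \<in> H" for h
    using that unfolding H'_def by (metis (mono_tags, lifting) add.right_neutral int_mult_0 mem_Collect_eq)
  have gH: "g \<in> H'" using H(1) unfolding H'_def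
    by (metis (mono_tags, lifting) add.left_neutral int_mult_1 mem_Collect_eq)
  have "hom_on H' f'"
    unfolding hom_on_def
  proof (intro conjI ballI)
    show "0 \<in> H'" using sub H(1) .
    fix x assume "x \<in> H'"
    then obtain h n where x: "h \<in> H" "x = h + int_mult n g" unfolding H'_def by auto
    show "f' x \<noteq> 0" using key[OF x(1)] x(2) H(5)[OF x(1)] u by simp
    fix y assume "y \<in> H'"
    then obtain k m where y: "k \<in> H" "y = k + int_mult m g" unfolding H'_def by auto
    have "x - y = (h - k) + int_mult (n - m) g" using x y by (simp add: int_mult_diff algebra_simps)
    then show "x - y \<in> H'" using H(2)[OF x(1) y(1)] unfolding H'_def by blast
    have "x + y = (h + k) + int_mult (n + m) g" using x y by (simp add: int_mult_add algebra_simps)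
    then have "f' (x + y) = f (h + k) * u powi (n + m)" using key[OF H(3)[OF x(1) y(1)]] by simp
    then show "f' (x + y) = f' x * f' y"
      using key[OF x(1)] key[OF y(1)] x(2) y(2) H(6)[OF x(1) y(1)] u by (simp add: power_int_add)
  qed
  moreover have "f' x = f x" if "x \<in> H" for x using key[OF that, of 0] by simp
  moreover have "f' g = u" using key[OF H(1), of 1] H(7) by simp
  ultimately show ?thesis using sub gH by blast
qed

text \<open>If no nonzero multiple of \<open>g\<close> lies in \<open>H\<close>, any value will do at \<open>g\<close>.  Otherwise a \<open>k\<close>-th root of
\<open>f (k g)\<close> is needed, where \<open>k g\<close> is the least positive multiple in \<open>H\<close>.\<close>

lemma hom_on_extend_one:
  assumes f: "hom_on H f"
  shows "\<exists>H' f'. hom_on H' f' \<and> H \<subseteq> H' \<and> g \<in> H' \<and> (\<forall>x\<in>H. f' x = f x)"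
proof -
  note H = hom_onD[OF f]
  have "\<exists>u. u \<noteq> 0 \<and> (\<forall>n. int_mult n g \<in> H \<longrightarrow> f (int_mult n g) = u powi n)"
  proof (cases "\<exists>k::nat. k > 0 \<and> int_mult (int k) g \<in> H")
    case False
    have "n = 0" if "int_mult n g \<in> H" for n
    proof (rule ccontr)
      assume "n \<noteq> 0"
      then have "int_mult (int (nat \<bar>n\<bar>)) g \<in> H" "nat \<bar>n\<bar> > 0"
        using that H(4)[OF that] by (auto simp: abs_if int_mult_minus)
      then show False using False by blast
    qed
    then show ?thesis using H(7) by (intro exI[of _ 1]) fastforce
  next
    case True
    define k where "k = (LEAST k::nat. k > 0 \<and> int_mult (int k) g \<in> H)"
    have k: "k > 0" "int_mult (int k) g \<in> H"
      using LeastI_ex[OF True] unfolding k_def by auto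
    have min: "k \<le> j" if "j > 0" "int_mult (int j) g \<in> H" for j
      unfolding k_def using that by (intro Least_le) auto
    define w where "w = f (int_mult (int k) g)"
    define u where "u = exp (Ln w / of_nat k)"
    have w: "w \<noteq> 0" using H(5) k(2) w_def by auto
    have uk: "u ^ k = w" using k(1) w by (simp add: u_def exp_of_nat_mult[symmetric])
    have "f (int_mult n g) = u powi n" if n: "int_mult n g \<in> H" for n
    proof -
      have n': "n = n div int k * int k"
        using least_multiple_dvd[OF f n k min] by simp
      have "f (int_mult n g) = w powi (n div int k)"
        using hom_on_int_mult(2)[OF f k(2), of "n div int k"] n' unfolding w_def
        by (simp add: int_mult_int_mult)
      also have "\<dots> = u powi (n div int k * int k)"
        unfolding uk[symmetric] by (simp add: power_int_mult mult.commute[of _ "int k"])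
      finally show ?thesis using n' by simp
    qed
    moreover have "u \<noteq> 0" by (simp add: u_def)
    ultimately show ?thesis by blast
  qed
  then obtain u where "u \<noteq> 0" "\<And>n. int_mult n g \<in> H \<Longrightarrow> f (int_mult n g) = u powi n" by blast
  from hom_on_extend_one_to[OF f this] show ?thesis by blast
qed

text \<open>The elements of the countable group are adjoined one after another.\<close>

lemma hom_on_extend:
  fixes f :: "'g::{ab_group_add,countable} \<Rightarrow> complex"
  assumes f: "hom_on H f"
  shows "\<exists>F. hom_on UNIV F \<and> (\<forall>x\<in>H. F x = f x)"
proof -
  define P where "P n p \<longleftrightarrow> hom_on (fst p) (snd p) \<and> H \<subseteq> fst p \<and> (\<forall>x\<in>H. snd p x = f x)"
    for n :: nat and p :: "'g set \<times> ('g \<Rightarrow> complex)"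
  define Q where "Q n p q \<longleftrightarrow> fst p \<subseteq> fst q \<and> from_nat n \<in> fst q \<and> (\<forall>x\<in>fst p. snd q x = snd p x)"
    for n :: nat and p q :: "'g set \<times> ('g \<Rightarrow> complex)"
  have "\<exists>p. P 0 p" using f unfolding P_def by (intro exI[of _ "(H, f)"]) auto
  moreover have "\<exists>q. P (Suc n) q \<and> Q n p q" if "P n p" for n p
  proof -
    obtain H' f' where "hom_on H' f'" "fst p \<subseteq> H'" "from_nat n \<in> H'" "\<forall>x\<in>fst p. f' x = snd p x"
      using hom_on_extend_one[of "fst p" "snd p" "from_nat n"] \<open>P n p\<close> unfolding P_def by blast
    then show ?thesis using that unfolding P_def Q_def by (intro exI[of _ "(H', f')"]) auto
  qed
  ultimately obtain p where p: "\<And>n. P n (p n)" "\<And>n. Q n (p n) (p (Suc n))"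
    using dependent_nat_choice[of P Q] by blast
  have mono: "fst (p m) \<subseteq> fst (p n) \<and> (\<forall>x\<in>fst (p m). snd (p n) x = snd (p m) x)" if "m \<le> n" for m n
    using that by (induction rule: dec_induct) (use p(2) in \<open>auto simp: Q_def subset_iff\<close>)
  have mem: "x \<in> fst (p n)" if "n > to_nat x" for x :: 'g and n
    using p(2)[of "to_nat x"] mono[of "Suc (to_nat x)" n] that unfolding Q_def by auto
  define F where "F x = snd (p (Suc (to_nat x))) x" for x
  have F: "F x = snd (p n) x" if "n > to_nat x" for x n
    using mono[of "Suc (to_nat x)" n] mem[of x "Suc (to_nat x)"] that unfolding F_def by auto
  have hom: "hom_on (fst (p n)) (snd (p n))" for n using p(1) P_def by auto
  have "hom_on UNIV F"
    unfolding hom_on_def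
  proof (intro conjI ballI)
    fix x y :: 'g
    show "F x \<noteq> 0" unfolding F_def using hom_onD(5)[OF hom mem] by blast
    define n where "n = Suc (to_nat x + to_nat y + to_nat (x + y))"
    have "n > to_nat x" "n > to_nat y" "n > to_nat (x + y)" unfolding n_def by auto
    then show "F (x + y) = F x * F y" using F hom_onD(6)[OF hom mem mem] by metis
  qed auto
  moreover have "F x = f x" if "x \<in> H" for x using p(1) that unfolding F_def P_def by auto
  ultimately show ?thesis by (intro exI[of _ F]) auto
qed

lemma dualD:
  assumes "\<gamma> \<in> dual"
  shows "cmod (\<gamma> g) = 1" "\<gamma> (g + h) = \<gamma> g * \<gamma> h" "\<gamma> 0 = 1" "\<gamma> (- g) = cnj (\<gamma> g)"
    "\<gamma> (g - h) = \<gamma> g * cnj (\<gamma> h)" "\<gamma> (int_mult n g) = \<gamma> g powi n"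
proof -
  note a = assms[unfolded dual_def]
  show 1: "cmod (\<gamma> g) = 1" "\<gamma> (g + h) = \<gamma> g * \<gamma> h" for g h using a by auto
  have nz: "\<gamma> g \<noteq> 0" for g using 1(1)[of g] by auto
  show 0: "\<gamma> 0 = 1" using 1(2)[of 0 0] nz[of 0] by simp
  show m: "\<gamma> (- g) = cnj (\<gamma> g)" for g
  proof -
    have "\<gamma> g * \<gamma> (- g) = 1" using 1(2)[of g "- g"] 0 by simp
    moreover have "\<gamma> g * cnj (\<gamma> g) = 1"
      using 1(1)[of g] by (simp add: complex_norm_square[symmetric])
    ultimately show ?thesis using nz[of g] by (metis mult_left_cancel)
  qed
  show "\<gamma> (g - h) = \<gamma> g * cnj (\<gamma> h)" using 1(2)[of g "- h"] m by simp
  have "hom_on UNIV \<gamma>" unfolding hom_on_def using 1 nz by auto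
  from hom_on_int_mult(2)[OF this] show "\<gamma> (int_mult n g) = \<gamma> g powi n" by simp
qed

text \<open>Division by the absolute value turns an extension to the nonzero complex numbers into a
character.\<close>

lemma dual_extend:
  fixes f :: "'g::{ab_group_add,countable} \<Rightarrow> complex"
  assumes f: "hom_on H f" "\<And>x. x \<in> H \<Longrightarrow> cmod (f x) = 1" and u: "cmod u = 1"
    and c: "\<And>n. int_mult n g \<in> H \<Longrightarrow> f (int_mult n g) = u powi n"
  shows "\<exists>\<gamma>\<in>dual. (\<forall>x\<in>H. \<gamma> x = f x) \<and> \<gamma> g = u"
proof -
  have "u \<noteq> 0" using u by auto
  from hom_on_extend_one_to[OF f(1) this c] obtain H' f' where
    f': "hom_on H' f'" "H \<subseteq> H'" "g \<in> H'" "f' g = u" "\<forall>x\<in>H. f' x = f x" by blast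
  from hom_on_extend[OF f'(1)] obtain F where F: "hom_on UNIV F" "\<forall>x\<in>H'. F x = f' x" by blast
  define \<gamma> where "\<gamma> x = F x / of_real (cmod (F x))" for x
  note D = hom_onD[OF F(1)]
  have "\<gamma> \<in> dual" unfolding dual_def \<gamma>_def using D(5,6) by (auto simp: norm_divide norm_mult)
  moreover have "\<gamma> x = f x" if "x \<in> H" for x
  proof -
    have "F x = f x" using that F(2) f'(2,5) by auto
    then show ?thesis using f(2)[OF that] by (simp add: \<gamma>_def)
  qed
  moreover have "\<gamma> g = u" using F(2) f'(3,4) u by (simp add: \<gamma>_def)
  ultimately show ?thesis by (intro bexI[of _ \<gamma>]) auto
qed

text \<open>The homomorphism that sends \<open>z\<close> to \<open>exp 1\<close> extends to the group, and the
logarithm of its modulus is additive.\<close>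

lemma real_hom_exists:
  fixes z :: "'g::{ab_group_add,countable}"
  assumes z: "\<And>n. n \<noteq> 0 \<Longrightarrow> int_mult n z \<noteq> 0"
  shows "\<exists>\<psi> :: 'g \<Rightarrow> real. (\<forall>x y. \<psi> (x + y) = \<psi> x + \<psi> y) \<and> \<psi> z = 1"
proof -
  have "hom_on {0} (\<lambda>_. 1 :: complex)" by (auto simp: hom_on_def)
  moreover have "1 = exp (1::complex) powi n" if "int_mult n z \<in> {0}" for n
    using z[of n] that by (cases "n = 0") auto
  ultimately obtain H' f' where f': "hom_on H' f'" "z \<in> H'" "f' z = exp 1"
    using hom_on_extend_one_to[of "{0}" "\<lambda>_. 1" "exp 1" z] by (metis exp_not_eq_zero)
  from hom_on_extend[OF f'(1)] obtain F where F: "hom_on UNIV F" "\<forall>x\<in>H'. F x = f' x" by blast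
  note D = hom_onD[OF F(1)]
  show ?thesis
    using D(5,6) F(2) f'(2,3)
    by (intro exI[of _ "\<lambda>x. ln (cmod (F x))"]) (simp add: norm_mult ln_mult)
qed

section \<open>Characters with prescribed values\<close>

lemma cmod_cis_diff_le: "cmod (cis x - cis y) \<le> \<bar>x - y\<bar>"
proof -
  have "cis x - cis y = cis y * (cis (x - y) - 1)" by (simp add: algebra_simps cis_mult)
  then have "cmod (cis x - cis y) = cmod (exp (\<i> * of_real (x - y)) - 1)"
    by (simp add: norm_mult cis_conv_exp)
  also have "\<dots> = 2 * \<bar>sin ((x - y) / 2)\<bar>" by (rule dist_exp_i_1)
  also have "\<dots> \<le> \<bar>x - y\<bar>" using abs_sin_x_le_abs_x[of "(x - y) / 2"] by simp
  finally show ?thesis .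
qed

lemma cmod_cis_diff_1_le: "cmod (cis x - 1) \<le> \<bar>x\<bar>"
  using cmod_cis_diff_le[of x 0] by simp

lemma cmod_mult_diff_le:
  fixes a b c d :: complex
  assumes "cmod b \<le> 1" "cmod c \<le> 1"
  shows "cmod (a * b - c * d) \<le> cmod (a - c) + cmod (b - d)"
proof -
  have "a * b - c * d = (a - c) * b + c * (b - d)" by (simp add: algebra_simps)
  also have "cmod \<dots> \<le> cmod (a - c) * cmod b + cmod c * cmod (b - d)"
    by (metis norm_mult norm_triangle_ineq)
  also have "\<dots> \<le> cmod (a - c) * 1 + 1 * cmod (b - d)"
    using assms by (intro add_mono mult_left_mono mult_right_mono) auto
  finally show ?thesis by simp
qed

text \<open>Rounding down the argument costs at most one step of the subdivision of the circle.\<close>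

lemma near_root_of_unity:
  assumes u: "cmod u = 1" and M: "M > 0"
  shows "\<exists>y<M. cmod (u - cis (2 * pi * real y / real M)) \<le> 2 * pi / real M"
proof -
  define t where "t = Arg2pi u"
  have t: "0 \<le> t" "t < 2 * pi" "u = cis t"
    using Arg2pi[of u] u by (auto simp: t_def cis_conv_exp is_Arg_def)
  define y where "y = nat \<lfloor>real M * t / (2 * pi)\<rfloor>"
  define s where "s = real M * t / (2 * pi)"
  have s: "0 \<le> s" "s < real M" using t M by (auto simp: s_def field_simps)
  have y: "real y \<le> s" "s < real y + 1" using s(1) unfolding y_def s_def by linarith+
  have ts: "t = 2 * pi * s / real M" using M by (simp add: s_def)
  have "cmod (u - cis (2 * pi * real y / real M)) \<le> \<bar>t - 2 * pi * real y / real M\<bar>"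
    unfolding t(3) by (rule cmod_cis_diff_le)
  also have "t - 2 * pi * real y / real M = 2 * pi * (s - real y) / real M"
    unfolding ts by (simp add: algebra_simps diff_divide_distrib)
  also have "\<bar>\<dots>\<bar> \<le> 2 * pi / real M"
    using y M by (simp add: abs_mult divide_right_mono)
  finally show ?thesis using y s(2) by (intro exI[of _ y]) auto
qed

text \<open>Dirichlet's theorem on simultaneous approximation, applied to the arguments of the values at
\<open>g\<close>.  Its bound on the multiplier does not depend on \<open>g\<close>, which is essential for torsion groups.\<close>

lemma simultaneous_small_multiple:
  assumes fin: "finite \<Gamma>" and \<Gamma>: "\<Gamma> \<subseteq> dual" and \<eta>: "\<eta> > 0"
  shows "\<exists>L\<ge>1. \<forall>g. \<exists>l::nat. 1 \<le> l \<and> l \<le> L \<and> (\<forall>\<gamma>\<in>\<Gamma>. cmod (\<gamma> (int_mult (int l) g) - 1) < \<eta>)"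
proof -
  obtain N :: nat where N: "real N > 2 * pi / \<eta>" using reals_Archimedean2 by blast
  have Npos: "N > 0" using N \<eta> pi_gt_zero by (metis divide_pos_pos gr0I less_asym of_nat_0 zero_less_mult_iff zero_less_numeral)
  obtain h where h: "\<Gamma> = h ` {..<card \<Gamma>}"
    using ex_bij_betw_nat_finite[OF fin] by (metis bij_betw_def lessThan_atLeast0)
  have "\<exists>l::nat. 1 \<le> l \<and> l \<le> N ^ card \<Gamma> \<and> (\<forall>\<gamma>\<in>\<Gamma>. cmod (\<gamma> (int_mult (int l) g) - 1) < \<eta>)" for g
  proof -
    define \<theta> where "\<theta> i = Arg (h i g) / (2 * pi)" for i
    obtain q p where q: "0 < q" "q \<le> int (N ^ card \<Gamma>)"
      and a: "\<And>i. i < card \<Gamma> \<Longrightarrow> \<bar>of_int q * \<theta> i - of_int (p i)\<bar> < 1 / N"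
      using Dirichlet_approx_simult[OF Npos, of "card \<Gamma>" \<theta>] by blast
    have "cmod (\<gamma> (int_mult q g) - 1) < \<eta>" if "\<gamma> \<in> \<Gamma>" for \<gamma>
    proof -
      obtain i where i: "i < card \<Gamma>" "\<gamma> = h i" using h \<open>\<gamma> \<in> \<Gamma>\<close> by (metis imageE lessThan_iff)
      have d: "\<gamma> \<in> dual" using that \<Gamma> by auto
      have "\<gamma> g \<noteq> 0" using dualD(1)[OF d, of g] by auto
      then have "\<gamma> g = cis (2 * pi * \<theta> i)"
        using cis_Arg[of "\<gamma> g"] dualD(1)[OF d, of g] by (simp add: \<theta>_def i(2) sgn_div_norm)
      then have "\<gamma> (int_mult q g) = cis (2 * pi * (of_int q * \<theta> i))"
        by (simp add: dualD(6)[OF d] cis_power_int mult_ac)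
      also have "\<dots> = cis (2 * pi * (of_int q * \<theta> i - of_int (p i))) * cis (2 * pi * of_int (p i))"
        unfolding cis_mult by (simp add: algebra_simps)
      also have "cis (2 * pi * of_int (p i)) = 1" by (rule cis_multiple_2pi) auto
      finally have "cmod (\<gamma> (int_mult q g) - 1) \<le> \<bar>2 * pi * (of_int q * \<theta> i - of_int (p i))\<bar>"
        using cmod_cis_diff_1_le by simp
      also have "\<dots> = 2 * pi * \<bar>of_int q * \<theta> i - of_int (p i)\<bar>" by (simp add: abs_mult)
      also have "\<dots> \<le> 2 * pi * (1 / N)" using a[OF i(1)] by (intro mult_left_mono) auto
      also have "\<dots> < \<eta>" using N \<eta> Npos by (simp add: field_simps)
      finally show ?thesis .
    qed
    then show ?thesis using q by (intro exI[of _ "nat q"]) (auto simp: nat_le_iff)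
  qed
  moreover have "N ^ card \<Gamma> \<ge> 1" using Npos by simp
  ultimately show ?thesis by blast
qed

text \<open>One new coordinate of a cube: \<open>\<theta>\<close> is invisible on the given finite set \<open>E\<close>, the given characters
do not see \<open>g\<close>, and \<open>\<theta>\<close> turns \<open>g\<close> by \<open>1 / M\<close> of a full turn.\<close>

definition free_directions :: "'g::ab_group_add itself \<Rightarrow> nat \<Rightarrow> bool" where
  "free_directions _ M \<longleftrightarrow> (\<forall>E \<Gamma> \<eta>. finite E \<longrightarrow> finite \<Gamma> \<longrightarrow> \<Gamma> \<subseteq> dual \<longrightarrow> \<eta> > 0 \<longrightarrow>
     (\<exists>\<theta>\<in>dual. \<exists>g::'g. (\<forall>e\<in>E. cmod (\<theta> e - 1) < \<eta>) \<and> (\<forall>\<gamma>\<in>\<Gamma>. cmod (\<gamma> g - 1) < \<eta>) \<and>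
        cmod (\<theta> g - cis (2 * pi / real M)) < \<eta>))"

text \<open>A homomorphism to the reals that is 1 at \<open>z\<close> gives arbitrarily slow rotations, which are close
to 1 on \<open>E\<close>; a large multiple of \<open>z\<close> that is nearly invisible to \<open>\<Gamma>\<close> compensates for the slowness.\<close>

lemma free_directions_infinite_order:
  fixes z :: "'g::{ab_group_add,countable}"
  assumes z: "\<And>n. n \<noteq> 0 \<Longrightarrow> int_mult n z \<noteq> 0" and M: "M > 0"
  shows "free_directions TYPE('g) M"
  unfolding free_directions_def
proof (intro allI impI)
  fix E :: "'g set" and \<Gamma> :: "('g \<Rightarrow> complex) set" and \<eta> :: real
  assume fin: "finite E" "finite \<Gamma>" and \<Gamma>: "\<Gamma> \<subseteq> dual" and \<eta>: "\<eta> > 0"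
  obtain \<psi> :: "'g \<Rightarrow> real" where \<psi>: "\<And>x y. \<psi> (x + y) = \<psi> x + \<psi> y" "\<psi> z = 1"
    using real_hom_exists[OF z] by blast
  define B where "B = (\<Sum>e\<in>E. \<bar>\<psi> e\<bar>)"
  have B: "B \<ge> 0" "\<And>e. e \<in> E \<Longrightarrow> \<bar>\<psi> e\<bar> \<le> B"
    unfolding B_def using fin by (auto intro: sum_nonneg member_le_sum)
  obtain P :: nat where P: "real P > 2 * pi * B / \<eta>" using reals_Archimedean2 by blast
  have P0: "P > 0" using P B \<eta> pi_gt_zero
    by (metis divide_nonneg_pos gr0I less_eq_real_def mult_nonneg_nonneg not_less of_nat_0 zero_le_numeral)
  obtain l :: nat where l: "l \<ge> 1" "\<And>\<gamma>. \<gamma> \<in> \<Gamma> \<Longrightarrow> cmod (\<gamma> (int_mult (int l) (int_mult (int P) z)) - 1) < \<eta>"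
    using simultaneous_small_multiple[OF fin(2) \<Gamma> \<eta>] by meson
  define g where "g = int_mult (int (l * P)) z"
  define D where "D = real M * real (l * P)"
  \<comment> \<open>Slow enough to be close to 1 on \<open>E\<close>, and turning \<open>g\<close> by exactly \<open>1 / M\<close> since \<open>\<psi> g = l * P\<close>.\<close>
  define \<theta> where "\<theta> x = cis (2 * pi * \<psi> x / D)" for x
  have D: "D \<ge> real P" "D > 0"
  proof -
    have "1 * (1 * real P) \<le> real M * (real l * real P)"
      using M l(1) by (intro mult_mono) auto
    then show "D \<ge> real P" by (simp add: D_def)
    then show "D > 0" using P0 by linarith
  qed
  have "\<theta> \<in> dual" unfolding dual_def \<theta>_def
    by (auto simp: \<psi> cis_mult add_divide_distrib algebra_simps)
  have \<psi>n: "\<psi> (int_mult (int n) z) = real n" for n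
  proof (induction n)
    case 0 show ?case using \<psi>(1)[of 0 0] by simp
  next
    case (Suc n) then show ?case by (simp add: int_mult_add \<psi>)
  qed
  have "\<theta> g = cis (2 * pi / real M)"
  proof -
    have "2 * pi * \<psi> g / D = 2 * pi / real M"
      unfolding g_def \<psi>n D_def using l(1) P0 by (simp del: of_nat_mult add: field_simps)
    then show ?thesis by (simp add: \<theta>_def)
  qed
  moreover have "cmod (\<gamma> g - 1) < \<eta>" if "\<gamma> \<in> \<Gamma>" for \<gamma>
    using l(2)[OF that] by (simp add: g_def int_mult_int_mult)
  moreover have "cmod (\<theta> e - 1) < \<eta>" if "e \<in> E" for e
  proof -
    have "cmod (\<theta> e - 1) \<le> \<bar>2 * pi * \<psi> e / D\<bar>" unfolding \<theta>_def by (rule cmod_cis_diff_1_le)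
    also have "\<dots> = 2 * pi * \<bar>\<psi> e\<bar> / D" using D(2) by (simp add: abs_mult)
    also have "\<dots> \<le> 2 * pi * B / real P"
      using B(2)[OF that] D(1) B(1) P0 by (intro frac_le mult_left_mono mult_nonneg_nonneg) auto
    also have "\<dots> < \<eta>" using P P0 \<eta> by (simp add: field_simps)
    finally show ?thesis .
  qed
  ultimately show "\<exists>\<theta>\<in>dual. \<exists>g. (\<forall>e\<in>E. cmod (\<theta> e - 1) < \<eta>) \<and> (\<forall>\<gamma>\<in>\<Gamma>. cmod (\<gamma> g - 1) < \<eta>) \<and>
        cmod (\<theta> g - cis (2 * pi / real M)) < \<eta>"
    using \<open>\<theta> \<in> dual\<close> \<eta> by (intro bexI[of _ \<theta>] exI[of _ g]) auto
qed

text \<open>All of \<open>E\<close> is killed by some \<open>m\<close>, so characters trivial on the \<open>m\<close>-torsion \<open>H\<close> are trivial on \<open>E\<close>.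
Since the exponent is infinite there is an element of large order modulo \<open>H\<close> that is nearly
invisible to \<open>\<Gamma>\<close>, and a character can send it close to any point of the circle.\<close>

lemma free_directions_torsion:
  fixes M :: nat
  assumes inf: "infinite_exponent TYPE('g::{ab_group_add,countable})"
    and tors: "\<And>z::'g. \<exists>n. n \<noteq> 0 \<and> int_mult n z = 0" and M: "M > 0"
  shows "free_directions TYPE('g) M"
  unfolding free_directions_def
proof (intro allI impI)
  fix E :: "'g set" and \<Gamma> :: "('g \<Rightarrow> complex) set" and \<eta> :: real
  assume fin: "finite E" "finite \<Gamma>" and \<Gamma>: "\<Gamma> \<subseteq> dual" and \<eta>: "\<eta> > 0"
  have "\<exists>k::nat. k > 0 \<and> int_mult (int k) z = 0" for z :: 'g
  proof -
    obtain n where n: "n \<noteq> 0" "int_mult n z = 0" using tors by blast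
    then have "int_mult (int (nat \<bar>n\<bar>)) z = 0" by (auto simp: abs_if int_mult_minus)
    then show ?thesis using n(1) by (intro exI[of _ "nat \<bar>n\<bar>"]) auto
  qed
  then obtain k :: "'g \<Rightarrow> nat" where k: "\<And>z. k z > 0" "\<And>z. int_mult (int (k z)) z = 0" by metis
  define m where "m = (\<Prod>e\<in>E. k e)"
  have m: "m > 0" "int_mult (int m) e = 0" if "e \<in> E" for e
  proof -
    show "m > 0" unfolding m_def using k by (simp add: prod_pos)
    have "m = (\<Prod>x\<in>E - {e}. k x) * k e" unfolding m_def using fin that by (simp add: prod.remove mult.commute)
    then show "int_mult (int m) e = 0" using k(2)[of e] by (simp add: int_mult_int_mult[symmetric])
  qed
  have m0: "m > 0" unfolding m_def using k by (simp add: prod_pos)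
  obtain L where L: "L \<ge> 1" "\<And>g::'g. \<exists>l::nat. 1 \<le> l \<and> l \<le> L \<and> (\<forall>\<gamma>\<in>\<Gamma>. cmod (\<gamma> (int_mult (int l) g) - 1) < \<eta>)"
    using simultaneous_small_multiple[OF fin(2) \<Gamma> \<eta>] by blast
  obtain P :: nat where P: "real P > 2 * pi / \<eta>" using reals_Archimedean2 by blast
  \<comment> \<open>An element with no nonzero multiple up to \<open>B\<close> keeps an order above \<open>P\<close> when it is multiplied by \<open>l \<le> L\<close> and reduced modulo \<open>H\<close>.\<close>
  define B where "B = m * L * P"
  obtain g0 :: 'g where g0: "int_mult (int (fact B)) g0 \<noteq> 0"
    using inf unfolding infinite_exponent_def int_mult_of_nat by (metis fact_ge_1)
  have big: "int_mult (int j) g0 \<noteq> 0" if "1 \<le> j" "j \<le> B" for j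
  proof
    assume "int_mult (int j) g0 = 0"
    moreover have "j dvd fact B" using that by (intro dvd_fact) auto
    then obtain c where "fact B = j * c" by blast
    ultimately show False using g0 by (simp add: mult.commute int_mult_int_mult[symmetric])
  qed
  obtain l :: nat where l: "1 \<le> l" "l \<le> L" "\<forall>\<gamma>\<in>\<Gamma>. cmod (\<gamma> (int_mult (int l) g0) - 1) < \<eta>"
    using L(2)[of g0] by blast
  define g where "g = int_mult (int l) g0"
  define H where "H = {x::'g. int_mult (int m) x = 0}"
  have H: "hom_on H (\<lambda>_. 1)"
  proof -
    have "int_mult (int m) (x - y) = int_mult (int m) x - int_mult (int m) y" for x y :: 'g
      using int_mult_distrib[of "int m" "x - y" y] by (simp add: algebra_simps)
    then show ?thesis unfolding hom_on_def H_def by auto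
  qed
  define Q where "Q j \<longleftrightarrow> j > 0 \<and> int_mult (int j) g \<in> H" for j :: nat
  have "Q (k g)" unfolding Q_def H_def using k by auto
  define d where "d = (LEAST j. Q j)"
  have d: "d > 0" "int_mult (int d) g \<in> H" using LeastI[of Q, OF \<open>Q (k g)\<close>] unfolding d_def[symmetric] by (auto simp: Q_def)
  have min: "d \<le> j" if "j > 0" "int_mult (int j) g \<in> H" for j
    unfolding d_def using that by (intro Least_le) (auto simp: Q_def)
  have "d > P"
  proof (rule ccontr)
    assume "\<not> d > P"
    then have "m * l * d \<le> B" unfolding B_def using l(2) by (intro mult_mono) auto
    moreover have "int_mult (int (m * l * d)) g0 = 0"
      using d(2) unfolding H_def g_def by (simp add: int_mult_int_mult mult_ac)
    moreover have "m * l * d \<ge> 1" using m0 l(1) d(1) by (simp add: Suc_le_eq)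
    ultimately show False using big by blast
  qed
  \<comment> \<open>The \<open>d\<close>-th root of unity with index \<open>c\<close> approximates \<open>1 / M\<close> of a turn, with error at most \<open>1 / d\<close>.\<close>
  define c where "c = d div M"
  have "\<bar>real c / real d - 1 / real M\<bar> \<le> 1 / real d"
  proof -
    have "d = M * c + d mod M" by (simp add: c_def)
    then have "real d = real M * real c + real (d mod M)" by (metis of_nat_add of_nat_mult)
    then have "real c / real d - 1 / real M = - (real (d mod M) / real M) / real d"
      using d(1) M by (simp add: field_simps)
    then have "\<bar>real c / real d - 1 / real M\<bar> = real (d mod M) / real M / real d" by simp
    also have "\<dots> \<le> 1 / real d" using M by (intro divide_right_mono) (auto simp: less_imp_le)
    finally show ?thesis .
  qed
  define u where "u = cis (2 * pi * (real c / real d))"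
  have "\<exists>\<theta>\<in>dual. (\<forall>x\<in>H. \<theta> x = 1) \<and> \<theta> g = u"
  proof (rule dual_extend[OF H])
    fix n assume "int_mult n g \<in> H"
    from least_multiple_dvd[OF H this d min] obtain j where j: "n = int d * j" by blast
    have "u powi n = cis (2 * pi * (real_of_int (int c * j)))"
      unfolding u_def cis_power_int j using d(1) by (simp add: field_simps)
    also have "\<dots> = 1" by (rule cis_multiple_2pi) auto
    finally show "1 = u powi n" by simp
  qed (auto simp: u_def)
  then obtain \<theta> where \<theta>: "\<theta> \<in> dual" "\<And>x. x \<in> H \<Longrightarrow> \<theta> x = 1" "\<theta> g = u" by blast
  have "cmod (\<theta> g - cis (2 * pi / real M)) < \<eta>"
  proof -
    have "cmod (\<theta> g - cis (2 * pi / real M)) \<le> \<bar>2 * pi * (real c / real d) - 2 * pi / real M\<bar>"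
      unfolding \<theta>(3) u_def by (rule cmod_cis_diff_le)
    also have "\<dots> = 2 * pi * \<bar>real c / real d - 1 / real M\<bar>"
    proof -
      have "2 * pi * (real c / real d) - 2 * pi / real M = 2 * pi * (real c / real d - 1 / real M)"
        by (simp add: algebra_simps)
      then show ?thesis by (simp only: abs_mult) simp
    qed
    also have "\<dots> \<le> 2 * pi * (1 / real d)"
      using \<open>\<bar>real c / real d - 1 / real M\<bar> \<le> 1 / real d\<close> by (intro mult_left_mono) auto
    also have "\<dots> < \<eta>"
    proof -
      have "2 * pi < \<eta> * real P" using P \<eta> by (simp add: field_simps)
      also have "\<dots> \<le> \<eta> * real d" using \<open>d > P\<close> \<eta> by simp
      finally show ?thesis using d(1) by (simp add: field_simps)
    qed
    finally show ?thesis .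
  qed
  moreover have "\<theta> e = 1" if "e \<in> E" for e using \<theta>(2) m(2)[OF that] unfolding H_def by auto
  ultimately show "\<exists>\<theta>\<in>dual. \<exists>g. (\<forall>e\<in>E. cmod (\<theta> e - 1) < \<eta>) \<and> (\<forall>\<gamma>\<in>\<Gamma>. cmod (\<gamma> g - 1) < \<eta>) \<and>
        cmod (\<theta> g - cis (2 * pi / real M)) < \<eta>"
    using \<theta>(1) l(3) \<eta> by (intro bexI[of _ \<theta>] exI[of _ g]) (auto simp: g_def)
qed

text \<open>The isomorphism in terms of integer coordinates \<open>co x i n\<close> modulo \<open>q i\<close>; \<open>unit m\<close> has the entry 1
at position \<open>m\<close> of every summand, so that its order is the exponent of the group.\<close>

lemma Sigma_sum_coordinates:
  fixes q :: "nat \<Rightarrow> nat" and r :: nat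
  assumes q: "\<And>i. i \<in> {1..r} \<Longrightarrow> q i \<ge> 2"
    and iso: "(additive_group :: 'g::ab_group_add monoid) \<cong> sum_group {1..r} (\<lambda>i. Sigma_group (q i))"
  obtains co :: "'g::ab_group_add \<Rightarrow> nat \<Rightarrow> nat \<Rightarrow> int" and unit :: "nat \<Rightarrow> 'g::ab_group_add"
  where "\<And>x i n. i \<in> {1..r} \<Longrightarrow> n \<ge> 1 \<Longrightarrow> 0 \<le> co x i n \<and> co x i n < int (q i)"
    and "\<And>x y i n. i \<in> {1..r} \<Longrightarrow> n \<ge> 1 \<Longrightarrow> co (x + y) i n = (co x i n + co y i n) mod int (q i)"
    and "\<And>x y. (\<And>i n. i \<in> {1..r} \<Longrightarrow> n \<ge> 1 \<Longrightarrow> co x i n = co y i n) \<Longrightarrow> x = y"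
    and "\<And>x. \<exists>b. \<forall>n>b. \<forall>i\<in>{1..r}. co x i n = 0"
    and "\<And>m i n. i \<in> {1..r} \<Longrightarrow> n \<ge> 1 \<Longrightarrow> m \<ge> 1 \<Longrightarrow> co (unit m) i n = (if n = m then 1 else 0)"
proof -
  define A where "A = sum_group {1..r} (\<lambda>i. Sigma_group (q i))"
  have grp: "group (Sigma_group k)" for k unfolding Sigma_group_def by (rule sum_group) auto
  have carS: "carrier (Sigma_group k) =
      {x \<in> {1..} \<rightarrow>\<^sub>E carrier (integer_mod_group k). finite {n \<in> {1..}. x n \<noteq> 0}}" for k
    unfolding Sigma_group_def by (simp add: carrier_sum_group)
  obtain \<psi> where \<psi>: "\<psi> \<in> iso (additive_group :: 'g monoid) A" using iso unfolding is_iso_def A_def by blast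
  have \<psi>A: "\<psi> x \<in> carrier A" for x
    using \<psi> unfolding iso_def hom_def by (auto simp: additive_group_def)
  have \<psi>add: "\<psi> (x + y) = \<psi> x \<otimes>\<^bsub>A\<^esub> \<psi> y" for x y
    using \<psi> unfolding iso_def hom_def by (auto simp: additive_group_def)
  have bij: "bij_betw \<psi> UNIV (carrier A)"
    using \<psi> unfolding iso_def by (auto simp: additive_group_def)
  have comp: "\<psi> x \<in> extensional {1..r}" "\<And>i. i \<in> {1..r} \<Longrightarrow> \<psi> x i \<in> extensional {1..}"
    "\<And>i n. i \<in> {1..r} \<Longrightarrow> n \<ge> 1 \<Longrightarrow> \<psi> x i n \<in> carrier (integer_mod_group (q i))"
    "\<And>i. i \<in> {1..r} \<Longrightarrow> finite {n \<in> {1..}. \<psi> x i n \<noteq> 0}" for x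
    using \<psi>A[of x] unfolding A_def carrier_sum_group[OF grp] carS by (auto simp: PiE_iff)
  define v where "v m = (\<lambda>i\<in>{1..r}. \<lambda>n\<in>{1..}. if n = m then 1 else 0 :: int)" for m :: nat
  have vA: "v m \<in> carrier A" for m
  proof -
    have "finite {n \<in> {1..}. (\<lambda>n\<in>{1..}. if n = m then 1 else 0 :: int) n \<noteq> 0}"
      by (rule finite_subset[of _ "{m}"]) (auto split: if_splits)
    moreover have "q i \<noteq> 0" "q i \<noteq> Suc 0" "(1::int) < int (q i)" if "i \<in> {1..r}" for i using q[OF that] by auto
    ultimately show ?thesis
      unfolding A_def carrier_sum_group[OF grp] carS v_def
      by (auto simp: PiE_iff carrier_integer_mod_group)
  qed
  define unit where "unit m = inv_into UNIV \<psi> (v m)" for m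
  have unit: "\<psi> (unit m) = v m" for m
    unfolding unit_def using bij vA[of m] by (simp add: bij_betw_def f_inv_into_f)
  show thesis
  proof (rule that[of \<psi> unit])
    fix x y :: 'g and i n m :: nat
    assume i: "i \<in> {1..r}" and n: "n \<ge> 1"
    show "0 \<le> \<psi> x i n \<and> \<psi> x i n < int (q i)"
      using comp(3)[OF i n, of x] q[OF i] by (auto simp: carrier_integer_mod_group)
    show "\<psi> (x + y) i n = (\<psi> x i n + \<psi> y i n) mod int (q i)"
      unfolding \<psi>add A_def using i n by (simp add: Sigma_group_def)
    assume "m \<ge> 1"
    show "\<psi> (unit m) i n = (if n = m then 1 else 0)"
      using i n by (simp add: unit v_def)
  next
    fix x y :: 'g assume eq: "\<And>i n. i \<in> {1..r} \<Longrightarrow> n \<ge> 1 \<Longrightarrow> \<psi> x i n = \<psi> y i n"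
    have "\<psi> x = \<psi> y"
      by (rule extensionalityI[OF comp(1) comp(1)], rule extensionalityI[OF comp(2) comp(2)])
        (use eq in auto)
    then show "x = y" using bij by (simp add: bij_betw_def inj_eq)
  next
    fix x :: 'g
    have "finite (\<Union>i\<in>{1..r}. {n \<in> {1..}. \<psi> x i n \<noteq> 0})" using comp(4) by blast
    then obtain b where b: "\<And>n. n \<in> (\<Union>i\<in>{1..r}. {n \<in> {1..}. \<psi> x i n \<noteq> 0}) \<Longrightarrow> n \<le> b"
      unfolding finite_nat_set_iff_bounded_le by blast
    show "\<exists>b. \<forall>n>b. \<forall>i\<in>{1..r}. \<psi> x i n = 0"
    proof (intro exI[of _ b] allI impI ballI, rule ccontr)
      fix n i assume "n > b" "i \<in> {1..r}" "\<psi> x i n \<noteq> 0"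
      then show False using b[of n] by fastforce
    qed
  qed
qed

text \<open>Here \<open>M\<close> is the exponent, so that characters take exact \<open>M\<close>-th roots of unity as values.
Infinitely many units have only finitely many patterns of values under \<open>\<Gamma>\<close>, hence the difference of
two of them lies in the kernel of \<open>\<Gamma>\<close>.  It has order \<open>M\<close> modulo the subgroup of elements that
vanish at one far position.\<close>

lemma free_directions_Sigma_sum:
  fixes q :: "nat \<Rightarrow> nat" and r :: nat
  assumes q: "\<And>i. i \<in> {1..r} \<Longrightarrow> q i \<ge> 2"
    and iso: "(additive_group :: 'g::{ab_group_add,countable} monoid) \<cong> sum_group {1..r} (\<lambda>i. Sigma_group (q i))"
    and inf: "infinite (UNIV :: 'g::{ab_group_add,countable} set)"
  shows "\<exists>M\<ge>2. free_directions TYPE('g) M \<and> (\<forall>x::'g. int_mult (int M) x = 0)"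
proof (rule Sigma_sum_coordinates[OF _ iso], goal_cases)
  case (1 i)
  then show ?case by (rule q)
next
  case (2 co unit)
  note range = 2(1) and add = 2(2) and inj = 2(3) and fin = 2(4) and unit = 2(5)
  have modco: "co x i n mod int (q i) = co x i n" if "i \<in> {1..r}" "n \<ge> 1" for x i n
    using range[OF that] by simp
  have zero: "co 0 i n = 0" if "i \<in> {1..r}" "n \<ge> 1" for i n
  proof -
    have "(co 0 i n + 0) mod int (q i) = (co 0 i n + co 0 i n) mod int (q i)"
      using add[OF that, of 0 0] modco[OF that, of 0] by simp
    then have "int (q i) dvd co 0 i n" by (simp add: mod_eq_dvd_iff)
    then show ?thesis using modco[OF that, of 0] by simp
  qed
  have mult: "co (int_mult k x) i n = (k * co x i n) mod int (q i)" if i: "i \<in> {1..r}" "n \<ge> 1" for k x i n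
  proof (induction k rule: int_induct[of _ 0])
    case base show ?case by (simp add: zero[OF i])
  next
    case (step1 k)
    then show ?case by (simp add: int_mult_add add[OF i] mod_simps algebra_simps)
  next
    case (step2 k)
    have "(co (int_mult (k - 1) x) i n + co x i n) mod int (q i) = (k * co x i n) mod int (q i)"
      using add[OF i, of "int_mult (k - 1) x" x] int_mult_add[of "k - 1" 1 x] step2 by simp
    then have "co (int_mult (k - 1) x) i n mod int (q i) = ((k - 1) * co x i n) mod int (q i)"
      by (simp add: mod_eq_dvd_iff algebra_simps)
    then show ?case by (simp add: modco[OF i])
  qed
  define M where "M = Lcm (q ` {1..r})"
  have r: "r \<ge> 1"
  proof (rule ccontr)
    assume "\<not> r \<ge> 1"
    then have "x = y" for x y :: 'g by (intro inj) auto
    then have "UNIV \<subseteq> {0::'g}" by auto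
    then show False using inf finite_subset by blast
  qed
  have M0: "M \<noteq> 0"
  proof -
    have "q i \<noteq> 0" if "i \<in> {1..r}" for i using q[OF that] by simp
    then have "0 \<notin> q ` {1..r}" by (metis imageE)
    then show ?thesis unfolding M_def by (simp add: Lcm_0_iff)
  qed
  have dvd: "q i dvd M" if "i \<in> {1..r}" for i unfolding M_def using that by auto
  have M: "M \<ge> 2" using dvd[of 1] q[of 1] r M0 dvd_imp_le[of "q 1" M] by auto
  have MG: "int_mult (int M) x = 0" for x :: 'g
  proof (rule inj)
    fix i n assume i: "i \<in> {1..r}" "(n::nat) \<ge> 1"
    have "int (q i) dvd int M * co x i n" using dvd[OF i(1)] by auto
    then show "co (int_mult (int M) x) i n = co 0 i n" using mult[OF i] zero[OF i] by simp
  qed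
  have "free_directions TYPE('g) M"
    unfolding free_directions_def
  proof (intro allI impI)
    fix E :: "'g set" and \<Gamma> :: "('g \<Rightarrow> complex) set" and \<eta> :: real
    assume finE: "finite E" and fin\<Gamma>: "finite \<Gamma>" and \<Gamma>: "\<Gamma> \<subseteq> dual" and \<eta>: "\<eta> > 0"
    obtain b where b: "\<And>x n i. n > b x \<Longrightarrow> i \<in> {1..r} \<Longrightarrow> co x i n = 0" using fin by metis
    define B where "B = Suc (\<Sum>e\<in>E. b e)"
    have B: "b e < B" if "e \<in> E" for e
      unfolding B_def using member_le_sum[of e E b] finE that by (simp add: le_imp_less_Suc)
    define R where "R = {z::complex. z ^ M = 1}"
    have "finite R" unfolding R_def using M by (intro finite_roots_unity) auto
    then have "finite (\<Gamma> \<rightarrow>\<^sub>E R)" using fin\<Gamma> by (intro finite_PiE) auto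
    moreover have "(\<lambda>n. \<lambda>\<gamma>\<in>\<Gamma>. \<gamma> (unit n)) ` {B..} \<subseteq> \<Gamma> \<rightarrow>\<^sub>E R"
    proof -
      have "\<gamma> x ^ M = 1" if "\<gamma> \<in> \<Gamma>" for \<gamma> x
        using dualD(6)[of \<gamma> "int M" x] dualD(3)[of \<gamma>] MG[of x] that \<Gamma> by auto
      then show ?thesis unfolding R_def by auto
    qed
    ultimately have "finite ((\<lambda>n. \<lambda>\<gamma>\<in>\<Gamma>. \<gamma> (unit n)) ` {B..})" using finite_subset by blast
    then have "\<not> inj_on (\<lambda>n. \<lambda>\<gamma>\<in>\<Gamma>. \<gamma> (unit n)) {B..}" using finite_imageD infinite_Ici by blast
    then obtain n m where nm: "n \<ge> B" "m \<ge> B" "n \<noteq> m"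
      "(\<lambda>\<gamma>\<in>\<Gamma>. \<gamma> (unit n)) = (\<lambda>\<gamma>\<in>\<Gamma>. \<gamma> (unit m))" unfolding inj_on_def by auto
    have n1: "n \<ge> 1" "m \<ge> 1" using nm B_def by auto
    define g where "g = unit n - unit m"
    define H where "H = {x. \<forall>i\<in>{1..r}. co x i n = 0}"
    have H: "hom_on H (\<lambda>_. 1)"
    proof -
      have "co (x - y) i n = 0" if "i \<in> {1..r}" "co x i n = 0" "co y i n = 0" for x y i
        using add[OF that(1) n1(1), of "x - y" y] that(2,3) modco[OF that(1) n1(1), of "x - y"] by simp
      then show ?thesis unfolding hom_on_def H_def using zero[OF _ n1(1)] by auto
    qed
    have cog: "co g i n = 1" if "i \<in> {1..r}" for i
      using add[OF that n1(1), of g "unit m"] unit[OF that n1(1) n1(1)] unit[OF that n1(1) n1(2)] nm(3)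
        modco[OF that n1(1), of g] by (simp add: g_def)
    have "\<exists>\<theta>\<in>dual. (\<forall>x\<in>H. \<theta> x = 1) \<and> \<theta> g = cis (2 * pi / real M)"
    proof (rule dual_extend[OF H])
      fix k assume k: "int_mult k g \<in> H"
      have "int (q i) dvd k" if "i \<in> {1..r}" for i
        using k mult[OF that n1(1), of k g] cog[OF that] that unfolding H_def by auto
      then have "q i dvd nat \<bar>k\<bar>" if "i \<in> {1..r}" for i
        using that by (simp add: int_dvd_int_iff[symmetric])
      then have "M dvd nat \<bar>k\<bar>" unfolding M_def by (intro Lcm_least) auto
      then have "int M dvd k" by (simp add: int_dvd_int_iff[symmetric])
      then obtain j where j: "k = int M * j" by blast
      have "cis (2 * pi / real M) powi k = cis (2 * pi * real_of_int j)"
        unfolding cis_power_int j using M by (simp add: field_simps)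
      also have "\<dots> = 1" by (rule cis_multiple_2pi) auto
      finally show "1 = cis (2 * pi / real M) powi k" by simp
    qed auto
    then obtain \<theta> where \<theta>: "\<theta> \<in> dual" "\<And>x. x \<in> H \<Longrightarrow> \<theta> x = 1" "\<theta> g = cis (2 * pi / real M)" by blast
    have "\<theta> e = 1" if "e \<in> E" for e
      using \<theta>(2)[of e] b[of e n] B[OF that] nm(1) unfolding H_def by fastforce
    moreover have "cmod (\<gamma> g - 1) < \<eta>" if "\<gamma> \<in> \<Gamma>" for \<gamma>
    proof -
      have "\<gamma> (unit n) = \<gamma> (unit m)" using fun_cong[OF nm(4), of \<gamma>] that by simp
      moreover have d: "\<gamma> \<in> dual" using that \<Gamma> by auto
      ultimately have "\<gamma> g = 1"
        unfolding g_def using dualD(5)[OF d, of "unit m" "unit m"] dualD(3,5)[OF d] by simp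
      then show ?thesis using \<eta> by simp
    qed
    ultimately show "\<exists>\<theta>\<in>dual. \<exists>g. (\<forall>e\<in>E. cmod (\<theta> e - 1) < \<eta>) \<and> (\<forall>\<gamma>\<in>\<Gamma>. cmod (\<gamma> g - 1) < \<eta>) \<and>
        cmod (\<theta> g - cis (2 * pi / real M)) < \<eta>"
      using \<theta>(1,3) \<eta> by (intro bexI[of _ \<theta>] exI[of _ g]) auto
  qed
  then show ?thesis using M MG by blast
qed

text \<open>The free directions span cubes \<open>(\<int>/M)^N\<close> in the group, and by the second property every element is
seen by the characters like some word of the cube.  For infinite exponent any large \<open>M\<close> will do;
otherwise \<open>M\<close> is the exponent.\<close>

lemma reasonably_homogeneous_free_directions:
  assumes "reasonably_homogeneous TYPE('g::{ab_group_add,countable})" and \<epsilon>: "\<epsilon> > 0"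
  shows "\<exists>M\<ge>2. free_directions TYPE('g) M \<and>
    (\<forall>\<gamma>\<in>dual. \<forall>h::'g. \<exists>y<M. cmod (\<gamma> h - cis (2 * pi * real y / real M)) < \<epsilon>)"
proof (cases "infinite_exponent TYPE('g)")
  case True
  obtain M0 :: nat where M0: "real M0 > 2 * pi / \<epsilon>" using reals_Archimedean2 by blast
  define M where "M = M0 + 2"
  have M: "M \<ge> 2" "2 * pi / real M < \<epsilon>"
  proof -
    have "2 * pi / \<epsilon> < real M" using M0 by (simp add: M_def)
    then show "2 * pi / real M < \<epsilon>" using \<epsilon> by (simp add: M_def field_simps)
  qed (simp add: M_def)
  have "free_directions TYPE('g) M"
  proof (cases "\<exists>z::'g. \<forall>n. n \<noteq> 0 \<longrightarrow> int_mult n z \<noteq> 0")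
    case True
    then show ?thesis using free_directions_infinite_order M(1) by (metis gr0I not_numeral_le_zero)
  next
    case False
    then show ?thesis using M(1) by (intro free_directions_torsion[OF True]) auto
  qed
  moreover have "\<exists>y<M. cmod (\<gamma> h - cis (2 * pi * real y / real M)) < \<epsilon>" if "\<gamma> \<in> dual" for \<gamma> and h :: 'g
  proof -
    have "M > 0" using M(1) by simp
    then show ?thesis
      using near_root_of_unity[OF dualD(1)[OF that, of h], of M] M(2) by force
  qed
  ultimately show ?thesis using M(1) by blast
next
  case False
  then obtain r :: nat and q where "\<forall>i\<in>{1..r}. q i \<ge> 2"
    "(additive_group :: 'g monoid) \<cong> sum_group {1..r} (\<lambda>i. Sigma_group (q i))" "infinite (UNIV :: 'g set)"
    using assms(1) unfolding reasonably_homogeneous_def by blast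
  then obtain M where M: "M \<ge> 2" "free_directions TYPE('g) M" "\<And>x::'g. int_mult (int M) x = 0"
    using free_directions_Sigma_sum[of r q] by blast
  have "\<exists>y<M. cmod (\<gamma> h - cis (2 * pi * real y / real M)) < \<epsilon>" if "\<gamma> \<in> dual" for \<gamma> and h :: 'g
  proof -
    have "\<gamma> h ^ M = 1" using dualD(6)[OF that, of "int M" h] dualD(3)[OF that] M(3)[of h] by simp
    then have "\<gamma> h \<in> (\<lambda>k. cis (2 * pi * real k / real M)) ` {..<M}"
      using Complex.bij_betw_roots_unity[of M] M(1) unfolding bij_betw_def by auto
    then show ?thesis using \<epsilon> by auto
  qed
  then show ?thesis using M(1,2) by blast
qed

section \<open>Concentration of measure on Hamming cubes\<close>

definition hamming :: "'a list \<Rightarrow> 'a list \<Rightarrow> nat" where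
  "hamming xs ys = length (filter (\<lambda>(a, b). a \<noteq> b) (zip xs ys))"

lemma hamming_card:
  assumes "length xs = n" "length ys = n"
  shows "hamming xs ys = card {i. i < n \<and> xs ! i \<noteq> ys ! i}"
  unfolding hamming_def length_filter_conv_card using assms
  by (intro arg_cong[of _ _ card]) auto

lemma hamming_Cons [simp]: "hamming (x # xs) (y # ys) = (if x = y then 0 else 1) + hamming xs ys"
  by (simp add: hamming_def)

lemma hamming_self [simp]: "hamming xs xs = 0"
  by (induction xs) (auto simp: hamming_def)

lemma hamming_commute: "length xs = length ys \<Longrightarrow> hamming xs ys = hamming ys xs"
  by (induction rule: list_induct2) (auto simp: hamming_def)

lemma hamming_triangle:
  "length xs = length ys \<Longrightarrow> length ys = length zs \<Longrightarrow> hamming xs zs \<le> hamming xs ys + hamming ys zs"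
  by (induction rule: list_induct3) (auto simp: hamming_def)

definition words :: "nat \<Rightarrow> nat \<Rightarrow> nat list set" where
  "words M n = {xs. length xs = n \<and> set xs \<subseteq> {..<M}}"

lemma finite_words [simp]: "finite (words M n)"
  unfolding words_def using finite_lists_length_eq[of "{..<M}" n] by (simp add: conj_commute)

lemma card_words: "card (words M n) = M ^ n"
  unfolding words_def using card_lists_length_eq[of "{..<M}" n] by (simp add: conj_commute)

lemma words_0: "words M 0 = {[]}"
  by (auto simp: words_def)

lemma words_Suc: "words M (Suc n) = (\<lambda>(z, x). z # x) ` ({..<M} \<times> words M n)"
  by (auto simp: words_def length_Suc_conv image_def)

lemma sum_words_Suc: "(\<Sum>x\<in>words M (Suc n). f x) = (\<Sum>z<M. \<Sum>x\<in>words M n. f (z # x))"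
  unfolding words_Suc by (subst sum.reindex) (auto simp: inj_on_def sum.cartesian_product case_prod_unfold)

lemma sum_sum_square_diff:
  fixes a b :: "'a \<Rightarrow> real"
  shows "(\<Sum>x\<in>W. \<Sum>y\<in>W. (a x - b y)\<^sup>2) =
    real (card W) * (\<Sum>x\<in>W. (a x)\<^sup>2) + real (card W) * (\<Sum>x\<in>W. (b x)\<^sup>2) - 2 * (\<Sum>x\<in>W. a x) * (\<Sum>x\<in>W. b x)"
proof -
  have "(\<Sum>x\<in>W. \<Sum>y\<in>W. (a x - b y)\<^sup>2) = (\<Sum>x\<in>W. \<Sum>y\<in>W. (a x)\<^sup>2 + (b y)\<^sup>2 - 2 * (a x * b y))"
    by (simp add: power2_diff mult.assoc)
  also have "\<dots> = (\<Sum>x\<in>W. \<Sum>y\<in>W. (a x)\<^sup>2) + (\<Sum>x\<in>W. \<Sum>y\<in>W. (b y)\<^sup>2) - 2 * (\<Sum>x\<in>W. \<Sum>y\<in>W. a x * b y)"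
    by (simp only: sum_subtractf sum.distrib sum_distrib_left)
  also have "(\<Sum>x\<in>W. \<Sum>y\<in>W. a x * b y) = (\<Sum>x\<in>W. a x) * (\<Sum>x\<in>W. b x)"
    by (simp add: sum_product)
  finally show ?thesis by (simp add: sum_distrib_left[symmetric] mult.assoc)
qed

text \<open>The Efron-Stein bound: a function that changes by at most 1 when one letter is changed has
variance of the order of \<open>n\<close>, hence is concentrated on a scale far below the diameter \<open>n\<close> of the
cube.  The double sum is twice the variance times the square of the number of words.\<close>

lemma variance_Lipschitz:
  fixes f :: "nat list \<Rightarrow> real"
  assumes "\<And>x y. x \<in> words M n \<Longrightarrow> y \<in> words M n \<Longrightarrow> \<bar>f x - f y\<bar> \<le> real (hamming x y)"
  shows "(\<Sum>x\<in>words M n. \<Sum>y\<in>words M n. (f x - f y)\<^sup>2) \<le> real n * (real M ^ n)\<^sup>2"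
  using assms
proof (induction n arbitrary: f)
  case 0
  show ?case by (simp add: words_0)
next
  case (Suc n)
  define W where "W = words M n"
  define K where "K = real (card W)"
  have K: "K = real M ^ n" by (simp add: K_def W_def card_words)
  have step: "(\<Sum>x\<in>W. \<Sum>y\<in>W. (f (z # x) - f (w # y))\<^sup>2) \<le> real (Suc n) * K\<^sup>2" if zw: "z < M" "w < M" for z w
  proof -
    have in_words: "v # x \<in> words M (Suc n)" if "v < M" "x \<in> W" for v x
      using that unfolding W_def words_def by auto
    have V: "(\<Sum>x\<in>W. \<Sum>y\<in>W. (f (v # x) - f (v # y))\<^sup>2) \<le> real n * K\<^sup>2" if "v < M" for v
      unfolding W_def K
    proof (rule Suc.IH[of "\<lambda>x. f (v # x)"])
      fix x y assume "x \<in> words M n" "y \<in> words M n"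
      then show "\<bar>f (v # x) - f (v # y)\<bar> \<le> real (hamming x y)"
        using Suc.prems[of "v # x" "v # y"] in_words[OF that] by (simp add: W_def)
    qed
    have "\<bar>\<Sum>x\<in>W. f (z # x) - f (w # x)\<bar> \<le> (\<Sum>x\<in>W. \<bar>f (z # x) - f (w # x)\<bar>)" by (rule sum_abs)
    also have "\<dots> \<le> (\<Sum>x\<in>W. 1)"
    proof (rule sum_mono)
      fix x assume x: "x \<in> W"
      have "\<bar>f (z # x) - f (w # x)\<bar> \<le> real (hamming (z # x) (w # x))"
        by (rule Suc.prems) (use in_words zw x in auto)
      then show "\<bar>f (z # x) - f (w # x)\<bar> \<le> 1" by (simp split: if_splits)
    qed
    finally have "\<bar>\<Sum>x\<in>W. f (z # x) - f (w # x)\<bar> \<le> K" by (simp add: K_def)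
    then have sq: "((\<Sum>x\<in>W. f (z # x)) - (\<Sum>x\<in>W. f (w # x)))\<^sup>2 \<le> K\<^sup>2"
      by (simp add: sum_subtractf abs_le_square_iff[symmetric] K)
    \<comment> \<open>The decomposition of variance into the part within and the part between the first letters.\<close>
    have "(\<Sum>x\<in>W. \<Sum>y\<in>W. (f (z # x) - f (w # y))\<^sup>2) =
        ((\<Sum>x\<in>W. \<Sum>y\<in>W. (f (z # x) - f (z # y))\<^sup>2) + (\<Sum>x\<in>W. \<Sum>y\<in>W. (f (w # x) - f (w # y))\<^sup>2)) / 2
        + ((\<Sum>x\<in>W. f (z # x)) - (\<Sum>x\<in>W. f (w # x)))\<^sup>2"
      unfolding sum_sum_square_diff by (simp add: power2_eq_square field_simps)
    also have "\<dots> \<le> (real n * K\<^sup>2 + real n * K\<^sup>2) / 2 + K\<^sup>2"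
      using V[OF zw(1)] V[OF zw(2)] sq by (intro add_mono divide_right_mono) auto
    finally show ?thesis by (simp add: algebra_simps)
  qed
  have "(\<Sum>x\<in>words M (Suc n). \<Sum>y\<in>words M (Suc n). (f x - f y)\<^sup>2) =
      (\<Sum>z<M. \<Sum>x\<in>W. \<Sum>w<M. \<Sum>y\<in>W. (f (z # x) - f (w # y))\<^sup>2)"
    unfolding sum_words_Suc W_def ..
  also have "\<dots> = (\<Sum>z<M. \<Sum>w<M. \<Sum>x\<in>W. \<Sum>y\<in>W. (f (z # x) - f (w # y))\<^sup>2)"
    by (intro sum.cong refl sum.swap)
  also have "\<dots> \<le> (\<Sum>z<M. \<Sum>w<M. real (Suc n) * K\<^sup>2)"
    by (intro sum_mono step) auto
  also have "\<dots> = real (Suc n) * (real M ^ Suc n)\<^sup>2" by (simp add: K power2_eq_square algebra_simps)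
  finally show ?case .
qed

text \<open>The distance to \<open>A\<close> is Lipschitz and vanishes on \<open>A\<close>.  If all of \<open>B\<close> were far from \<open>A\<close>, the pairs
in \<open>A \<times> B\<close> alone would exceed the variance bound.\<close>

lemma dense_words_close:
  assumes AB: "A \<subseteq> words M n" "B \<subseteq> words M n" and \<delta>: "\<delta> > 0"
    and A: "real (card A) > \<delta> * real M ^ n" and B: "real (card B) > \<delta> * real M ^ n"
  shows "\<exists>a\<in>A. \<exists>b\<in>B. \<delta>\<^sup>2 * (real (hamming a b))\<^sup>2 \<le> real n"
proof (rule ccontr)
  assume "\<not> ?thesis"
  then have far: "\<delta>\<^sup>2 * (real (hamming a b))\<^sup>2 > real n" if "a \<in> A" "b \<in> B" for a b
    using that by force
  have fin: "finite A" "finite B" using AB finite_subset[OF _ finite_words] by auto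
  have K0: "\<delta> * real M ^ n \<ge> 0" using \<delta> by simp
  have ne: "A \<noteq> {}" "B \<noteq> {}" using A B K0 by auto
  have len: "length x = n" if "x \<in> words M n" for x using that by (simp add: words_def)
  define f where "f x = Min ((\<lambda>a. real (hamming x a)) ` A)" for x
  have fle: "f x \<le> real (hamming x a)" if "a \<in> A" for x a
    unfolding f_def using fin that by (intro Min_le) auto
  have fex: "\<exists>a\<in>A. f x = real (hamming x a)" for x
  proof -
    have "f x \<in> (\<lambda>a. real (hamming x a)) ` A" unfolding f_def using fin ne by (intro Min_in) auto
    then show ?thesis by auto
  qed
  have one: "f x - f y \<le> real (hamming x y)" if xy: "x \<in> words M n" "y \<in> words M n" for x y
  proof -
    obtain a where a: "a \<in> A" "f y = real (hamming y a)" using fex by blast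
    have "hamming x a \<le> hamming x y + hamming y a"
      using hamming_triangle[of x y a] len xy AB a(1) by (metis subsetD)
    then show ?thesis using fle[OF a(1), of x] a(2) by linarith
  qed
  have V: "(\<Sum>x\<in>words M n. \<Sum>y\<in>words M n. (f x - f y)\<^sup>2) \<le> real n * (real M ^ n)\<^sup>2"
  proof (rule variance_Lipschitz)
    fix x y assume xy: "x \<in> words M n" "y \<in> words M n"
    have "hamming x y = hamming y x" using hamming_commute len xy by metis
    then show "\<bar>f x - f y\<bar> \<le> real (hamming x y)"
      using one[OF xy] one[OF xy(2,1)] by (simp add: abs_le_iff)
  qed
  have f0: "f x = 0" if "x \<in> A" for x
    using fle[OF that, of x] fex[of x] by auto
  have fB: "\<delta>\<^sup>2 * (f y)\<^sup>2 > real n" if "y \<in> B" for y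
  proof -
    obtain a where a: "a \<in> A" "f y = real (hamming y a)" using fex by blast
    have "hamming y a = hamming a y" using hamming_commute len AB a(1) that by (metis subsetD)
    then show ?thesis using far[OF a(1) that] a(2) by simp
  qed
  have "real (card A) * real (card B) * real n = (\<Sum>x\<in>A. \<Sum>y\<in>B. real n)" by simp
  also have "\<dots> < (\<Sum>x\<in>A. \<Sum>y\<in>B. \<delta>\<^sup>2 * (f x - f y)\<^sup>2)"
    using fin ne f0 fB by (intro sum_strict_mono) auto
  also have "\<dots> = \<delta>\<^sup>2 * (\<Sum>x\<in>A. \<Sum>y\<in>B. (f x - f y)\<^sup>2)" by (simp add: sum_distrib_left)
  also have "(\<Sum>x\<in>A. \<Sum>y\<in>B. (f x - f y)\<^sup>2) \<le> (\<Sum>x\<in>words M n. \<Sum>y\<in>words M n. (f x - f y)\<^sup>2)"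
  proof -
    have "(\<Sum>x\<in>A. \<Sum>y\<in>B. (f x - f y)\<^sup>2) \<le> (\<Sum>x\<in>A. \<Sum>y\<in>words M n. (f x - f y)\<^sup>2)"
      by (intro sum_mono sum_mono2 AB) auto
    also have "\<dots> \<le> (\<Sum>x\<in>words M n. \<Sum>y\<in>words M n. (f x - f y)\<^sup>2)"
      by (intro sum_mono2 AB sum_nonneg) auto
    finally show ?thesis .
  qed
  also note V
  finally have "real (card A) * real (card B) * real n < \<delta>\<^sup>2 * (real n * (real M ^ n)\<^sup>2)"
    using \<delta> by (simp add: mult_left_mono)
  also have "\<dots> = (\<delta> * real M ^ n) * (\<delta> * real M ^ n) * real n" by (simp add: power2_eq_square)
  also have "\<dots> \<le> real (card A) * real (card B) * real n"
    using A B K0 by (intro mult_right_mono mult_mono) auto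
  finally show False by simp
qed

section \<open>Measure preserving systems\<close>

lemma G_systemD:
  assumes "G_system M T"
  shows "prob_space M" "\<And>g. T g \<in> measurable M M" "\<And>x. x \<in> space M \<Longrightarrow> T 0 x = x"
    "\<And>g h x. x \<in> space M \<Longrightarrow> T (g + h) x = T g (T h x)"
    "\<And>g D. D \<in> sets M \<Longrightarrow> emeasure M (T g ` D) = emeasure M D"
  using assms unfolding G_system_def by auto

lemma G_system_space:
  assumes "G_system M T" "x \<in> space M"
  shows "T g x \<in> space M"
  using measurable_space[OF G_systemD(2)[OF assms(1)] assms(2)] .

lemma action_image_eq:
  assumes T0: "\<And>x. x \<in> X \<Longrightarrow> T 0 x = x" and T: "\<And>g h x. x \<in> X \<Longrightarrow> T (g + h) x = T g (T h x)"
    and X: "\<And>g x. x \<in> X \<Longrightarrow> T g x \<in> X" and D: "D \<subseteq> X"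
  shows "T (g :: 'g::ab_group_add) ` D = T (- g) -` D \<inter> X"
proof (intro equalityI subsetI)
  fix y assume "y \<in> T g ` D"
  then obtain x where x: "x \<in> D" "y = T g x" by auto
  then show "y \<in> T (- g) -` D \<inter> X" using D X T[of x "- g" g] T0[of x] by auto
next
  fix y assume y: "y \<in> T (- g) -` D \<inter> X"
  then have "y = T g (T (- g) y)" using T[of y g "- g"] T0[of y] by auto
  then show "y \<in> T g ` D" using y by blast
qed

lemma G_system_image:
  assumes "G_system M T" "D \<in> sets M"
  shows "T g ` D = T (- g) -` D \<inter> space M" "T g ` D \<in> sets M"
proof -
  show eq: "T g ` D = T (- g) -` D \<inter> space M"
    by (rule action_image_eq[where X = "space M"])
      (simp_all add: G_systemD(3,4)[OF assms(1)] G_system_space[OF assms(1)] sets.sets_into_space[OF assms(2)])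
  show "T g ` D \<in> sets M" unfolding eq using measurable_sets[OF G_systemD(2)[OF assms(1)] assms(2)] .
qed

lemma G_system_preimage:
  assumes "G_system M T" "D \<in> sets M"
  shows "emeasure M (T g -` D \<inter> space M) = emeasure M D"
  using G_system_image(1)[OF assms, of "- g"] G_systemD(5)[OF assms, of "- g"] by simp

text \<open>The definition of a system speaks of images; for an action by a group they are preimages under
inverses, so that invariance of the distribution suffices.\<close>

lemma G_systemI:
  assumes "prob_space M" and meas: "\<And>g. T g \<in> measurable M M" and T0: "\<And>x. x \<in> space M \<Longrightarrow> T 0 x = x"
    and T: "\<And>g h x. x \<in> space M \<Longrightarrow> T (g + h) x = T g (T h x)"
    and distr: "\<And>g. distr M M (T g) = M"
  shows "G_system M T"
  unfolding G_system_def
proof (intro conjI allI ballI)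
  fix g D assume D: "D \<in> sets M"
  have "T g ` D = T (- g) -` D \<inter> space M"
    by (rule action_image_eq[where X = "space M"])
      (simp_all add: T0 T measurable_space[OF meas] sets.sets_into_space[OF D])
  also have "emeasure M \<dots> = emeasure (distr M M (T (- g))) D"
    using meas D by (simp add: emeasure_distr)
  finally show "emeasure M (T g ` D) = emeasure M D" by (simp add: distr)
qed (use assms in auto)

text \<open>Averaging over \<open>x\<close> the number of \<open>a \<in> I\<close> with \<open>T (g a) x \<in> D\<close> gives \<open>card I * measure M D\<close>, so some
\<open>x\<close> outside a given null set visits \<open>D\<close> at more than \<open>\<delta> * card I\<close> places of the pattern.  The null
set is chosen such that two visits of \<open>x\<close> force a return of positive measure.\<close>

lemma finite_pattern_returns:
  fixes T :: "'g::ab_group_add \<Rightarrow> 'x \<Rightarrow> 'x" and g :: "'i \<Rightarrow> 'g"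
  assumes sys: "G_system M T" and D: "D \<in> sets M" and \<delta>: "measure M D > \<delta>"
    and I: "finite I" and ne: "I \<noteq> {}"
  shows "\<exists>A\<subseteq>I. real (card A) > \<delta> * real (card I) \<and>
      (\<forall>a\<in>A. \<forall>b\<in>A. emeasure M (D \<inter> T (g a - g b) ` D) > 0)"
proof -
  interpret prob_space M using G_systemD(1)[OF sys] .
  note S = G_systemD[OF sys] G_system_image[OF sys] G_system_space[OF sys]
  define V where "V a = T (g a) -` D \<inter> space M" for a
  have V: "V a \<in> sets M" "measure M (V a) = measure M D" for a
    using measurable_sets[OF S(2) D] G_system_preimage[OF sys D] unfolding V_def measure_def by auto
  define N where "N a b = (if emeasure M (D \<inter> T (g a - g b) ` D) > 0 then {}
      else T (g a) -` (D \<inter> T (g a - g b) ` D) \<inter> space M)" for a b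
  have N: "N a b \<in> null_sets M" for a b
  proof (cases "emeasure M (D \<inter> T (g a - g b) ` D) > 0")
    case False
    have DD: "D \<inter> T (g a - g b) ` D \<in> sets M" using D S(7)[OF D] by auto
    then show ?thesis unfolding N_def using False G_system_preimage[OF sys DD] measurable_sets[OF S(2) DD]
      by (simp add: null_sets_def)
  qed (simp add: N_def)
  define Z where "Z = (\<Union>a\<in>I. \<Union>b\<in>I. N a b)"
  have Z: "Z \<in> null_sets M" unfolding Z_def using I N by (intro null_sets.finite_UN) auto
  define A where "A x = {a\<in>I. x \<in> V a}" for x
  have good: "emeasure M (D \<inter> T (g a - g b) ` D) > 0" if x: "x \<notin> Z" and ab: "a \<in> A x" "b \<in> A x" for x a b
  proof (rule ccontr)
    assume *: "\<not> ?thesis"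
    have "x \<in> space M" "T (g a) x \<in> D" "T (g b) x \<in> D" using ab unfolding A_def V_def by auto
    moreover from this have "T (g a) x = T (g a - g b) (T (g b) x)"
      using S(4)[of x "g a - g b" "g b"] by simp
    ultimately have "x \<in> N a b" unfolding N_def using * by auto
    then show False using x ab unfolding Z_def A_def by auto
  qed
  have "\<exists>x. x \<notin> Z \<and> real (card (A x)) > \<delta> * real (card I)"
  proof (rule ccontr)
    assume "\<not> ?thesis"
    then have le: "real (card (A x)) \<le> \<delta> * real (card I)" if "x \<notin> Z" for x using that by force
    have cA: "real (card (A x)) = (\<Sum>a\<in>I. indicator (V a) x)" for x
      using I unfolding A_def by (simp add: indicator_def sum.If_cases Int_def)
    have int: "integrable M (indicator (V a) :: _ \<Rightarrow> real)" for a
      using V(1) by (intro integrable_real_indicator) (auto simp: emeasure_eq_measure)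
    have "(\<integral>x. (\<Sum>a\<in>I. indicator (V a) x) \<partial>M) \<le> \<delta> * real (card I)"
    proof (rule integral_le_const)
      show "integrable M (\<lambda>x. \<Sum>a\<in>I. indicator (V a) x :: real)" using int by (intro Bochner_Integration.integrable_sum) auto
      show "AE x in M. (\<Sum>a\<in>I. indicator (V a) x) \<le> \<delta> * real (card I)"
        using AE_not_in[OF Z] by eventually_elim (use le cA in force)
    qed
    moreover have "(\<integral>x. (\<Sum>a\<in>I. indicator (V a) x) \<partial>M) = (\<Sum>a\<in>I. measure M (V a))"
      using int V(1) by (subst Bochner_Integration.integral_sum) auto
    ultimately have "real (card I) * measure M D \<le> \<delta> * real (card I)" using V(2) by simp
    then show False using \<delta> ne I by (simp add: mult.commute card_gt_0_iff)
  qed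
  then obtain x where "x \<notin> Z" "real (card (A x)) > \<delta> * real (card I)" by blast
  then show "\<exists>A\<subseteq>I. real (card A) > \<delta> * real (card I) \<and>
      (\<forall>a\<in>A. \<forall>b\<in>A. emeasure M (D \<inter> T (g a - g b) ` D) > 0)"
    using good by (intro exI[of _ "A x"]) (auto simp: A_def)
qed

text \<open>Used as a model of the circle, with rotations \<open>y \<mapsto> frac (y + a)\<close>, and as the probability space from
which random branches are drawn.\<close>

definition unit_interval :: "real measure" where
  "unit_interval = restrict_space lborel {0..<1}"

lemma space_unit_interval [simp]: "space unit_interval = {0..<1}"
  by (simp add: unit_interval_def space_restrict_space)

lemma sets_unit_interval: "A \<in> sets unit_interval \<longleftrightarrow> A \<in> sets borel \<and> A \<subseteq> {0..<1}"
  unfolding unit_interval_def by (subst sets_restrict_space_iff) auto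

lemma emeasure_unit_interval: "A \<subseteq> {0..<1} \<Longrightarrow> emeasure unit_interval A = emeasure lborel A"
  unfolding unit_interval_def by (rule emeasure_restrict_space) auto

lemma prob_space_unit_interval: "prob_space unit_interval"
  by (rule prob_spaceI) (simp add: emeasure_unit_interval)

lemma emeasure_lborel_translate:
  fixes c :: real
  assumes "F \<in> sets borel"
  shows "emeasure lborel {y. y + c \<in> F} = emeasure lborel F"
proof -
  have "emeasure lborel F = emeasure (distr lborel borel ((+) c)) F" by (simp add: lborel_distr_plus)
  also have "\<dots> = emeasure lborel ((+) c -` F \<inter> space lborel)" using assms by (intro emeasure_distr) auto
  also have "(+) c -` F \<inter> space lborel = {y. y + c \<in> F}" by (auto simp: add.commute)
  finally show ?thesis ..
qed

lemma frac_cong: "x - y \<in> \<int> \<Longrightarrow> frac x = frac y" for x y :: real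
  using frac_add_int_right[of "x - y" y] by simp

lemma measurable_rotation: "(\<lambda>y. frac (y + a)) \<in> measurable unit_interval unit_interval" for a :: real
proof -
  have "(\<lambda>y. frac (y + a)) \<in> measurable lborel lborel" unfolding frac_def by measurable
  then show ?thesis unfolding unit_interval_def
    by (intro measurable_restrict_space3) (auto simp: frac_lt_1)
qed

lemma distr_rotation: "distr unit_interval unit_interval (\<lambda>y. frac (y + a)) = unit_interval" for a :: real
proof (rule measure_eqI)
  fix E assume "E \<in> sets (distr unit_interval unit_interval (\<lambda>y. frac (y + a)))"
  then have E: "E \<in> sets borel" "E \<subseteq> {0..<1}" and E': "E \<in> sets unit_interval" by (auto simp: sets_unit_interval)
  define c where "c = frac a"
  have c: "0 \<le> c" "c < 1" by (auto simp: c_def frac_lt_1)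
  have fr: "frac (y + a) = (if y < 1 - c then y + c else y + (c - 1))" if "0 \<le> y" "y < 1" for y
  proof -
    have "frac (y + a) = frac (y + c)" unfolding c_def by (rule frac_cong) (simp add: frac_def)
    also have "\<dots> = (if y < 1 - c then y + c else y + (c - 1))"
      using c that by (auto simp: frac_unique_iff)
    finally show ?thesis .
  qed
  define E1 where "E1 = E \<inter> {c..<1}"
  define E2 where "E2 = E \<inter> {0..<c}"
  have E12: "E1 \<in> sets borel" "E2 \<in> sets borel" using E by (auto simp: E1_def E2_def)
  have tr: "{y. y + b \<in> F} \<in> sets borel" if "F \<in> sets borel" for b :: real and F
    using measurable_sets_borel[of "\<lambda>y. y + b" borel F] that by (simp add: vimage_def)
  have eq: "(\<lambda>y. frac (y + a)) -` E \<inter> {0..<1} = {y. y + c \<in> E1} \<union> {y. y + (c - 1) \<in> E2}"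
  proof (intro equalityI subsetI)
    fix y assume "y \<in> (\<lambda>y. frac (y + a)) -` E \<inter> {0..<1}"
    then show "y \<in> {y. y + c \<in> E1} \<union> {y. y + (c - 1) \<in> E2}"
      using fr[of y] c by (auto simp: E1_def E2_def split: if_splits)
  next
    fix y assume "y \<in> {y. y + c \<in> E1} \<union> {y. y + (c - 1) \<in> E2}"
    then show "y \<in> (\<lambda>y. frac (y + a)) -` E \<inter> {0..<1}"
      using fr[of y] c E(2) by (auto simp: E1_def E2_def split: if_splits)
  qed
  have "emeasure (distr unit_interval unit_interval (\<lambda>y. frac (y + a))) E
      = emeasure unit_interval ((\<lambda>y. frac (y + a)) -` E \<inter> {0..<1})"
    using emeasure_distr[OF measurable_rotation E'] by simp
  also have "\<dots> = emeasure lborel ({y. y + c \<in> E1} \<union> {y. y + (c - 1) \<in> E2})"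
    unfolding eq[symmetric] by (rule emeasure_unit_interval) auto
  also have "\<dots> = emeasure lborel {y. y + c \<in> E1} + emeasure lborel {y. y + (c - 1) \<in> E2}"
  proof (rule plus_emeasure[symmetric])
    show "{y. y + c \<in> E1} \<in> sets lborel" "{y. y + (c - 1) \<in> E2} \<in> sets lborel"
      using tr[OF E12(1)] tr[OF E12(2)] by simp_all
    show "{y. y + c \<in> E1} \<inter> {y. y + (c - 1) \<in> E2} = {}" by (auto simp: E1_def E2_def)
  qed
  also have "\<dots> = emeasure lborel E1 + emeasure lborel E2"
    by (simp add: emeasure_lborel_translate E12)
  also have "\<dots> = emeasure lborel (E1 \<union> E2)"
    using E12 by (intro plus_emeasure) (auto simp: E1_def E2_def)
  also have "E1 \<union> E2 = E" using E(2) c by (auto simp: E1_def E2_def)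
  also have "emeasure lborel E = emeasure unit_interval E" using E(2) by (simp add: emeasure_unit_interval)
  finally show "emeasure (distr unit_interval unit_interval (\<lambda>y. frac (y + a))) E = emeasure unit_interval E" .
qed simp

text \<open>The product of the given system with the rotation of the circle by \<open>\<gamma>\<close>: a point of a short arc
that returns to this arc at time \<open>g\<close> shows that \<open>\<gamma> g\<close> is close to 1.\<close>

lemma set_of_recurrence_Bohr:
  fixes R :: "'g::{ab_group_add,countable} set"
  assumes R: "set_of_recurrence R" and \<gamma>: "\<gamma> \<in> dual" and \<epsilon>: "\<epsilon> > 0"
  shows "set_of_recurrence {r \<in> R. cmod (\<gamma> r - 1) < \<epsilon>}"
  unfolding set_of_recurrence_def recurrent_on_def
proof (intro allI impI ballI)
  fix M :: "('g \<Rightarrow> bool) measure" and T :: "'g \<Rightarrow> ('g \<Rightarrow> bool) \<Rightarrow> ('g \<Rightarrow> bool)" and D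
  assume sys: "G_system M T" and D: "D \<in> sets M" and Dpos: "emeasure M D > 0"
  note S = G_systemD[OF sys]
  interpret M: prob_space M by (rule S(1))
  interpret U: prob_space unit_interval by (rule prob_space_unit_interval)
  interpret MU: pair_prob_space M unit_interval ..
  define \<alpha> where "\<alpha> g = Arg (\<gamma> g) / (2 * pi)" for g
  have \<alpha>: "\<gamma> g = cis (2 * pi * \<alpha> g)" for g
  proof -
    have "\<gamma> g \<noteq> 0" using dualD(1)[OF \<gamma>, of g] by auto
    then show ?thesis using cis_Arg[of "\<gamma> g"] dualD(1)[OF \<gamma>, of g] by (simp add: \<alpha>_def sgn_div_norm)
  qed
  have cisZ: "x \<in> \<int>" if "cis (2 * pi * x) = 1" for x :: real
  proof -
    have "cos (2 * pi * x) = 1" using that by (metis cis.sel(1) one_complex.sel(1))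
    then obtain k :: int where "2 * pi * x = of_int k * 2 * pi" using cos_one_2pi_int by blast
    then show ?thesis by simp
  qed
  have \<alpha>add: "\<alpha> (g + h) - (\<alpha> g + \<alpha> h) \<in> \<int>" for g h
  proof (rule cisZ)
    have "cis (2 * pi * (\<alpha> (g + h) - (\<alpha> g + \<alpha> h))) = \<gamma> (g + h) / (\<gamma> g * \<gamma> h)"
      unfolding \<alpha> cis_mult cis_divide by (simp add: algebra_simps)
    then show "cis (2 * pi * (\<alpha> (g + h) - (\<alpha> g + \<alpha> h))) = 1"
      using dualD(2)[OF \<gamma>, of g h] dualD(1)[OF \<gamma>, of "g + h"] by auto
  qed
  have \<alpha>0: "\<alpha> 0 \<in> \<int>" using \<alpha>add[of 0 0] by simp
  define \<rho> where "\<rho> g y = frac (y + \<alpha> g)" for g y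
  have \<rho>m: "\<rho> g \<in> measurable unit_interval unit_interval" for g
    unfolding \<rho>_def by (rule measurable_rotation)
  have \<rho>d: "distr unit_interval unit_interval (\<rho> g) = unit_interval" for g
    unfolding \<rho>_def by (rule distr_rotation)
  have \<rho>0: "\<rho> 0 y = y" if "y \<in> {0..<1}" for y
    using frac_add_int_right[OF \<alpha>0, of y] that by (simp add: \<rho>_def)
  have \<rho>add: "\<rho> (g + h) y = \<rho> g (\<rho> h y)" for g h y
    unfolding \<rho>_def
  proof (rule frac_cong)
    have "y + \<alpha> (g + h) - (frac (y + \<alpha> h) + \<alpha> g) = (\<alpha> (g + h) - (\<alpha> g + \<alpha> h)) + of_int \<lfloor>y + \<alpha> h\<rfloor>"
      by (simp add: frac_def)
    then show "y + \<alpha> (g + h) - (frac (y + \<alpha> h) + \<alpha> g) \<in> \<int>" using \<alpha>add by (metis Ints_add Ints_of_int)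
  qed
  define T' where "T' g = (\<lambda>(x, y). (T g x, \<rho> g y))" for g
  have sys': "G_system (M \<Otimes>\<^sub>M unit_interval) T'"
  proof (rule G_systemI)
    show "prob_space (M \<Otimes>\<^sub>M unit_interval)" by unfold_locales
    show "T' g \<in> measurable (M \<Otimes>\<^sub>M unit_interval) (M \<Otimes>\<^sub>M unit_interval)" for g
      unfolding T'_def using S(2) \<rho>m by measurable
    show "T' 0 x = x" if "x \<in> space (M \<Otimes>\<^sub>M unit_interval)" for x
      using that S(3) \<rho>0 by (auto simp: T'_def space_pair_measure)
    show "T' (g + h) x = T' g (T' h x)" if "x \<in> space (M \<Otimes>\<^sub>M unit_interval)" for g h x
      using that S(4) \<rho>add by (auto simp: T'_def space_pair_measure)
    show "distr (M \<Otimes>\<^sub>M unit_interval) (M \<Otimes>\<^sub>M unit_interval) (T' g) = M \<Otimes>\<^sub>M unit_interval" for g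
    proof -
      have "distr M M (T g) = M"
      proof (rule measure_eqI)
        fix A assume "A \<in> sets (distr M M (T g))"
        then show "emeasure (distr M M (T g)) A = emeasure M A"
          using G_system_preimage[OF sys, of A g] S(2) by (simp add: emeasure_distr)
      qed simp
      then show ?thesis
        using pair_measure_distr[OF S(2)[of g] \<rho>m[of g]] U.sigma_finite_measure_axioms
        by (simp add: \<rho>d T'_def)
    qed
  qed
  \<comment> \<open>Two points of an arc of length \<open>e\<close> differ by an angle of at most \<open>2 * pi * e < \<epsilon>\<close>.\<close>
  define e where "e = min 1 (\<epsilon> / 7)"
  have e: "0 < e" "e \<le> 1" "2 * pi * e < \<epsilon>"
  proof -
    show "0 < e" "e \<le> 1" using \<epsilon> by (auto simp: e_def)
    have "2 * pi * e \<le> 2 * pi * (\<epsilon> / 7)" by (intro mult_left_mono) (auto simp: e_def)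
    also have "\<dots> < \<epsilon>" using pi_less_4 \<epsilon> pi_approx by (simp add: field_simps)
    finally show "2 * pi * e < \<epsilon>" .
  qed
  define E where "E = {0..<e}"
  have E: "E \<in> sets unit_interval" "emeasure unit_interval E = ennreal e"
    using e by (auto simp: E_def sets_unit_interval emeasure_unit_interval)
  have "D \<times> E \<in> sets (M \<Otimes>\<^sub>M unit_interval)" using D E by auto
  moreover have "emeasure (M \<Otimes>\<^sub>M unit_interval) (D \<times> E) > 0"
    using U.emeasure_pair_measure_Times[OF D E(1)] Dpos E(2) e(1) by (simp add: ennreal_zero_less_mult_iff)
  ultimately obtain g where g: "g \<in> R" "emeasure (M \<Otimes>\<^sub>M unit_interval) (D \<times> E \<inter> T' g ` (D \<times> E)) > 0"
    using set_of_recurrence_all_types[OF R, where 'x = "('g \<Rightarrow> bool) \<times> real"] sys'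
    unfolding recurrent_on_def by blast
  have sub: "D \<times> E \<inter> T' g ` (D \<times> E) \<subseteq> (D \<inter> T g ` D) \<times> (E \<inter> \<rho> g ` E)"
    by (auto simp: T'_def)
  have "D \<times> E \<inter> T' g ` (D \<times> E) \<noteq> {}" using g(2) by auto
  then obtain y y' where y: "y \<in> E" "y' \<in> E" "y = \<rho> g y'" using sub by blast
  have "cmod (\<gamma> g - 1) < \<epsilon>"
  proof -
    have "\<alpha> g - (y - y') \<in> \<int>"
      unfolding y(3) \<rho>_def by (simp add: frac_def)
    then have "cis (2 * pi * (\<alpha> g - (y - y'))) = 1" by (rule cis_multiple_2pi)
    then have "\<gamma> g = cis (2 * pi * (y - y'))"
      unfolding \<alpha> by (simp add: right_diff_distrib cis_divide[symmetric] field_simps cis_mult)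
    then have "cmod (\<gamma> g - 1) \<le> \<bar>2 * pi * (y - y')\<bar>" using cmod_cis_diff_1_le by simp
    also have "\<dots> = 2 * pi * \<bar>y - y'\<bar>" by (simp add: abs_mult)
    also have "\<dots> \<le> 2 * pi * e" using y(1,2) by (intro mult_left_mono) (auto simp: E_def abs_le_iff)
    finally show ?thesis using e(3) by simp
  qed
  moreover have "emeasure M (D \<inter> T g ` D) > 0"
  proof -
    have DT: "D \<inter> T g ` D \<in> sets M" using D G_system_image(2)[OF sys D] by auto
    have "emeasure (M \<Otimes>\<^sub>M unit_interval) (D \<times> E \<inter> T' g ` (D \<times> E))
        \<le> emeasure (M \<Otimes>\<^sub>M unit_interval) ((D \<inter> T g ` D) \<times> space unit_interval)"
      using sub sets.sets_into_space[OF E(1)] by (intro emeasure_mono pair_measureI DT sets.top) auto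
    also have "\<dots> = emeasure M (D \<inter> T g ` D)"
      using U.emeasure_pair_measure_Times[OF DT sets.top] U.emeasure_space_1 by simp
    finally show ?thesis using g(2) by simp
  qed
  ultimately show "\<exists>g\<in>{r \<in> R. cmod (\<gamma> r - 1) < \<epsilon>}. emeasure M (D \<inter> T g ` D) > 0" using g(1) by blast
qed

text \<open>In the Bernoulli shift, the event of a 1 at 0 and of 0s at the finitely many places \<open>- r\<close> for \<open>r\<close>
in \<open>R\<close> has positive probability and is disjoint from its translates by elements of \<open>R\<close>.\<close>

lemma finite_not_set_of_recurrence:
  fixes R :: "'g::ab_group_add set"
  assumes fin: "finite R" and R: "0 \<notin> R"
  shows "\<not> set_of_recurrence R"
proof
  assume rec: "set_of_recurrence R"
  define B where "B = measure_pmf (bernoulli_pmf (1/2))"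
  define P where "P = PiM (UNIV :: 'g set) (\<lambda>_. B)"
  interpret product_prob_space "\<lambda>_::'g. B" UNIV
    unfolding B_def by (intro product_prob_spaceI prob_space_measure_pmf)
  have spP: "space P = UNIV" by (auto simp: P_def space_PiM B_def)
  define U :: "'g \<Rightarrow> ('g \<Rightarrow> bool) \<Rightarrow> 'g \<Rightarrow> bool" where "U = (\<lambda>h w g. w (g + h))"
  have sys: "G_system P U"
  proof (rule G_systemI)
    show "prob_space P" unfolding P_def by unfold_locales
    show "U h \<in> measurable P P" for h
      unfolding U_def P_def by (rule measurable_PiM_single') (auto simp: space_PiM B_def)
    show "U 0 w = w" for w by (simp add: U_def)
    show "U (g + h) w = U g (U h w)" for g h w by (simp add: U_def ac_simps)
    show "distr P P (U h) = P" for h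
      using distr_PiM_reindex[of UNIV "\<lambda>_. B" "\<lambda>n. n + h" UNIV]
      unfolding P_def U_def B_def by (simp add: prob_space_measure_pmf restrict_UNIV)
  qed
  define J where "J = insert 0 (uminus ` R)"
  define D where "D = {w \<in> space P. \<forall>i\<in>J. w i \<in> {i = 0}}"
  have finJ: "finite J" using fin by (simp add: J_def)
  have D: "D \<in> sets P" unfolding D_def
  proof (rule sets.sets_Collect_finite_All[OF _ finJ])
    fix i
    have "(\<lambda>w. w i) \<in> measurable P B" unfolding P_def by (rule measurable_component_singleton) simp
    from measurable_sets[OF this, of "{i = 0}"] show "{w \<in> space P. w i \<in> {i = 0}} \<in> sets P"
      by (simp add: B_def vimage_def Int_def conj_commute)
  qed
  have "emeasure P D = (\<Prod>i\<in>J. emeasure B {i = 0})"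
    unfolding D_def P_def by (rule emeasure_PiM_Collect) (use finJ in \<open>auto simp: B_def\<close>)
  moreover have "emeasure B {b} > 0" for b
    unfolding B_def emeasure_pmf_single by (simp only: ennreal_less_zero_iff) (simp add: pmf_positive_iff)
  ultimately have "emeasure P D > 0"
    using finJ by (simp add: zero_less_iff_neq_zero prod_zero_iff)
  then obtain g where g: "g \<in> R" "emeasure P (D \<inter> U g ` D) > 0"
    using rec sys D unfolding set_of_recurrence_def recurrent_on_def by blast
  then have "D \<inter> U g ` D \<noteq> {}" by auto
  then obtain w where w: "w \<in> D" "U g w \<in> D" by blast
  have "- g \<noteq> 0" "- g \<in> J" using g(1) R by (auto simp: J_def)
  then have "\<not> U g w (- g)" using w(2) unfolding D_def by blast
  moreover have "w 0" using w(1) unfolding D_def J_def by auto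
  ultimately show False by (simp add: U_def)
qed

section \<open>Compactness of recurrence\<close>

text \<open>Recurrence for large sets only.  In contrast to \<open>set_of_recurrence\<close> this is inherited by suitable
finite subsets, at the price of a slightly larger \<open>\<delta>\<close>.\<close>

definition density_recurrent :: "real \<Rightarrow> 'g::ab_group_add set \<Rightarrow> bool" where
  "density_recurrent \<delta> R \<longleftrightarrow>
     (\<forall>(M :: ('g \<Rightarrow> bool) measure) T. G_system M T \<longrightarrow>
        (\<forall>D\<in>sets M. measure M D > \<delta> \<longrightarrow> (\<exists>g\<in>R. emeasure M (D \<inter> T g ` D) > 0)))"

definition depends_on :: "'g set \<Rightarrow> ('g \<Rightarrow> bool) set \<Rightarrow> bool" where
  "depends_on F E \<longleftrightarrow> (\<forall>w w'. (\<forall>g\<in>F. w g = w' g) \<longrightarrow> (w \<in> E \<longleftrightarrow> w' \<in> E))"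

text \<open>The algebra of sets that depend on finitely many coordinates.  Its members are open and compact,
which makes finitely additive measures on it countably additive.\<close>

definition cylinders :: "('g \<Rightarrow> bool) set set" where
  "cylinders = {E. \<exists>F. finite F \<and> depends_on F E}"

lemma depends_onD:
  assumes "depends_on F E" "\<And>g. g \<in> F \<Longrightarrow> w g = w' g"
  shows "w \<in> E \<longleftrightarrow> w' \<in> E"
  using assms(1)[unfolded depends_on_def, rule_format, of w w'] assms(2) by simp

lemma depends_onI:
  assumes "\<And>w w'. (\<And>g. g \<in> F \<Longrightarrow> w g = w' g) \<Longrightarrow> w \<in> E \<longleftrightarrow> w' \<in> E"
  shows "depends_on F E"
  unfolding depends_on_def
proof (intro allI impI)
  fix w w' :: "'a \<Rightarrow> bool" assume "\<forall>g\<in>F. w g = w' g"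
  then show "w \<in> E \<longleftrightarrow> w' \<in> E" by (intro assms) (rule bspec)
qed

lemma cylinders_Compl: "E \<in> cylinders \<Longrightarrow> - E \<in> cylinders"
  unfolding cylinders_def depends_on_def by simp

lemma cylinders_Un:
  assumes "A \<in> cylinders" "B \<in> cylinders"
  shows "A \<union> B \<in> cylinders"
proof -
  obtain F F' where F: "finite F" "depends_on F A" "finite F'" "depends_on F' B"
    using assms unfolding cylinders_def by auto
  have "depends_on (F \<union> F') (A \<union> B)"
  proof (rule depends_onI)
    fix w w' :: "'a \<Rightarrow> bool" assume "\<And>g. g \<in> F \<union> F' \<Longrightarrow> w g = w' g"
    then show "w \<in> A \<union> B \<longleftrightarrow> w' \<in> A \<union> B"
      using depends_onD[OF F(2), of w w'] depends_onD[OF F(4), of w w'] by simp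
  qed
  then show ?thesis unfolding cylinders_def using F by blast
qed

lemma cylinders_Int: "A \<in> cylinders \<Longrightarrow> B \<in> cylinders \<Longrightarrow> A \<inter> B \<in> cylinders"
  using cylinders_Compl[OF cylinders_Un[OF cylinders_Compl[of A] cylinders_Compl[of B]]] by simp

lemma cylinders_empty: "{} \<in> cylinders"
  unfolding cylinders_def depends_on_def by (simp add: exI[of _ "{}"])

lemma cylinders_UNIV: "UNIV \<in> cylinders"
  using cylinders_Compl[OF cylinders_empty] by simp

lemma algebra_cylinders: "algebra UNIV cylinders"
  unfolding algebra_iff_Un
  using cylinders_empty cylinders_Un cylinders_Compl by (auto simp: Compl_eq_Diff_UNIV)

lemma coordinate_cylinder: "{w. w g} \<in> cylinders"
proof -
  have "depends_on {g} {w. w g}" by (rule depends_onI) simp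
  then show ?thesis unfolding cylinders_def by blast
qed

lemma cylinder_open:
  assumes "E \<in> cylinders"
  shows "open E"
proof -
  obtain F where F: "finite F" "depends_on F E" using assms unfolding cylinders_def by auto
  have o: "open {v. v g = b}" for g :: 'a and b :: bool
  proof -
    have "open ((\<lambda>v. v g) -` {b} :: ('a \<Rightarrow> bool) set)"
      by (intro open_vimage continuous_on_product_coordinates) (rule discrete_topology_class.open_discrete)
    then show ?thesis by (simp add: vimage_def)
  qed
  have eq: "E = (\<Union>w\<in>E. \<Inter>g\<in>F. {v. v g = w g})"
  proof (intro equalityI subsetI)
    fix v assume "v \<in> (\<Union>w\<in>E. \<Inter>g\<in>F. {v. v g = w g})"
    then obtain w where "w \<in> E" "\<And>g. g \<in> F \<Longrightarrow> v g = w g" by auto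
    then show "v \<in> E" using depends_onD[OF F(2), of v w] by simp
  qed auto
  moreover have "open (\<Inter>g\<in>F. {v. v g = w g})" for w :: "'a \<Rightarrow> bool"
    using F(1) o by (intro open_INT) auto
  ultimately have "open (\<Union>w\<in>E. \<Inter>g\<in>F. {v. v g = w g})" by (intro open_UN ballI)
  then show ?thesis by (simp only: eq[symmetric])
qed

lemma cylinder_closed: "E \<in> cylinders \<Longrightarrow> closed E"
  unfolding closed_def by (intro cylinder_open cylinders_Compl)

lemma compact_functions:
  assumes "compact K"
  shows "compact {f :: 'a \<Rightarrow> 'b::topological_space. \<forall>x. f x \<in> K}"
proof -
  have "compactin (product_topology (\<lambda>_. euclidean) (UNIV :: 'a set)) (UNIV \<rightarrow>\<^sub>E K)"
    unfolding compactin_PiE using assms by (simp add: compactin_euclidean_iff)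
  moreover have "UNIV \<rightarrow>\<^sub>E K = {f :: 'a \<Rightarrow> 'b. \<forall>x. f x \<in> K}" by auto
  ultimately show ?thesis by (simp add: euclidean_product_topology compactin_euclidean_iff)
qed

lemma compact_binary_functions: "compact (UNIV :: ('a \<Rightarrow> bool) set)"
  using compact_functions[of "UNIV :: bool set"] by (simp add: finite_imp_compact)

lemma cylinders_decseq_empty:
  assumes "range A \<subseteq> cylinders" "decseq A" "(\<Inter>i. A i) = {}"
  shows "\<exists>n. A n = {}"
proof (rule ccontr)
  assume ne: "\<not> ?thesis"
  have "UNIV \<inter> (\<Inter>i\<in>UNIV. A i) \<noteq> {}"
  proof (rule compact_imp_fip_image[OF compact_binary_functions])
    show "closed (A i)" for i using assms(1) by (intro cylinder_closed) auto
    fix J :: "nat set" assume J: "finite J"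
    have "A (Max (insert 0 J)) \<subseteq> A i" if "i \<in> J" for i
      by (rule decseqD[OF assms(2)], rule Max_ge) (use J that in simp_all)
    moreover obtain x where "x \<in> A (Max (insert 0 J))" using ne by (meson ex_in_conv)
    ultimately have "x \<in> (\<Inter>i\<in>J. A i)" by blast
    then show "UNIV \<inter> (\<Inter>i\<in>J. A i) \<noteq> {}" by blast
  qed
  then show False using assms(3) by simp
qed

definition bit_shift :: "'g::ab_group_add \<Rightarrow> ('g \<Rightarrow> bool) \<Rightarrow> 'g \<Rightarrow> bool" where
  "bit_shift h w = (\<lambda>g. w (g + h))"

lemma bit_shift_image: "bit_shift h ` E = bit_shift (- h) -` E"
proof (intro equalityI subsetI)
  fix w assume "w \<in> bit_shift (- h) -` E"
  moreover have "w = bit_shift h (bit_shift (- h) w)" by (auto simp: bit_shift_def)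
  ultimately show "w \<in> bit_shift h ` E" by blast
qed (auto simp: bit_shift_def)

lemma bit_shift_cylinder:
  assumes "E \<in> cylinders"
  shows "bit_shift h -` E \<in> cylinders"
proof -
  obtain F where F: "finite F" "depends_on F E" using assms unfolding cylinders_def by auto
  have "depends_on ((\<lambda>g. g + h) ` F) (bit_shift h -` E)"
  proof (rule depends_onI)
    fix w w' :: "'a \<Rightarrow> bool" assume "\<And>g. g \<in> (\<lambda>g. g + h) ` F \<Longrightarrow> w g = w' g"
    then show "w \<in> bit_shift h -` E \<longleftrightarrow> w' \<in> bit_shift h -` E"
      using depends_onD[OF F(2), of "bit_shift h w" "bit_shift h w'"] by (simp add: bit_shift_def)
  qed
  then show ?thesis unfolding cylinders_def using F(1) by blast
qed

text \<open>A point \<open>x\<close> of a system is coded by the set of those \<open>g\<close> for which \<open>T g x \<in> D\<close>.  This carries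
any system with a distinguished set to an invariant measure on one and the same shift space.\<close>

lemma itinerary_measurable:
  assumes sys: "G_system M T" and D: "D \<in> sets M" and E: "E \<in> cylinders"
  shows "(\<lambda>x g. T g x \<in> D) -` E \<inter> space M \<in> sets M"
proof -
  obtain F where F: "finite F" "depends_on F E" using E unfolding cylinders_def by auto
  define \<A> where "\<A> = {A \<in> Pow F. (\<lambda>g. g \<in> A) \<in> E}"
  have fin: "finite \<A>" using F(1) by (simp add: \<A>_def)
  have "(\<lambda>x g. T g x \<in> D) -` E \<inter> space M = (\<Union>A\<in>\<A>. {x \<in> space M. \<forall>g\<in>F. T g x \<in> D \<longleftrightarrow> g \<in> A})"
  proof (intro equalityI subsetI)
    fix x assume x: "x \<in> (\<lambda>x g. T g x \<in> D) -` E \<inter> space M"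
    define A where "A = {g \<in> F. T g x \<in> D}"
    have "(\<lambda>g. g \<in> A) \<in> E \<longleftrightarrow> (\<lambda>g. T g x \<in> D) \<in> E"
      using depends_onD[OF F(2), of "\<lambda>g. g \<in> A" "\<lambda>g. T g x \<in> D"] by (auto simp: A_def)
    then have "A \<in> \<A>" using x by (auto simp: \<A>_def A_def)
    then show "x \<in> (\<Union>A\<in>\<A>. {x \<in> space M. \<forall>g\<in>F. T g x \<in> D \<longleftrightarrow> g \<in> A})"
      using x by (intro UN_I[of A]) (simp_all add: A_def)
  next
    fix x assume "x \<in> (\<Union>A\<in>\<A>. {x \<in> space M. \<forall>g\<in>F. T g x \<in> D \<longleftrightarrow> g \<in> A})"
    then obtain A where A: "A \<in> \<A>" "x \<in> space M" "\<forall>g\<in>F. T g x \<in> D \<longleftrightarrow> g \<in> A" by auto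
    then have "(\<lambda>g. g \<in> A) \<in> E \<longleftrightarrow> (\<lambda>g. T g x \<in> D) \<in> E"
      using depends_onD[OF F(2), of "\<lambda>g. g \<in> A" "\<lambda>g. T g x \<in> D"] by auto
    then show "x \<in> (\<lambda>x g. T g x \<in> D) -` E \<inter> space M" using A by (auto simp: \<A>_def)
  qed
  moreover have "{x \<in> space M. \<forall>g\<in>F. T g x \<in> D \<longleftrightarrow> g \<in> A} \<in> sets M" for A
  proof (rule sets.sets_Collect_finite_All[OF _ F(1)])
    fix g
    have "T g -` D \<inter> space M \<in> sets M" using measurable_sets[OF G_systemD(2)[OF sys] D] .
    then have *: "{x \<in> space M. T g x \<in> D} \<in> sets M" by (simp add: vimage_def Int_def conj_commute)
    show "{x \<in> space M. T g x \<in> D \<longleftrightarrow> g \<in> A} \<in> sets M"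
      using * sets.sets_Collect_neg[OF *] by (cases "g \<in> A") auto
  qed
  ultimately show ?thesis using fin by (simp add: sets.finite_UN)
qed

lemma itinerary_shift:
  assumes sys: "G_system M T" and D: "D \<in> sets M" and E: "E \<in> cylinders"
  shows "(\<lambda>x g. T g x \<in> D) -` (bit_shift h ` E) \<inter> space M = T h ` ((\<lambda>x g. T g x \<in> D) -` E \<inter> space M)"
proof -
  have "(\<lambda>g. T g (T (- h) x) \<in> D) = bit_shift (- h) (\<lambda>g. T g x \<in> D)" if "x \<in> space M" for x
    by (simp add: bit_shift_def G_systemD(4)[OF sys that, symmetric])
  then show ?thesis
    unfolding bit_shift_image G_system_image(1)[OF sys itinerary_measurable[OF sys D E]]
    using G_system_space[OF sys] by auto
qed

text \<open>Shift-invariant finitely additive probabilities on the cylinders.  The values on other sets are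
arbitrary in \<open>{0..1}\<close>, so that the set of all these functions is compact for pointwise convergence.\<close>

definition invariant_charge :: "(('g::ab_group_add \<Rightarrow> bool) set \<Rightarrow> real) \<Rightarrow> bool" where
  "invariant_charge f \<longleftrightarrow> (\<forall>E. f E \<in> {0..1}) \<and> f UNIV = 1 \<and>
     (\<forall>A\<in>cylinders. \<forall>B\<in>{B\<in>cylinders. A \<inter> B = {}}. f (A \<union> B) = f A + f B) \<and>
     (\<forall>h. \<forall>E\<in>cylinders. f (bit_shift h ` E) = f E)"

lemma compact_invariant_charge:
  "compact {f :: ('g::ab_group_add \<Rightarrow> bool) set \<Rightarrow> real. invariant_charge f}"
proof -
  have c: "continuous_on UNIV (\<lambda>f :: ('g \<Rightarrow> bool) set \<Rightarrow> real. f E)" for E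
    by (rule continuous_on_product_coordinates)
  have "{f :: ('g \<Rightarrow> bool) set \<Rightarrow> real. invariant_charge f} = {f. \<forall>E. f E \<in> {0..1}} \<inter> ({f. f UNIV = 1} \<inter>
     (\<Inter>A\<in>cylinders. \<Inter>B\<in>{B\<in>cylinders. A \<inter> B = {}}. {f. f (A \<union> B) = f A + f B}) \<inter>
     (\<Inter>h. \<Inter>E\<in>cylinders. {f. f (bit_shift h ` E) = f E}))"
    unfolding invariant_charge_def by auto
  also have "compact \<dots>"
    by (intro compact_Int_closed compact_functions closed_Int closed_INT ballI closed_Collect_eq
        continuous_intros c) auto
  finally show ?thesis .
qed

lemma system_invariant_charge:
  assumes sys: "G_system M T" and D: "D \<in> sets M"
  shows "invariant_charge (\<lambda>E. measure M ((\<lambda>x g. T g x \<in> D) -` E \<inter> space M))"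
proof -
  interpret prob_space M using G_systemD(1)[OF sys] .
  define \<phi> where "\<phi> = (\<lambda>x g. T g x \<in> D)"
  have m: "\<phi> -` E \<inter> space M \<in> sets M" if "E \<in> cylinders" for E
    using itinerary_measurable[OF sys D that] by (simp add: \<phi>_def)
  have "measure M (\<phi> -` (A \<union> B) \<inter> space M) = measure M (\<phi> -` A \<inter> space M) + measure M (\<phi> -` B \<inter> space M)"
    if "A \<in> cylinders" "B \<in> cylinders" "A \<inter> B = {}" for A B
  proof -
    have "\<phi> -` (A \<union> B) \<inter> space M = (\<phi> -` A \<inter> space M) \<union> (\<phi> -` B \<inter> space M)" by auto
    moreover have "(\<phi> -` A \<inter> space M) \<inter> (\<phi> -` B \<inter> space M) = {}" using that(3) by auto
    ultimately show ?thesis using m that by (simp add: finite_measure_Union)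
  qed
  moreover have "measure M (\<phi> -` (bit_shift h ` E) \<inter> space M) = measure M (\<phi> -` E \<inter> space M)"
    if "E \<in> cylinders" for h E
    using itinerary_shift[OF sys D that, of h] G_systemD(5)[OF sys m[OF that]]
    unfolding \<phi>_def measure_def by simp
  ultimately show ?thesis
    unfolding invariant_charge_def \<phi>_def[symmetric] by (auto simp: prob_space)
qed

text \<open>Caratheodory's theorem applies because a decreasing sequence of cylinders with empty intersection is eventually empty.\<close>

lemma invariant_charge_system:
  fixes f :: "('g::ab_group_add \<Rightarrow> bool) set \<Rightarrow> real"
  assumes f: "invariant_charge f"
  shows "\<exists>N. G_system N bit_shift \<and> (\<forall>E\<in>cylinders. E \<in> sets N \<and> emeasure N E = ennreal (f E))"
proof -
  have rng: "0 \<le> f E" and one: "f UNIV = 1"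
    and add: "\<And>A B. A \<in> cylinders \<Longrightarrow> B \<in> cylinders \<Longrightarrow> A \<inter> B = {} \<Longrightarrow> f (A \<union> B) = f A + f B"
    and inv: "\<And>h E. E \<in> cylinders \<Longrightarrow> f (bit_shift h ` E) = f E" for E
    using f unfolding invariant_charge_def by auto
  have f0: "f {} = 0" using add[OF cylinders_empty cylinders_empty] by simp
  interpret algebra UNIV cylinders by (rule algebra_cylinders)
  have "\<exists>\<mu>. (\<forall>s\<in>cylinders. \<mu> s = ennreal (f s)) \<and> measure_space UNIV (sigma_sets UNIV cylinders) \<mu>"
  proof (rule caratheodory_empty_continuous)
    show "positive cylinders (\<lambda>s. ennreal (f s))" by (simp add: positive_def f0)
    show "additive cylinders (\<lambda>s. ennreal (f s))"
      unfolding additive_def using add rng by (simp add: ennreal_plus)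
    fix A :: "nat \<Rightarrow> ('g \<Rightarrow> bool) set" assume A: "range A \<subseteq> cylinders" "decseq A" "(\<Inter>i. A i) = {}"
    then obtain n where n: "A n = {}" using cylinders_decseq_empty by blast
    have "A m = {}" if "m \<ge> n" for m using decseqD[OF A(2) that] n by auto
    then have "eventually (\<lambda>m. ennreal (f (A m)) = 0) sequentially"
      unfolding eventually_sequentially by (intro exI[of _ n]) (simp add: f0)
    then show "(\<lambda>i. ennreal (f (A i))) \<longlonglongrightarrow> 0" by (rule tendsto_eventually)
  qed simp
  then obtain \<mu> where \<mu>: "\<And>s. s \<in> cylinders \<Longrightarrow> \<mu> s = ennreal (f s)"
    "measure_space UNIV (sigma_sets UNIV cylinders) \<mu>" by blast
  define N where "N = measure_of UNIV (sigma_sets UNIV cylinders) \<mu>"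
  have sp: "space N = UNIV" by (simp add: N_def space_measure_of_conv)
  have sts: "sets N = sigma_sets UNIV cylinders"
    unfolding N_def by (subst sets_measure_of) (auto simp: sigma_sets_sigma_sets_eq)
  have cyl: "E \<in> sets N" if "E \<in> cylinders" for E using that sts by auto
  have em: "emeasure N E = ennreal (f E)" if "E \<in> cylinders" for E
    using \<mu>(2) that unfolding N_def measure_space_def
    by (subst emeasure_measure_of_sigma) (auto simp: \<mu>(1))
  have meas: "bit_shift h \<in> measurable N N" for h
    by (rule measurable_sigma_sets[OF sts]) (use cyl bit_shift_cylinder in \<open>auto simp: sp\<close>)
  have "distr N N (bit_shift h) = N" for h
  proof (rule measure_eqI_generator_eq[where E = cylinders and \<Omega> = UNIV and A = "\<lambda>_. UNIV"])
    show "Int_stable cylinders" by (auto simp: Int_stable_def cylinders_Int)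
    fix E assume E: "E \<in> (cylinders :: ('g \<Rightarrow> bool) set set)"
    have "emeasure (distr N N (bit_shift h)) E = emeasure N (bit_shift h -` E)"
      using meas cyl[OF E] by (simp add: emeasure_distr sp)
    also have "bit_shift h -` E = bit_shift (- h) ` E" by (simp add: bit_shift_image)
    also have "emeasure N \<dots> = emeasure N E"
      using em[OF E] em[of "bit_shift (- h) ` E"] inv[OF E, of "- h"] bit_shift_cylinder[OF E, of h]
      by (simp add: bit_shift_image)
    finally show "emeasure (distr N N (bit_shift h)) E = emeasure N E" .
  next
    show "emeasure (distr N N (bit_shift h)) UNIV \<noteq> \<infinity>" for i :: nat
      using meas cyl[OF cylinders_UNIV] em[OF cylinders_UNIV] by (simp add: emeasure_distr sp)
  qed (auto simp: sts cylinders_UNIV)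
  then have "G_system N bit_shift"
    by (intro G_systemI meas prob_spaceI)
      (auto simp: sp em[OF cylinders_UNIV] one bit_shift_def add_ac)
  then show ?thesis using cyl em by blast
qed

text \<open>If every finite subset of \<open>R\<close> fails for some system, code these systems as invariant charges.
The conditions \<open>f (D \<inter> bit_shift r ` D) = 0\<close> for \<open>r \<in> R\<close> are closed and any finitely many of them hold
simultaneously for some charge that gives \<open>D\<close> at least \<open>\<delta>'\<close>; by compactness all of them do.  The
resulting system contradicts the hypothesis on \<open>R\<close>.\<close>

lemma density_recurrent_finite_subset:
  fixes R :: "'g::{ab_group_add,countable} set"
  assumes R: "density_recurrent \<delta> R" and \<delta>: "\<delta> < \<delta>'"
  shows "\<exists>F\<subseteq>R. finite F \<and> density_recurrent \<delta>' F"
proof (rule ccontr)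
  assume no: "\<not> ?thesis"
  define D :: "('g \<Rightarrow> bool) set" where "D = {w. w 0}"
  have D: "D \<in> cylinders" unfolding D_def by (rule coordinate_cylinder)
  have DD: "D \<inter> bit_shift r ` D \<in> cylinders" for r
    unfolding bit_shift_image by (intro cylinders_Int D bit_shift_cylinder)
  define K where "K = {f. invariant_charge f} \<inter> {f. \<delta>' \<le> f D}"
  define C where "C r = {f :: ('g \<Rightarrow> bool) set \<Rightarrow> real. f (D \<inter> bit_shift r ` D) = 0}" for r
  have "K \<inter> (\<Inter>r\<in>R. C r) \<noteq> {}"
  proof (rule compact_imp_fip_image)
    show "compact K" unfolding K_def
      by (intro compact_Int_closed compact_invariant_charge closed_Collect_le continuous_intros
          continuous_on_product_coordinates)
    show "closed (C r)" for r unfolding C_def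
      by (intro closed_Collect_eq continuous_intros continuous_on_product_coordinates)
    fix F assume F: "finite F" "F \<subseteq> R"
    then have "\<not> density_recurrent \<delta>' F" using no by blast
    then obtain M :: "('g \<Rightarrow> bool) measure" and T B where sys: "G_system M T"
      and B: "B \<in> sets M" "measure M B > \<delta>'" and null: "\<And>g. g \<in> F \<Longrightarrow> \<not> emeasure M (B \<inter> T g ` B) > 0"
      unfolding density_recurrent_def by blast
    define f where "f = (\<lambda>E. measure M ((\<lambda>x g. T g x \<in> B) -` E \<inter> space M))"
    have D': "(\<lambda>x g. T g x \<in> B) -` D \<inter> space M = B"
      using G_systemD(3)[OF sys] sets.sets_into_space[OF B(1)] by (auto simp: D_def)
    have "f \<in> K"
      using system_invariant_charge[OF sys B(1)] B(2) D' by (simp add: K_def f_def)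
    moreover have "f \<in> C r" if "r \<in> F" for r
    proof -
      define \<phi> where "\<phi> = (\<lambda>x g. T g x \<in> B)"
      have "\<phi> -` (D \<inter> bit_shift r ` D) \<inter> space M
          = (\<phi> -` D \<inter> space M) \<inter> (\<phi> -` (bit_shift r ` D) \<inter> space M)"
        unfolding vimage_Int by (simp only: Int_ac Int_absorb Int_left_absorb)
      also have "\<dots> = B \<inter> T r ` B"
        using itinerary_shift[OF sys B(1) D, of r] D' by (simp only: \<phi>_def)
      finally have "(\<lambda>x g. T g x \<in> B) -` (D \<inter> bit_shift r ` D) \<inter> space M = B \<inter> T r ` B"
        by (simp only: \<phi>_def)
      then show ?thesis using null[OF that] by (simp add: C_def f_def measure_def)
    qed
    ultimately show "K \<inter> (\<Inter>r\<in>F. C r) \<noteq> {}" by blast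
  qed
  then obtain f where f: "invariant_charge f" "\<delta>' \<le> f D" "\<And>r. r \<in> R \<Longrightarrow> f (D \<inter> bit_shift r ` D) = 0"
    unfolding K_def C_def by blast
  obtain N where N: "G_system N bit_shift" "\<And>E. E \<in> cylinders \<Longrightarrow> E \<in> sets N \<and> emeasure N E = ennreal (f E)"
    using invariant_charge_system[OF f(1)] by blast
  have "measure N D = f D" using N(2)[OF D] f(1) unfolding invariant_charge_def measure_def by simp
  then have "measure N D > \<delta>" using f(2) \<delta> by simp
  then obtain r where "r \<in> R" "emeasure N (D \<inter> bit_shift r ` D) > 0"
    using R N(1) N(2)[OF D] unfolding density_recurrent_def by blast
  then show False using N(2)[OF DD[of r]] f(3)[of r] by simp
qed

section \<open>Recurrence of Bohr-Hamming balls\<close>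

lemma dual_mult: "\<gamma> \<in> dual \<Longrightarrow> \<kappa> \<in> dual \<Longrightarrow> (\<lambda>x. \<gamma> x * \<kappa> x) \<in> dual"
  unfolding dual_def by (auto simp: norm_mult)

text \<open>Free directions are chosen one after another: \<open>\<theta> n\<close> is close to 1 at \<open>g 0, \<dots>, g (n - 1)\<close>, and \<open>g n\<close> is
nearly invisible to \<open>\<theta> 0, \<dots>, \<theta> (n - 1)\<close> and to all targets \<open>\<tau> j\<close>.  Then \<open>\<tau> j * \<theta> j\<close> has the required
properties.\<close>

lemma dual_system_exists:
  fixes E :: "'g::{ab_group_add,countable} set" and \<tau> :: "nat \<Rightarrow> 'g \<Rightarrow> complex"
  assumes free: "free_directions TYPE('g) M" and E: "finite E"
    and \<tau>: "\<And>i. i < N \<Longrightarrow> \<tau> i \<in> dual" and \<eta>: "\<eta> > 0"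
  shows "\<exists>\<kappa> g. (\<forall>i<N. \<kappa> i \<in> dual \<and> (\<forall>e\<in>E. cmod (\<kappa> i e - \<tau> i e) < \<eta>)) \<and>
    (\<forall>i<N. \<forall>j<N. cmod (\<kappa> j (g i) - (if i = j then cis (2 * pi / real M) else 1)) < \<eta>)"
proof -
  define \<delta> where "\<delta> i j = (if i = j then cis (2 * pi / real M) else 1)" for i j :: nat
  have "\<exists>\<theta> g. \<forall>i<n. \<theta> i \<in> dual \<and> (\<forall>e\<in>E. cmod (\<theta> i e - 1) < \<eta> / 2) \<and>
      (\<forall>j<N. cmod (\<tau> j (g i) - 1) < \<eta> / 2) \<and> (\<forall>j<n. cmod (\<theta> j (g i) - \<delta> i j) < \<eta> / 2)" for n
  proof (induction n)
    case 0 show ?case by simp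
  next
    case (Suc n)
    then obtain \<theta> g where IH: "\<And>i. i < n \<Longrightarrow> \<theta> i \<in> dual \<and> (\<forall>e\<in>E. cmod (\<theta> i e - 1) < \<eta> / 2) \<and>
      (\<forall>j<N. cmod (\<tau> j (g i) - 1) < \<eta> / 2) \<and> (\<forall>j<n. cmod (\<theta> j (g i) - \<delta> i j) < \<eta> / 2)" by blast
    have "finite (E \<union> g ` {..<n})" "finite (\<tau> ` {..<N} \<union> \<theta> ` {..<n})" using E by auto
    moreover have "\<tau> ` {..<N} \<union> \<theta> ` {..<n} \<subseteq> dual" using \<tau> IH by auto
    moreover have "\<eta> / 2 > 0" using \<eta> by simp
    ultimately obtain \<theta>' g' where new: "\<theta>' \<in> dual" "\<forall>e\<in>E \<union> g ` {..<n}. cmod (\<theta>' e - 1) < \<eta> / 2"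
      "\<forall>\<gamma>\<in>\<tau> ` {..<N} \<union> \<theta> ` {..<n}. cmod (\<gamma> g' - 1) < \<eta> / 2" "cmod (\<theta>' g' - cis (2 * pi / real M)) < \<eta> / 2"
      using free unfolding free_directions_def by meson
    show ?case
    proof (intro exI[of _ "\<theta>(n := \<theta>')"] exI[of _ "g(n := g')"] allI impI)
      fix i assume "i < Suc n"
      then consider "i < n" | "i = n" by linarith
      then show "(\<theta>(n := \<theta>')) i \<in> dual \<and> (\<forall>e\<in>E. cmod ((\<theta>(n := \<theta>')) i e - 1) < \<eta> / 2) \<and>
        (\<forall>j<N. cmod (\<tau> j ((g(n := g')) i) - 1) < \<eta> / 2) \<and>
        (\<forall>j<Suc n. cmod ((\<theta>(n := \<theta>')) j ((g(n := g')) i) - \<delta> i j) < \<eta> / 2)"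
      proof cases
        case 1
        then show ?thesis using IH[OF 1] new(2) by (auto simp: \<delta>_def less_Suc_eq)
      next
        case 2
        then show ?thesis using new by (auto simp: \<delta>_def less_Suc_eq)
      qed
    qed
  qed
  from this[of N] obtain \<theta> g where \<theta>: "\<And>i. i < N \<Longrightarrow> \<theta> i \<in> dual \<and> (\<forall>e\<in>E. cmod (\<theta> i e - 1) < \<eta> / 2) \<and>
      (\<forall>j<N. cmod (\<tau> j (g i) - 1) < \<eta> / 2) \<and> (\<forall>j<N. cmod (\<theta> j (g i) - \<delta> i j) < \<eta> / 2)" by blast
  show ?thesis
  proof (intro exI[of _ "\<lambda>i x. \<tau> i x * \<theta> i x"] exI[of _ g] conjI allI impI ballI)
    fix i assume i: "i < N"
    show "(\<lambda>x. \<tau> i x * \<theta> i x) \<in> dual" using \<tau> \<theta> i by (intro dual_mult) auto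
    fix e assume "e \<in> E"
    have "cmod (\<tau> i e * \<theta> i e - \<tau> i e) = cmod (\<tau> i e) * cmod (\<theta> i e - 1)"
      by (simp add: norm_mult[symmetric] algebra_simps)
    also have "\<dots> < \<eta>" using \<theta>[OF i] \<open>e \<in> E\<close> dualD(1)[OF \<tau>[OF i]] \<eta> by fastforce
    finally show "cmod (\<tau> i e * \<theta> i e - \<tau> i e) < \<eta>" .
  next
    fix i j assume ij: "i < N" "j < N"
    have "cmod (\<tau> j (g i) * \<theta> j (g i) - 1 * \<delta> i j) \<le> cmod (\<tau> j (g i) - 1) + cmod (\<theta> j (g i) - \<delta> i j)"
      using \<theta>[OF ij(2)] by (intro cmod_mult_diff_le) (auto simp: dualD(1))
    also have "\<dots> < \<eta>" using \<theta>[OF ij(1)] ij(2) by (smt (verit) field_sum_of_halves)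
    finally show "cmod (\<tau> j (g i) * \<theta> j (g i) - (if i = j then cis (2 * pi / real M) else 1)) < \<eta>"
      by (simp add: \<delta>_def)
  qed
qed

lemma dual_sum: "\<gamma> \<in> dual \<Longrightarrow> \<gamma> (\<Sum>i\<in>A. f i) = (\<Prod>i\<in>A. \<gamma> (f i))"
  by (induction A rule: infinite_finite_induct) (auto simp: dualD(2,3))

lemma words_nth: "z \<in> words M N \<Longrightarrow> i < N \<Longrightarrow> z ! i < M"
  unfolding words_def by (metis (mono_tags, lifting) lessThan_iff mem_Collect_eq nth_mem subsetD)

lemma shifted_word_inj:
  "inj_on (\<lambda>z. map (\<lambda>i. (z ! i + y i) mod M) [0..<N]) (words M N)"
proof (rule inj_onI)
  fix a b assume a: "a \<in> words M N" and b: "b \<in> words M N"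
    and eq: "map (\<lambda>i. (a ! i + y i) mod M) [0..<N] = map (\<lambda>i. (b ! i + y i) mod M) [0..<N]"
  have len: "length a = N" "length b = N" using a b by (auto simp: words_def)
  show "a = b"
  proof (rule nth_equalityI)
    fix i assume i: "i < length a"
    then have "a ! i < M" "b ! i < M" using words_nth[OF a] words_nth[OF b] len by auto
    moreover have "(a ! i + y i) mod M = (b ! i + y i) mod M"
      using arg_cong[OF eq, of "\<lambda>l. l ! i"] i len by simp
    then have "(int (a ! i) + int (y i)) mod int M = (int (b ! i) + int (y i)) mod int M"
      by (metis of_nat_add of_nat_mod)
    then have "int (a ! i) mod int M = int (b ! i) mod int M" by (simp add: mod_eq_dvd_iff)
    ultimately show "a ! i = b ! i" by simp
  qed (simp add: len)
qed

text \<open>The words \<open>z\<close> index the elements \<open>G z = (\<Sum>i<N. z i * g i)\<close>, and \<open>\<kappa> i (G z)\<close> is close to the \<open>z i\<close>-th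
power of the basic root of unity.  There are more than \<open>\<delta> * M ^ N\<close> words \<open>a\<close> such that all
differences of the corresponding \<open>G a\<close> are return times of \<open>D\<close>.  Shifting these words by the word \<open>y\<close>
that represents \<open>h\<close> gives another set of the same size, and concentration provides two words \<open>a\<close> and
\<open>c\<close> of the first set with \<open>a = c + y\<close> at all but a few positions; then \<open>m = G a - G c\<close>.\<close>

lemma Bohr_Hamming_recurrence:
  fixes T :: "'g::ab_group_add \<Rightarrow> 'x \<Rightarrow> 'x" and g :: "nat \<Rightarrow> 'g"
  assumes \<kappa>: "\<And>i. i < N \<Longrightarrow> \<kappa> i \<in> dual"
    and near: "\<And>i j. i < N \<Longrightarrow> j < N \<Longrightarrow> cmod (\<kappa> j (g i) - (if i = j then cis (2 * pi / real M) else 1)) \<le> \<eta>"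
    and \<eta>: "real N * real M * \<eta> \<le> \<epsilon>" and M: "M > 0"
    and roots: "\<And>i. i < N \<Longrightarrow> \<exists>y<M. cmod (\<kappa> i h - cis (2 * pi * real y / real M)) < \<epsilon>"
    and N: "real N < \<delta>\<^sup>2 * (\<rho> * real N)\<^sup>2" and \<delta>: "\<delta> > 0" and \<rho>: "\<rho> \<ge> 0"
    and sys: "G_system X T" and D: "D \<in> sets X" "measure X D > \<delta>"
  shows "\<exists>m. emeasure X (D \<inter> T m ` D) > 0 \<and>
    real (card {i. i < N \<and> 3 * \<epsilon> \<le> cmod (\<kappa> i (m - h) - 1)}) \<le> \<rho> * real N"
proof -
  obtain y where y: "\<And>i. i < N \<Longrightarrow> y i < M \<and> cmod (\<kappa> i h - cis (2 * pi * real (y i) / real M)) < \<epsilon>"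
    using roots by metis
  define G where "G z = (\<Sum>i<N. int_mult (int (z ! i)) (g i))" for z
  define e where "e k = cis (2 * pi * real k / real M)" for k
  have e_add: "e (a + b) = e a * e b" for a b
    by (simp add: e_def cis_mult add_divide_distrib distrib_left)
  have e_mod: "e (a mod M) = e a" for a
  proof -
    have "2 * pi * real (a div M * M) / real M = 2 * pi * real (a div M)" using M by simp
    then have "e (a div M * M) = cis (2 * pi * real (a div M))" unfolding e_def by (rule arg_cong)
    also have "\<dots> = 1" by (rule cis_multiple_2pi) auto
    finally show ?thesis using e_add[of "a div M * M" "a mod M"] by simp
  qed
  have W: "words M N \<noteq> {}"
  proof -
    have "replicate N 0 \<in> words M N" using M by (auto simp: words_def)
    then show ?thesis by blast
  qed
  have KG: "cmod (\<kappa> i (G z) - e (z ! i)) \<le> \<epsilon>" if z: "z \<in> words M N" and i: "i < N" for z i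
  proof -
    define w where "w j = (if j = i then cis (2 * pi / real M) else 1)" for j
    have "\<kappa> i (G z) = (\<Prod>j<N. \<kappa> i (g j) ^ (z ! j))"
      unfolding G_def dual_sum[OF \<kappa>[OF i]] by (simp add: dualD(6)[OF \<kappa>[OF i]])
    moreover have "e (z ! i) = (\<Prod>j<N. w j ^ (z ! j))"
    proof -
      have "(\<Prod>j<N. w j ^ (z ! j)) = (\<Prod>j<N. if j = i then cis (2 * pi / real M) ^ (z ! i) else 1)"
        by (intro prod.cong) (auto simp: w_def)
      also have "\<dots> = cis (2 * pi / real M) ^ (z ! i)" using i by (simp add: prod.delta)
      also have "\<dots> = e (z ! i)" by (simp add: e_def Complex.DeMoivre mult_ac)
      finally show ?thesis ..
    qed
    ultimately have "cmod (\<kappa> i (G z) - e (z ! i)) \<le> (\<Sum>j<N. cmod (\<kappa> i (g j) ^ (z ! j) - w j ^ (z ! j)))"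
      by (simp only:) (rule norm_prod_diff, auto simp: norm_power dualD(1)[OF \<kappa>[OF i]] w_def)
    also have "\<dots> \<le> (\<Sum>j<N. real M * \<eta>)"
    proof (rule sum_mono)
      fix j assume j: "j \<in> {..<N}"
      have "cmod (\<kappa> i (g j) ^ (z ! j) - w j ^ (z ! j)) \<le> real (z ! j) * cmod (\<kappa> i (g j) - w j)"
        by (rule norm_power_diff) (auto simp: dualD(1)[OF \<kappa>[OF i]] w_def)
      also have "\<dots> \<le> real M * \<eta>"
        using near[of j i] j i words_nth[OF z, of j] by (intro mult_mono) (auto simp: w_def)
      finally show "cmod (\<kappa> i (g j) ^ (z ! j) - w j ^ (z ! j)) \<le> real M * \<eta>" .
    qed
    also have "\<dots> \<le> \<epsilon>" using \<eta> by (simp add: mult.assoc)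
    finally show ?thesis .
  qed
  obtain A where A: "A \<subseteq> words M N" "real (card A) > \<delta> * real (card (words M N))"
    "\<And>a b. a \<in> A \<Longrightarrow> b \<in> A \<Longrightarrow> emeasure X (D \<inter> T (G a - G b) ` D) > 0"
    using finite_pattern_returns[OF sys D finite_words W, of G] by blast
  \<comment> \<open>Addition of \<open>y\<close> in the cube is injective, so it preserves the density of \<open>A\<close>.\<close>
  define sh where "sh z = map (\<lambda>i. (z ! i + y i) mod M) [0..<N]" for z
  have "inj_on sh A" unfolding sh_def using shifted_word_inj A(1) inj_on_subset by blast
  then have cB: "card (sh ` A) = card A" by (rule card_image)
  have B: "sh ` A \<subseteq> words M N" using M by (auto simp: sh_def words_def)
  obtain a b where ab: "a \<in> A" "b \<in> sh ` A" "\<delta>\<^sup>2 * (real (hamming a b))\<^sup>2 \<le> real N"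
    using dense_words_close[OF A(1) B \<delta>] A(2) cB by (auto simp: card_words)
  obtain c where c: "c \<in> A" "b = sh c" using ab(2) by blast
  define m where "m = G a - G c"
  have aW: "a \<in> words M N" and cW: "c \<in> words M N" and bW: "b \<in> words M N" using A(1) ab(1,2) c(1) B by auto
  have "\<delta>\<^sup>2 * (real (hamming a b))\<^sup>2 < \<delta>\<^sup>2 * (\<rho> * real N)\<^sup>2" using ab(3) N by linarith
  then have "(real (hamming a b))\<^sup>2 < (\<rho> * real N)\<^sup>2" using \<delta> by simp
  then have ham: "real (hamming a b) \<le> \<rho> * real N"
    using \<rho> by (meson less_imp_le power2_less_imp_less mult_nonneg_nonneg of_nat_0_le_iff)
  have "{i. i < N \<and> 3 * \<epsilon> \<le> cmod (\<kappa> i (m - h) - 1)} \<subseteq> {i. i < N \<and> a ! i \<noteq> b ! i}"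
  proof (clarify)
    fix i assume i: "i < N" and far: "3 * \<epsilon> \<le> cmod (\<kappa> i (m - h) - 1)" and eq: "a ! i = b ! i"
    have ei: "e (a ! i) = e (c ! i) * e (y i)"
      using eq i unfolding c(2) sh_def by (simp add: e_mod e_add)
    note d = dualD[OF \<kappa>[OF i]]
    have "G a = (m - h) + (G c + h)" by (simp add: m_def)
    then have "\<kappa> i (G a) = \<kappa> i (m - h) * (\<kappa> i (G c) * \<kappa> i h)" using d(2) by metis
    then have "\<kappa> i (G a) - \<kappa> i (G c) * \<kappa> i h = (\<kappa> i (m - h) - 1) * (\<kappa> i (G c) * \<kappa> i h)"
      by (simp add: algebra_simps)
    then have "cmod (\<kappa> i (m - h) - 1) = cmod (\<kappa> i (G a) - \<kappa> i (G c) * \<kappa> i h)"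
      by (simp add: norm_mult d(1))
    also have "\<dots> \<le> cmod (\<kappa> i (G a) - e (a ! i)) + cmod (e (c ! i) * e (y i) - \<kappa> i (G c) * \<kappa> i h)"
      unfolding ei by norm
    also have "cmod (e (c ! i) * e (y i) - \<kappa> i (G c) * \<kappa> i h) \<le> cmod (e (c ! i) - \<kappa> i (G c)) + cmod (e (y i) - \<kappa> i h)"
      by (rule cmod_mult_diff_le) (auto simp: e_def d(1))
    finally have "cmod (\<kappa> i (m - h) - 1) < 3 * \<epsilon>"
      using KG[OF aW i] KG[OF cW i] y[OF i] by (simp add: e_def norm_minus_commute)
    then show False using far by simp
  qed
  then have "card {i. i < N \<and> 3 * \<epsilon> \<le> cmod (\<kappa> i (m - h) - 1)} \<le> card {i. i < N \<and> a ! i \<noteq> b ! i}"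
    by (intro card_mono) auto
  also have "\<dots> = hamming a b" using aW bW by (intro hamming_card[symmetric]) (auto simp: words_def)
  finally show ?thesis using ham A(3)[OF ab(1) c(1)] unfolding m_def by (intro exI[of _ "G a - G c"]) auto
qed

lemma set_of_recurrence_Bohr_finite:
  fixes R :: "'g::{ab_group_add,countable} set"
  assumes R: "set_of_recurrence R" and \<kappa>: "\<And>i. i < N \<Longrightarrow> \<kappa> i \<in> dual" and \<epsilon>: "\<epsilon> > 0"
  shows "set_of_recurrence {r \<in> R. \<forall>i<(N::nat). cmod (\<kappa> i r - 1) < \<epsilon>}"
  using \<kappa>
proof (induction N)
  case 0
  then show ?case using R by simp
next
  case (Suc N)
  have "{r \<in> R. \<forall>i<Suc N. cmod (\<kappa> i r - 1) < \<epsilon>} =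
      {r \<in> {r \<in> R. \<forall>i<N. cmod (\<kappa> i r - 1) < \<epsilon>}. cmod (\<kappa> N r - 1) < \<epsilon>}"
    by (auto simp: less_Suc_eq)
  then show ?case using set_of_recurrence_Bohr[OF Suc.IH _ \<epsilon>, of "\<kappa> N"] Suc.prems by simp
qed

text \<open>Return times come from \<open>S\<close> and from the Bohr-Hamming ball at once: some \<open>m\<close> in the translate of the
ball returns \<open>D\<close> to itself, and \<open>S + (h - m)\<close> is a set of recurrence even within a Bohr set.  Its
return time \<open>r = s + (h - m)\<close> satisfies \<open>\<kappa> i s = \<kappa> i r * \<kappa> i (m - h)\<close>, and both factors are close to 1
for most \<open>i\<close>.\<close>

lemma density_recurrent_Bohr_Hamming_translate:
  fixes S :: "'g::{ab_group_add,countable} set" and \<kappa> :: "nat \<Rightarrow> 'g \<Rightarrow> complex"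
  assumes S: "measure_expanding S" and \<kappa>: "\<And>i. i < N \<Longrightarrow> \<kappa> i \<in> dual"
    and near: "\<And>i j. i < N \<Longrightarrow> j < N \<Longrightarrow> cmod (\<kappa> j (g i) - (if i = j then cis (2 * pi / real M) else 1)) \<le> \<eta>"
    and \<eta>: "real N * real M * \<eta> \<le> \<epsilon>" and M: "M > 0"
    and roots: "\<And>i. i < N \<Longrightarrow> \<exists>y<M. cmod (\<kappa> i h - cis (2 * pi * real y / real M)) < \<epsilon>"
    and N: "real N < \<delta>\<^sup>2 * (\<rho> * real N)\<^sup>2" and \<delta>: "\<delta> > 0" and \<rho>: "\<rho> \<ge> 0" and \<epsilon>: "\<epsilon> > 0"
  shows "density_recurrent \<delta> ((\<lambda>s. s + h) ` {s \<in> S. real (card {i. i < N \<and> 4 * \<epsilon> \<le> cmod (\<kappa> i s - 1)}) \<le> \<rho> * real N})"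
  unfolding density_recurrent_def
proof (intro allI impI ballI)
  fix X :: "('g \<Rightarrow> bool) measure" and T :: "'g \<Rightarrow> ('g \<Rightarrow> bool) \<Rightarrow> ('g \<Rightarrow> bool)" and D
  assume sys: "G_system X T" and D: "D \<in> sets X" "measure X D > \<delta>"
  obtain m where m: "emeasure X (D \<inter> T m ` D) > 0"
    "real (card {i. i < N \<and> 3 * \<epsilon> \<le> cmod (\<kappa> i (m - h) - 1)}) \<le> \<rho> * real N"
    using Bohr_Hamming_recurrence[where \<kappa> = \<kappa>, OF \<kappa> near \<eta> M roots N \<delta> \<rho> sys D] by blast
  define D' where "D' = D \<inter> T m ` D"
  have D': "D' \<in> sets X" using D(1) G_system_image(2)[OF sys D(1)] by (simp add: D'_def)
  define R where "R = (\<lambda>s. s + (h - m)) ` S"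
  have "set_of_recurrence R" using S unfolding measure_expanding_def R_def by blast
  from set_of_recurrence_Bohr_finite[where \<kappa> = \<kappa>, OF this \<kappa> \<epsilon>]
  have "set_of_recurrence {r \<in> R. \<forall>i<N. cmod (\<kappa> i r - 1) < \<epsilon>}" by blast
  then obtain r where r: "r \<in> R" "\<And>i. i < N \<Longrightarrow> cmod (\<kappa> i r - 1) < \<epsilon>" "emeasure X (D' \<inter> T r ` D') > 0"
    using sys D' m(1) unfolding set_of_recurrence_def recurrent_on_def D'_def by blast
  obtain s where s: "s \<in> S" "r = s + (h - m)" using r(1) unfolding R_def by blast
  have "D' \<inter> T r ` D' \<subseteq> D \<inter> T (s + h) ` D"
  proof
    fix x assume x: "x \<in> D' \<inter> T r ` D'"
    then obtain y where y: "y \<in> D" "x = T r (T m y)" unfolding D'_def by blast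
    have "y \<in> space X" using y(1) sets.sets_into_space[OF D(1)] by blast
    then have "x = T (r + m) y" using G_systemD(4)[OF sys, of y r m] y(2) by simp
    then have "x = T (s + h) y" by (simp add: s(2))
    moreover have "x \<in> D" using x unfolding D'_def by simp
    ultimately show "x \<in> D \<inter> T (s + h) ` D" using y(1) by (simp add: image_eqI)
  qed
  moreover have "D \<inter> T (s + h) ` D \<in> sets X" using D(1) G_system_image(2)[OF sys D(1)] by simp
  ultimately have "emeasure X (D' \<inter> T r ` D') \<le> emeasure X (D \<inter> T (s + h) ` D)" by (rule emeasure_mono)
  then have pos: "emeasure X (D \<inter> T (s + h) ` D) > 0" using r(3) by simp
  have "{i. i < N \<and> 4 * \<epsilon> \<le> cmod (\<kappa> i s - 1)} \<subseteq> {i. i < N \<and> 3 * \<epsilon> \<le> cmod (\<kappa> i (m - h) - 1)}"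
  proof (clarify)
    fix i assume i: "i < N" and far: "4 * \<epsilon> \<le> cmod (\<kappa> i s - 1)"
    have "\<kappa> i s = \<kappa> i r * \<kappa> i (m - h)"
      using dualD(2)[OF \<kappa>[OF i], of r "m - h"] by (simp add: s(2))
    then have "cmod (\<kappa> i s - 1) \<le> cmod (\<kappa> i r - 1) + cmod (\<kappa> i (m - h) - 1)"
      using cmod_mult_diff_le[of "\<kappa> i (m - h)" 1 "\<kappa> i r" 1] dualD(1)[OF \<kappa>[OF i]] by simp
    then show "3 * \<epsilon> \<le> cmod (\<kappa> i (m - h) - 1)" using far r(2)[OF i] by simp
  qed
  then have "card {i. i < N \<and> 4 * \<epsilon> \<le> cmod (\<kappa> i s - 1)} \<le> card {i. i < N \<and> 3 * \<epsilon> \<le> cmod (\<kappa> i (m - h) - 1)}"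
    by (intro card_mono) auto
  then have "real (card {i. i < N \<and> 4 * \<epsilon> \<le> cmod (\<kappa> i s - 1)}) \<le> \<rho> * real N" using m(2) by linarith
  then show "\<exists>g\<in>(\<lambda>s. s + h) ` {s \<in> S. real (card {i. i < N \<and> 4 * \<epsilon> \<le> cmod (\<kappa> i s - 1)}) \<le> \<rho> * real N}.
      emeasure X (D \<inter> T g ` D) > 0"
    using s(1) pos by blast
qed

lemma density_recurrent_mono: "density_recurrent \<delta> R \<Longrightarrow> R \<subseteq> R' \<Longrightarrow> density_recurrent \<delta> R'"
  unfolding density_recurrent_def by (meson subsetD)

text \<open>A rotation by \<open>M div 2\<close> of \<open>M\<close> equal steps is between a third and a half of a full turn.\<close>

lemma half_turn_far:
  assumes M: "M \<ge> 2"
  shows "cmod (cis (2 * pi / real M) ^ (M div 2) - 1) \<ge> 3 / 2"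
proof -
  define z where "z = M div 2"
  define t where "t = 2 * pi * real z / real M"
  have z: "2 * real M \<le> 6 * real z" "2 * real z \<le> real M"
  proof -
    have "2 * M \<le> 6 * z" "2 * z \<le> M" using M unfolding z_def by presburger+
    then show "2 * real M \<le> 6 * real z" "2 * real z \<le> real M" by linarith+
  qed
  have Mp: "real M > 0" using M by simp
  have "2 * pi / 3 \<le> t"
  proof -
    have "pi * (2 * real M) \<le> pi * (6 * real z)" using z(1) by (intro mult_left_mono) auto
    then show ?thesis unfolding t_def using Mp by (simp add: field_simps)
  qed
  moreover have "t \<le> pi"
  proof -
    have "pi * (2 * real z) \<le> pi * real M" using z(2) by (intro mult_left_mono) auto
    then show ?thesis unfolding t_def using Mp by (simp add: field_simps)
  qed
  ultimately have "cos t \<le> cos (2 * pi / 3)" by (intro cos_monotone_0_pi_le) auto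
  also have "cos (2 * pi / 3) = - (1 / 2)"
    using cos_pi_minus[of "pi / 3"] cos_60 by (simp add: field_simps)
  finally have "3 / 2 \<le> \<bar>Re (cis t - 1)\<bar>" by simp
  also have "\<dots> \<le> cmod (cis t - 1)" by (rule abs_Re_le_cmod)
  also have "cis t = cis (2 * pi / real M) ^ z" by (simp add: Complex.DeMoivre t_def mult_ac)
  finally show ?thesis by (simp add: z_def)
qed

lemma dual_system_separated:
  assumes \<kappa>: "\<kappa> i \<in> dual" "\<kappa> j \<in> dual" and "i \<noteq> j" and M: "M \<ge> 2"
    and near: "cmod (\<kappa> i (g i) - cis (2 * pi / real M)) \<le> \<eta>" "cmod (\<kappa> j (g i) - 1) \<le> \<eta>"
    and \<eta>: "real M * \<eta> \<le> 1 / 4"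
  shows "cmod (\<kappa> i (int_mult (int (M div 2)) (g i)) - \<kappa> j (int_mult (int (M div 2)) (g i))) \<ge> 1"
proof -
  define z where "z = M div 2"
  have \<eta>0: "\<eta> \<ge> 0" using near(2) norm_ge_zero order_trans by blast
  have "real z * \<eta> \<le> real M * \<eta>" using \<eta>0 by (intro mult_right_mono) (auto simp: z_def)
  then have z\<eta>: "real z * \<eta> \<le> 1 / 4" using \<eta> by linarith
  have p: "\<gamma> (int_mult (int z) x) = \<gamma> x ^ z" if "\<gamma> \<in> dual" for \<gamma> and x
    using dualD(6)[OF that, of "int z" x] by simp
  have "cmod (\<kappa> i (g i) ^ z - cis (2 * pi / real M) ^ z) \<le> real z * cmod (\<kappa> i (g i) - cis (2 * pi / real M))"
    by (rule norm_power_diff) (auto simp: dualD(1)[OF \<kappa>(1)])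
  also have "\<dots> \<le> real z * \<eta>" using near(1) by (intro mult_left_mono) auto
  finally have 1: "cmod (\<kappa> i (g i) ^ z - cis (2 * pi / real M) ^ z) \<le> 1 / 4" using z\<eta> by linarith
  have "cmod (\<kappa> j (g i) ^ z - 1 ^ z) \<le> real z * cmod (\<kappa> j (g i) - 1)"
    by (rule norm_power_diff) (auto simp: dualD(1)[OF \<kappa>(2)])
  also have "\<dots> \<le> real z * \<eta>" using near(2) by (intro mult_left_mono) auto
  finally have 2: "cmod (\<kappa> j (g i) ^ z - 1) \<le> 1 / 4" using z\<eta> by simp
  have 3: "3 / 2 \<le> cmod (cis (2 * pi / real M) ^ z - 1)" using half_turn_far[OF M] by (simp add: z_def)
  have "cmod (cis (2 * pi / real M) ^ z - 1) \<le> cmod (\<kappa> i (g i) ^ z - cis (2 * pi / real M) ^ z)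
      + cmod (\<kappa> i (g i) ^ z - \<kappa> j (g i) ^ z) + cmod (\<kappa> j (g i) ^ z - 1)"
    by norm
  then have "cmod (\<kappa> i (g i) ^ z - \<kappa> j (g i) ^ z) \<ge> 1" using 1 2 3 by linarith
  then show ?thesis unfolding z_def[symmetric] p[OF \<kappa>(1)] p[OF \<kappa>(2)] .
qed

text \<open>The \<open>2 ^ n\<close> characters of stage \<open>j\<close> are indexed by the dyadic intervals of length \<open>1 / 2 ^ n\<close>.  The
piece \<open>S0\<close> lies in their Bohr-Hamming ball, and its translates by the first \<open>j + 1\<close> elements of the
group are recurrent for sets of measure greater than \<open>1 / 2 ^ (j + 3)\<close>.  Later stages may change characters only
slightly on the finite set \<open>E\<close>, which separates the characters of this stage.\<close>

definition stage :: "'g::{ab_group_add,countable} set \<Rightarrow> nat \<Rightarrow> nat \<Rightarrow> (nat \<Rightarrow> 'g \<Rightarrow> complex) \<Rightarrow> 'g set \<Rightarrow> 'g set \<Rightarrow> bool" where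
  "stage S j n \<kappa> E S0 \<longleftrightarrow> j < n \<and> (\<forall>i<2 ^ n. \<kappa> i \<in> dual) \<and> finite E \<and> from_nat j \<in> E \<and>
     finite S0 \<and> S0 \<subseteq> S \<and> S0 \<subseteq> E \<and>
     (\<forall>s\<in>S0. real (card {i. i < 2 ^ n \<and> 1 / 2 ^ (j + 3) \<le> cmod (\<kappa> i s - 1)}) \<le> 1 / 2 ^ (j + 3) * 2 ^ n) \<and>
     (\<forall>k\<le>j. density_recurrent (1 / 2 ^ (j + 3)) ((\<lambda>s. s + from_nat k) ` S0)) \<and>
     (\<forall>i<2 ^ n. \<forall>i'<2 ^ n. i \<noteq> i' \<longrightarrow> (\<exists>w\<in>E. 1 \<le> cmod (\<kappa> i w - \<kappa> i' w)))"

text \<open>The number \<open>2 ^ n\<close> of characters is chosen before the targets \<open>\<tau>\<close>, because the targets of a stage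
are characters of the preceding stage indexed by the parents of the \<open>2 ^ n\<close> intervals.\<close>

lemma stage_exists:
  fixes S :: "'g::{ab_group_add,countable} set"
  assumes rh: "reasonably_homogeneous TYPE('g)" and S: "measure_expanding S"
  shows "\<exists>n>n0. \<forall>\<tau> E. (\<forall>i<2 ^ n. \<tau> i \<in> dual) \<longrightarrow> finite E \<longrightarrow>
    (\<exists>\<kappa> E' S0. stage S j n \<kappa> E' S0 \<and> E \<subseteq> E' \<and> (\<forall>i<2 ^ n. \<forall>e\<in>E. cmod (\<kappa> i e - \<tau> i e) < 1 / 2 ^ (j + 3)))"
proof -
  define \<epsilon> :: real where "\<epsilon> = 1 / 2 ^ (j + 3)"
  have \<epsilon>: "\<epsilon> > 0" by (simp add: \<epsilon>_def)
  \<comment> \<open>Four errors of size \<open>\<epsilon>1\<close> add up in the recurrence statement; the bound \<open>1 / 4\<close> serves the separation.\<close>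
  define \<epsilon>1 where "\<epsilon>1 = min \<epsilon> 1 / 4"
  have \<epsilon>1: "\<epsilon>1 > 0" "4 * \<epsilon>1 \<le> \<epsilon>" "\<epsilon>1 \<le> 1 / 4" using \<epsilon> by (auto simp: \<epsilon>1_def)
  obtain M where M: "M \<ge> 2" "free_directions TYPE('g) M"
    and roots: "\<And>\<gamma> h. \<gamma> \<in> dual \<Longrightarrow> \<exists>y<M. cmod (\<gamma> (h::'g) - cis (2 * pi * real y / real M)) < \<epsilon>1"
    using reasonably_homogeneous_free_directions[OF rh \<epsilon>1(1)] by blast
  \<comment> \<open>Passing to a finite subset costs the difference between \<open>\<delta>\<close> and \<open>\<epsilon>\<close>.\<close>
  define \<delta> where "\<delta> = \<epsilon> / 2"
  have \<delta>: "\<delta> > 0" "\<delta> < \<epsilon>" using \<epsilon> by (auto simp: \<delta>_def)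
  obtain k :: nat where k: "real k > 1 / (\<delta>\<^sup>2 * \<epsilon>\<^sup>2)" using reals_Archimedean2 by blast
  define n where "n = Suc (max (max n0 j) k)"
  define N :: nat where "N = 2 ^ n"
  have n: "n > n0" "n > j" by (simp_all add: n_def)
  have N0: "N > 0" by (simp add: N_def)
  have "real k < real N"
  proof -
    have "k < n" by (simp add: n_def)
    also have "n < N" unfolding N_def by simp
    finally show ?thesis by simp
  qed
  then have "1 / (\<delta>\<^sup>2 * \<epsilon>\<^sup>2) < real N" using k by linarith
  then have "1 < \<delta>\<^sup>2 * \<epsilon>\<^sup>2 * real N" using \<delta> \<epsilon> by (simp add: field_simps)
  then have "real N * 1 < real N * (\<delta>\<^sup>2 * \<epsilon>\<^sup>2 * real N)" using N0 by (intro mult_strict_left_mono) auto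
  then have NN: "real N < \<delta>\<^sup>2 * (\<epsilon> * real N)\<^sup>2" by (simp add: power2_eq_square mult_ac)
  \<comment> \<open>A word involves up to \<open>N * M\<close> factors, whose errors add up.\<close>
  define \<eta> where "\<eta> = \<epsilon>1 / (real N * real M)"
  have NM: "real N * real M \<ge> 1" "real N > 0" "real M > 0"
  proof -
    have "1 * 1 \<le> real N * real M" using N0 M(1) by (intro mult_mono) auto
    then show "real N * real M \<ge> 1" by simp
  qed (use N0 M in auto)
  have \<eta>: "\<eta> > 0" "real N * real M * \<eta> \<le> \<epsilon>1" "real M * \<eta> \<le> 1 / 4" "\<eta> \<le> \<epsilon>"
  proof -
    show \<eta>0: "\<eta> > 0" unfolding \<eta>_def using \<epsilon>1(1) NM by simp
    show eq: "real N * real M * \<eta> \<le> \<epsilon>1" unfolding \<eta>_def using NM by simp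
    have "1 * (real M * \<eta>) \<le> real N * (real M * \<eta>)" using N0 \<eta>0 by (intro mult_right_mono) auto
    then show "real M * \<eta> \<le> 1 / 4" using eq \<epsilon>1(3) by (simp add: mult.assoc)
    have "1 * \<eta> \<le> (real N * real M) * \<eta>" using NM \<eta>0 by (intro mult_right_mono) auto
    then show "\<eta> \<le> \<epsilon>" using eq \<epsilon>1(1,2) by simp
  qed
  show ?thesis
  proof (intro exI[of _ n] conjI allI impI n(1))
    fix \<tau> :: "nat \<Rightarrow> 'g \<Rightarrow> complex" and E :: "'g set"
    assume \<tau>: "\<forall>i<2 ^ n. \<tau> i \<in> dual" and E: "finite E"
    have \<tau>N: "\<tau> i \<in> dual" if "i < N" for i using \<tau> that by (simp add: N_def)
    obtain \<kappa> g where \<kappa>g: "\<forall>i<N. \<kappa> i \<in> dual \<and> (\<forall>e\<in>E. cmod (\<kappa> i e - \<tau> i e) < \<eta>)"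
      "\<forall>i<N. \<forall>j<N. cmod (\<kappa> j (g i) - (if i = j then cis (2 * pi / real M) else 1)) < \<eta>"
      using dual_system_exists[where \<tau> = \<tau>, OF M(2) E \<tau>N \<eta>(1)] by blast
    have \<kappa>: "\<kappa> i \<in> dual" if "i < N" for i using \<kappa>g(1) that by blast
    have near: "cmod (\<kappa> j (g i) - (if i = j then cis (2 * pi / real M) else 1)) \<le> \<eta>" if "i < N" "j < N" for i j
      using \<kappa>g(2) that by (meson less_imp_le)
    define B where "B = {s \<in> S. real (card {i. i < N \<and> 4 * \<epsilon>1 \<le> cmod (\<kappa> i s - 1)}) \<le> \<epsilon> * real N}"
    have "\<exists>A\<subseteq>B. finite A \<and> density_recurrent \<epsilon> ((\<lambda>s. s + h) ` A)" for h
    proof -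
      have "M > 0" using M(1) by simp
      moreover have "\<exists>y<M. cmod (\<kappa> i h - cis (2 * pi * real y / real M)) < \<epsilon>1" if "i < N" for i
        by (rule roots[OF \<kappa>[OF that]])
      ultimately have "density_recurrent \<delta> ((\<lambda>s. s + h) ` B)"
        unfolding B_def using NN \<delta>(1) \<epsilon> \<epsilon>1(1) \<eta>(2)
        by (intro density_recurrent_Bohr_Hamming_translate[where g = g and \<eta> = \<eta> and M = M] S \<kappa> near) auto
      from density_recurrent_finite_subset[OF this \<delta>(2)]
      obtain A' where A': "A' \<subseteq> (\<lambda>s. s + h) ` B" "finite A'" "density_recurrent \<epsilon> A'" by blast
      from finite_subset_image[OF A'(2,1)] obtain A where "A \<subseteq> B" "finite A" "A' = (\<lambda>s. s + h) ` A" by blast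
      then show ?thesis using A'(3) by blast
    qed
    then obtain A where A: "\<And>h. A h \<subseteq> B" "\<And>h. finite (A h)" "\<And>h. density_recurrent \<epsilon> ((\<lambda>s. s + h) ` A h)"
      by metis
    define S0 where "S0 = (\<Union>k\<le>j. A (from_nat k))"
    \<comment> \<open>Between a third and a half of a turn for \<open>\<kappa> i\<close>, and nearly no turn for the other characters.\<close>
    define W where "W = (\<lambda>i. int_mult (int (M div 2)) (g i)) ` {..<N}"
    have S0: "finite S0" "S0 \<subseteq> B" unfolding S0_def using A by auto
    have rec: "density_recurrent \<epsilon> ((\<lambda>s. s + from_nat k) ` S0)" if "k \<le> j" for k
      by (rule density_recurrent_mono[OF A(3)[of "from_nat k"]]) (use that in \<open>auto simp: S0_def\<close>)
    have cardB: "real (card {i. i < N \<and> \<epsilon> \<le> cmod (\<kappa> i s - 1)}) \<le> \<epsilon> * real N" if "s \<in> B" for s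
    proof -
      have "card {i. i < N \<and> \<epsilon> \<le> cmod (\<kappa> i s - 1)} \<le> card {i. i < N \<and> 4 * \<epsilon>1 \<le> cmod (\<kappa> i s - 1)}"
        using \<epsilon>1(2) by (intro card_mono) auto
      then show ?thesis using that unfolding B_def by simp
    qed
    have sep: "\<exists>w\<in>W. 1 \<le> cmod (\<kappa> i w - \<kappa> j w)" if "i < N" "j < N" "i \<noteq> j" for i j
    proof -
      have "1 \<le> cmod (\<kappa> i (int_mult (int (M div 2)) (g i)) - \<kappa> j (int_mult (int (M div 2)) (g i)))"
        using near[of i i] near[of i j] that
        by (intro dual_system_separated[where \<eta> = \<eta>] \<kappa> M(1) \<eta>(3)) auto
      then show ?thesis using that(1) unfolding W_def by blast
    qed
    have finW: "finite W" by (simp add: W_def)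
    have near\<tau>: "\<forall>i<N. \<kappa> i \<in> dual \<and> (\<forall>e\<in>E. cmod (\<kappa> i e - \<tau> i e) < \<epsilon>)"
      using \<kappa>g(1) \<eta>(4) by force
    have BS: "B \<subseteq> S" by (auto simp: B_def)
    have NR: "real N = 2 ^ n" by (simp add: N_def)
    define E' where "E' = insert (from_nat j) (E \<union> S0 \<union> W)"
    have "stage S j n \<kappa> E' S0"
      unfolding stage_def \<epsilon>_def[symmetric] N_def[symmetric] NR[symmetric]
    proof (intro conjI)
      show "j < n" "finite S0" by (rule n S0)+
      show "\<forall>i<N. \<kappa> i \<in> dual" using \<kappa> by simp
      show "finite E'" using E S0(1) finW by (simp add: E'_def)
      show "from_nat j \<in> E'" "S0 \<subseteq> E'" by (auto simp: E'_def)
      show "S0 \<subseteq> S" using S0(2) BS by (rule subset_trans)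
      show "\<forall>s\<in>S0. real (card {i. i < N \<and> \<epsilon> \<le> cmod (\<kappa> i s - 1)}) \<le> \<epsilon> * real N"
        using S0(2) cardB by (simp add: subset_iff)
      show "\<forall>k\<le>j. density_recurrent \<epsilon> ((\<lambda>s. s + from_nat k) ` S0)" using rec by simp
      have "W \<subseteq> E'" by (auto simp: E'_def)
      then show "\<forall>i<N. \<forall>i'<N. i \<noteq> i' \<longrightarrow> (\<exists>w\<in>E'. 1 \<le> cmod (\<kappa> i w - \<kappa> i' w))"
        using sep by (meson subsetD)
    qed
    moreover have "E \<subseteq> E'" by (auto simp: E'_def)
    moreover have "\<forall>i<2 ^ n. \<forall>e\<in>E. cmod (\<kappa> i e - \<tau> i e) < 1 / 2 ^ (j + 3)"
      using near\<tau> by (simp add: \<epsilon>_def N_def)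
    ultimately show "\<exists>\<kappa> E' S0. stage S j n \<kappa> E' S0 \<and> E \<subseteq> E' \<and>
        (\<forall>i<2 ^ n. \<forall>e\<in>E. cmod (\<kappa> i e - \<tau> i e) < 1 / 2 ^ (j + 3))"
      by (intro exI conjI)
  qed
qed

section \<open>The limit of a tree of characters\<close>

lemma openin_dual: "openin dual_topology U \<longleftrightarrow> (\<exists>V. open V \<and> U = dual \<inter> V)"
  unfolding dual_topology_def by (rule openin_open)

text \<open>Every term of a dense sequence is repeated infinitely often, so that open sets are entered at
arbitrarily late stages, when only small perturbations follow.\<close>

lemma dual_dense_sequence:
  "\<exists>c :: nat \<Rightarrow> 'g::{ab_group_add,countable} \<Rightarrow> complex. range c \<subseteq> dual \<and>
     (\<forall>U. openin dual_topology U \<and> U \<noteq> {} \<longrightarrow> (\<forall>m0. \<exists>m\<ge>m0. c m \<in> U))"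
proof -
  obtain B :: "('g \<Rightarrow> complex) set set" where B: "countable B" "topological_basis B"
    using ex_countable_basis by blast
  define pick where "pick b = (SOME x. x \<in> b \<inter> (dual :: ('g \<Rightarrow> complex) set))" for b
  define B' where "B' = {b \<in> B. b \<inter> dual \<noteq> {}}"
  have pick: "pick b \<in> b \<inter> dual" if "b \<in> B'" for b
    using that someI_ex[of "\<lambda>x. x \<in> b \<inter> dual"] unfolding pick_def B'_def by blast
  have dense: "\<exists>b\<in>B'. pick b \<in> U" if U: "openin dual_topology U" "U \<noteq> {}" for U
  proof -
    obtain V where V: "open V" "U = dual \<inter> V"
      using openin_dual U(1) by metis
    obtain x where x: "x \<in> U" using U(2) by blast
    obtain b where b: "b \<in> B" "x \<in> b" "b \<subseteq> V"
      using topological_basisE[OF B(2) V(1), of x] x V(2) by blast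
    then have "b \<in> B'" using x V(2) by (auto simp: B'_def)
    then show ?thesis using pick[of b] b(3) V(2) by blast
  qed
  have one: "(\<lambda>_. 1) \<in> (dual :: ('g \<Rightarrow> complex) set)" by (simp add: dual_def)
  have "openin dual_topology (dual :: ('g \<Rightarrow> complex) set)" by (simp add: dual_topology_def)
  then have ne: "B' \<noteq> {}" using dense one by blast
  have cB: "countable B'" using B(1) by (auto simp: B'_def)
  define c where "c m = pick (from_nat_into B' (fst (prod_decode m)))" for m
  have "c m \<in> dual" for m using pick[OF from_nat_into[OF ne]] by (simp add: c_def)
  moreover have "\<exists>m\<ge>m0. c m \<in> U" if U: "openin dual_topology U" "U \<noteq> {}" for U m0
  proof -
    obtain b where b: "b \<in> B'" "pick b \<in> U" using dense[OF U] by blast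
    \<comment> \<open>The second component is used only to repeat the first one at late places.\<close>
    define m where "m = prod_encode (to_nat_on B' b, m0)"
    have "c m = pick b" using cB b(1) by (simp add: c_def m_def)
    moreover have "m \<ge> m0" unfolding m_def by (rule le_prod_encode_2)
    ultimately show ?thesis using b(2) by auto
  qed
  ultimately show ?thesis by (intro exI[of _ c]) auto
qed

lemma dual_open_contains_box:
  assumes U: "openin dual_topology U" and x: "x \<in> U"
  shows "\<exists>F \<delta>. finite F \<and> \<delta> > 0 \<and> (\<forall>\<gamma>\<in>dual. (\<forall>g\<in>F. cmod (\<gamma> g - x g) < \<delta>) \<longrightarrow> \<gamma> \<in> U)"
proof -
  obtain V where V: "open V" "U = dual \<inter> V"
    using openin_dual U by metis
  have "openin (product_topology (\<lambda>_. euclidean) UNIV) V" using V(1) by (simp add: open_fun_def)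
  from product_topology_open_contains_basis[OF this, of x] x V(2)
  obtain X where X: "x \<in> (\<Pi>\<^sub>E i\<in>UNIV. X i)" "\<And>i. open (X i)" "finite {i. X i \<noteq> UNIV}" "(\<Pi>\<^sub>E i\<in>UNIV. X i) \<subseteq> V"
    by auto
  have "\<exists>d>0. ball (x i) d \<subseteq> X i" for i
    using X(1) X(2)[of i] by (auto simp: open_contains_ball)
  then obtain d where d: "\<And>i. d i > 0" "\<And>i. ball (x i) (d i) \<subseteq> X i" by metis
  define F where "F = {i. X i \<noteq> UNIV}"
  define \<delta> where "\<delta> = Min (insert 1 (d ` F))"
  have fin: "finite F" using X(3) by (simp add: F_def)
  have \<delta>: "\<delta> > 0" "\<And>i. i \<in> F \<Longrightarrow> \<delta> \<le> d i" unfolding \<delta>_def using fin d(1) by auto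
  have "\<gamma> \<in> U" if \<gamma>: "\<gamma> \<in> dual" "\<forall>g\<in>F. cmod (\<gamma> g - x g) < \<delta>" for \<gamma>
  proof -
    have "\<gamma> i \<in> X i" for i
    proof (cases "i \<in> F")
      case True
      then have "cmod (\<gamma> i - x i) < d i" using \<gamma>(2) \<delta>(2)[OF True] by fastforce
      then have "\<gamma> i \<in> ball (x i) (d i)" by (simp add: dist_norm norm_minus_commute)
      then show ?thesis using d(2) by blast
    qed (simp add: F_def)
    then have "\<gamma> \<in> V" using X(4) by (auto simp: subset_iff)
    then show ?thesis using V(2) \<gamma>(1) by blast
  qed
  then show ?thesis using fin \<delta>(1) by blast
qed

text \<open>The index of the dyadic interval of length \<open>1 / 2 ^ n\<close> that contains the point.\<close>

definition cell :: "nat \<Rightarrow> real \<Rightarrow> nat" where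
  "cell n t = nat \<lfloor>t * 2 ^ n\<rfloor>"

lemma cell_less:
  assumes "t \<in> {0..<1}"
  shows "cell n t < 2 ^ n"
proof -
  have "t * 2 ^ n < 1 * 2 ^ n" using assms by (intro mult_strict_right_mono) auto
  then have "\<lfloor>t * 2 ^ n\<rfloor> < 2 ^ n" by (simp add: floor_less_iff)
  then show ?thesis unfolding cell_def using assms by (simp add: nat_less_iff)
qed

lemma cell_bounds:
  assumes "t \<ge> 0"
  shows "real (cell n t) / 2 ^ n \<le> t" "t < (real (cell n t) + 1) / 2 ^ n"
proof -
  have "t * 2 ^ n \<ge> 0" using assms by simp
  then have "real (cell n t) \<le> t * 2 ^ n" "t * 2 ^ n < real (cell n t) + 1"
    unfolding cell_def by linarith+
  then show "real (cell n t) / 2 ^ n \<le> t" "t < (real (cell n t) + 1) / 2 ^ n"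
    by (simp_all add: field_simps)
qed

lemma cell_div:
  assumes "t \<ge> 0" "n \<le> n'"
  shows "cell n' t div 2 ^ (n' - n) = cell n t"
proof -
  obtain d where d: "n' = n + d" using assms(2) le_Suc_ex by blast
  have "t * 2 ^ n' / real_of_int (2 ^ d) = t * 2 ^ n"
    unfolding d by (simp add: power_add)
  then have "\<lfloor>t * 2 ^ n'\<rfloor> div 2 ^ d = \<lfloor>t * 2 ^ n\<rfloor>"
    using floor_divide_real_eq_div[of "2 ^ d" "t * 2 ^ n'"] by simp
  then have "nat (\<lfloor>t * 2 ^ n'\<rfloor> div 2 ^ d) = cell n t" by (simp add: cell_def)
  moreover have "0 \<le> \<lfloor>t * 2 ^ n'\<rfloor>" using assms(1) by simp
  ultimately show ?thesis
    unfolding cell_def d by (simp add: nat_div_distrib nat_power_eq)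
qed

text \<open>The threshold is an end point of a dyadic interval of length \<open>1 / 2 ^ n\<close>, so whether a point has
passed it can be read off from its cell.\<close>

lemma cell_dyadic_threshold:
  assumes "t \<ge> 0" "j \<le> n"
  shows "1 - 1 / 2 ^ j \<le> real (cell n t) / 2 ^ n \<longleftrightarrow> 1 - 1 / 2 ^ j \<le> t"
proof
  assume "1 - 1 / 2 ^ j \<le> real (cell n t) / 2 ^ n"
  then show "1 - 1 / 2 ^ j \<le> t" using cell_bounds(1)[OF assms(1), of n] by linarith
next
  assume a: "1 - 1 / 2 ^ j \<le> t"
  obtain d where d: "n = j + d" using assms(2) le_Suc_ex by blast
  define q :: int where "q = 2 ^ n - 2 ^ d"
  have q: "real_of_int q = (1 - 1 / 2 ^ j) * 2 ^ n"
    by (simp add: q_def d power_add field_simps)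
  have "real_of_int q \<le> t * 2 ^ n" unfolding q using a by (intro mult_right_mono) auto
  then have "q \<le> \<lfloor>t * 2 ^ n\<rfloor>" by (simp add: le_floor_iff)
  then have "q \<le> int (cell n t)" unfolding cell_def by linarith
  then have "real_of_int q \<le> real (cell n t)" by linarith
  then show "1 - 1 / 2 ^ j \<le> real (cell n t) / 2 ^ n" unfolding q by (simp add: field_simps)
qed

lemma measurable_cell: "(\<lambda>t. f (cell n t)) \<in> borel_measurable unit_interval" for f :: "nat \<Rightarrow> complex"
proof -
  have "(\<lambda>t::real. \<lfloor>t * 2 ^ n\<rfloor>) \<in> measurable borel (count_space UNIV)" by measurable
  then have "(\<lambda>t::real. f (nat \<lfloor>t * 2 ^ n\<rfloor>)) \<in> borel_measurable borel"
    by (rule measurable_compose) simp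
  then show ?thesis unfolding cell_def unit_interval_def
    by (intro measurable_restrict_space1) simp
qed

lemma cell_set_measure:
  assumes "finite J"
  shows "{t\<in>{0..<1}. cell n t \<in> J} \<in> sets unit_interval"
    and "measure unit_interval {t\<in>{0..<1}. cell n t \<in> J} \<le> real (card J) / 2 ^ n"
proof -
  interpret prob_space unit_interval by (rule prob_space_unit_interval)
  define I where "I i = {real i / 2 ^ n..<(real i + 1) / 2 ^ n} \<inter> {0..<1::real}" for i
  have I: "I i \<in> sets unit_interval" for i by (simp add: I_def sets_unit_interval)
  have Im: "measure unit_interval (I i) \<le> 1 / 2 ^ n" for i
  proof -
    have "emeasure unit_interval (I i) = emeasure lborel (I i)" by (rule emeasure_unit_interval) (simp add: I_def)
    also have "\<dots> \<le> emeasure lborel {real i / 2 ^ n..<(real i + 1) / 2 ^ n}"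
      by (intro emeasure_mono) (auto simp: I_def)
    also have "\<dots> = ennreal (1 / 2 ^ n)" by (simp add: divide_right_mono diff_divide_distrib[symmetric])
    finally show ?thesis by (simp add: emeasure_eq_measure)
  qed
  have cell_iff: "t \<in> I i \<longleftrightarrow> cell n t = i" if "t \<in> {0..<1}" for t i
  proof
    assume "cell n t = i"
    then show "t \<in> I i" using cell_bounds[of t n] that by (auto simp: I_def)
  next
    assume "t \<in> I i"
    then have "real i \<le> t * 2 ^ n" "t * 2 ^ n < real i + 1" by (auto simp: I_def field_simps)
    then have "\<lfloor>t * 2 ^ n\<rfloor> = int i" by linarith
    then show "cell n t = i" by (simp add: cell_def)
  qed
  have eq: "{t\<in>{0..<1}. cell n t \<in> J} = (\<Union>i\<in>J. I i)"
  proof (intro equalityI subsetI)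
    fix t assume "t \<in> {t\<in>{0..<1}. cell n t \<in> J}"
    then have w: "t \<in> {0..<1}" "cell n t \<in> J" by auto
    show "t \<in> (\<Union>i\<in>J. I i)" using cell_iff[OF w(1), of "cell n t"] w(2) by (intro UN_I) auto
  next
    fix t assume "t \<in> (\<Union>i\<in>J. I i)"
    then obtain i where i: "i \<in> J" "t \<in> I i" by (elim UN_E)
    then have "t \<in> {0..<1}" unfolding I_def by (elim IntD2)
    then show "t \<in> {t\<in>{0..<1}. cell n t \<in> J}" using cell_iff[of t i] i by simp
  qed
  show "{t\<in>{0..<1}. cell n t \<in> J} \<in> sets unit_interval"
    unfolding eq using assms I by auto
  have "measure unit_interval (\<Union>i\<in>J. I i) \<le> (\<Sum>i\<in>J. measure unit_interval (I i))"
    using assms I by (intro finite_measure_subadditive_finite) auto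
  also have "\<dots> \<le> (\<Sum>i\<in>J. 1 / 2 ^ n)" by (intro sum_mono Im)
  finally show "measure unit_interval {t\<in>{0..<1}. cell n t \<in> J} \<le> real (card J) / 2 ^ n"
    unfolding eq by simp
qed

lemma interval_measure:
  assumes "0 \<le> a" "a \<le> b" "b \<le> 1"
  shows "{a..<b} \<in> sets unit_interval" "measure unit_interval {a..<b} = b - a"
    "emeasure unit_interval {a..<b} = ennreal (b - a)"
proof -
  show "{a..<b} \<in> sets unit_interval" using assms by (auto simp: sets_unit_interval)
  show "emeasure unit_interval {a..<b} = ennreal (b - a)"
    using assms by (subst emeasure_unit_interval) auto
  then show "measure unit_interval {a..<b} = b - a" using assms by (simp add: measure_def)
qed

lemma dyadic_tail_measure:
  "{1 - 1 / 2 ^ j..<1} \<in> sets unit_interval" "measure unit_interval {1 - 1 / 2 ^ j..<1} = 1 / 2 ^ j"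
proof -
  have "(1::real) \<le> 2 ^ j" by (rule one_le_power) simp
  then have "0 \<le> 1 - 1 / (2::real) ^ j" "1 - 1 / (2::real) ^ j \<le> 1" by simp_all
  from interval_measure(1,2)[OF this order_refl]
  show "{1 - 1 / 2 ^ j..<1} \<in> sets unit_interval" "measure unit_interval {1 - 1 / 2 ^ j..<1} = 1 / 2 ^ j"
    by simp_all
qed

text \<open>The points \<open>t\<close> of the unit interval are the branches of the tree.  At each stage \<open>j > 0\<close> with
\<open>1 - 1 / 2 ^ j \<le> t\<close> the character of the branch is reset close to \<open>c j\<close>, and the branch is said to start
at the last such stage; from then on its characters stay close to their predecessors on the sets
\<open>E j\<close>.\<close>

locale character_tree =
  fixes n :: "nat \<Rightarrow> nat" and \<kappa> :: "nat \<Rightarrow> nat \<Rightarrow> 'g::{ab_group_add,countable} \<Rightarrow> complex"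
    and E :: "nat \<Rightarrow> 'g set" and c :: "nat \<Rightarrow> 'g \<Rightarrow> complex"
  assumes n_gt: "j < n j" and n_mono: "n j < n (Suc j)"
    and \<kappa>_dual: "i < 2 ^ n j \<Longrightarrow> \<kappa> j i \<in> dual"
    and E_mono: "E j \<subseteq> E (Suc j)" and E_enum: "from_nat j \<in> E j"
    and separated: "i < 2 ^ n j \<Longrightarrow> i' < 2 ^ n j \<Longrightarrow> i \<noteq> i' \<Longrightarrow> \<exists>w\<in>E j. 1 \<le> cmod (\<kappa> j i w - \<kappa> j i' w)"
    and successor: "i < 2 ^ n (Suc j) \<Longrightarrow> e \<in> E j \<Longrightarrow>
      cmod (\<kappa> (Suc j) i e - (if 1 - 1 / 2 ^ Suc j \<le> real i / 2 ^ n (Suc j) then c (Suc j) e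
        else \<kappa> j (i div 2 ^ (n (Suc j) - n j)) e)) < 1 / 2 ^ (j + 4)"
begin

definition level :: "nat \<Rightarrow> real \<Rightarrow> 'g \<Rightarrow> complex" where
  "level j t = \<kappa> j (cell (n j) t)"

definition branch :: "real \<Rightarrow> 'g \<Rightarrow> complex" where
  "branch t g = lim (\<lambda>j. level j t g)"

lemma level_dual: "t \<in> {0..<1} \<Longrightarrow> level j t \<in> dual"
  unfolding level_def by (intro \<kappa>_dual cell_less)

lemma E_le: "j \<le> k \<Longrightarrow> E j \<subseteq> E k"
  using E_mono lift_Suc_mono_le by metis

lemma level_Suc_new:
  assumes "t \<in> {0..<1}" "1 - 1 / 2 ^ Suc j \<le> t" "e \<in> E j"
  shows "cmod (level (Suc j) t e - c (Suc j) e) < 1 / 2 ^ (j + 4)"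
proof -
  have "1 - 1 / 2 ^ Suc j \<le> real (cell (n (Suc j)) t) / 2 ^ n (Suc j)"
    using assms(1,2) n_gt[of "Suc j"] by (subst cell_dyadic_threshold) auto
  then show ?thesis
    using successor[OF cell_less[OF assms(1)] assms(3)] unfolding level_def by simp
qed

lemma level_Suc_old:
  assumes "t \<in> {0..<1}" "t < 1 - 1 / 2 ^ Suc j" "e \<in> E j"
  shows "cmod (level (Suc j) t e - level j t e) < 1 / 2 ^ (j + 4)"
proof -
  have "\<not> 1 - 1 / 2 ^ Suc j \<le> real (cell (n (Suc j)) t) / 2 ^ n (Suc j)"
    using assms(1,2) n_gt[of "Suc j"] by (subst cell_dyadic_threshold) auto
  moreover have "cell (n (Suc j)) t div 2 ^ (n (Suc j) - n j) = cell (n j) t"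
    using assms(1) n_mono[of j] by (intro cell_div) auto
  ultimately show ?thesis
    using successor[OF cell_less[OF assms(1)] assms(3)] unfolding level_def by simp
qed

lemma dyadic_threshold_mono: "j \<le> k \<Longrightarrow> (1::real) - 1 / 2 ^ j \<le> 1 - 1 / 2 ^ k"
  by (simp add: frac_le power_increasing)

text \<open>The increments after stage \<open>j\<close> are dominated by a geometric series; the form of the bound is
adapted to induction.\<close>

lemma level_diff:
  assumes t: "t \<in> {0..<1}" "t < 1 - 1 / 2 ^ Suc j" and e: "e \<in> E j" and k: "j \<le> k"
  shows "cmod (level k t e - level j t e) \<le> 1 / 2 ^ (j + 3) - 1 / 2 ^ (k + 3)"
  using k
proof (induction rule: dec_induct)
  case base show ?case by simp
next
  case (step k)
  have "t < 1 - 1 / 2 ^ Suc k"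
    using t(2) dyadic_threshold_mono[of "Suc j" "Suc k"] step(1) by linarith
  moreover have "e \<in> E k" using e E_le[OF step(1)] by blast
  ultimately have "cmod (level (Suc k) t e - level k t e) < 1 / 2 ^ (k + 4)" by (rule level_Suc_old[OF t(1)])
  moreover have "cmod (level (Suc k) t e - level j t e) \<le> cmod (level (Suc k) t e - level k t e) + cmod (level k t e - level j t e)"
    by norm
  ultimately have "cmod (level (Suc k) t e - level j t e) \<le> 1 / 2 ^ (k + 4) + (1 / 2 ^ (j + 3) - 1 / 2 ^ (k + 3))"
    using step.IH by linarith
  also have "\<dots> = 1 / 2 ^ (j + 3) - 1 / 2 ^ (Suc k + 3)" by (simp add: power_add field_simps)
  finally show ?case .
qed

lemma eventually_started:
  assumes "t \<in> {0..<1::real}"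
  shows "\<exists>j0. \<forall>j\<ge>j0. t < 1 - 1 / 2 ^ Suc j"
proof -
  have "1 - t > 0" using assms by simp
  then obtain j0 where "(1 / 2) ^ j0 < 1 - t" using real_arch_pow_inv[of "1 - t" "1 / 2"] by auto
  then have j0: "1 / 2 ^ j0 < 1 - t" by (simp add: power_one_over)
  have "t < 1 - 1 / 2 ^ Suc j" if "j \<ge> j0" for j
    using dyadic_threshold_mono[of j0 "Suc j"] that j0 by linarith
  then show ?thesis by blast
qed

lemma branch_limit:
  assumes t: "t \<in> {0..<1}"
  shows "(\<lambda>j. level j t g) \<longlonglongrightarrow> branch t g"
proof -
  obtain j0 where j0: "\<And>j. j \<ge> j0 \<Longrightarrow> t < 1 - 1 / 2 ^ Suc j" using eventually_started[OF t] by blast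
  have "Cauchy (\<lambda>j. level j t g)"
  proof (rule metric_CauchyI)
    fix r :: real assume "r > 0"
    then obtain j1 where "(1 / 2) ^ j1 < r" using real_arch_pow_inv[of r "1 / 2"] by auto
    then have j1: "1 / 2 ^ j1 < r" by (simp add: power_one_over)
    define J where "J = max j0 (max j1 (to_nat g))"
    have "(1::real) / 2 ^ J \<le> 1 / 2 ^ j1" using dyadic_threshold_mono[of j1 J] by (simp add: J_def)
    then have J: "1 / 2 ^ J < r" using j1 by linarith
    have "to_nat g \<le> J" by (simp add: J_def)
    then have gE: "g \<in> E J" using E_le[of "to_nat g" J] E_enum[of "to_nat g"] by auto
    have half: "cmod (level k t g - level J t g) \<le> 1 / 2 ^ (J + 3)" if "k \<ge> J" for k
    proof -
      have "cmod (level k t g - level J t g) \<le> 1 / 2 ^ (J + 3) - 1 / 2 ^ (k + 3)"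
        using level_diff[OF t j0 gE that] by (simp add: J_def)
      also have "\<dots> \<le> 1 / 2 ^ (J + 3)" by simp
      finally show ?thesis .
    qed
    have "dist (level k t g) (level l t g) < r" if "k \<ge> J" "l \<ge> J" for k l
    proof -
      have "dist (level k t g) (level l t g) \<le> cmod (level k t g - level J t g) + cmod (level l t g - level J t g)"
        unfolding dist_norm by norm
      also have "\<dots> \<le> 1 / 2 ^ (J + 3) + 1 / 2 ^ (J + 3)" using half that by (intro add_mono) auto
      also have "\<dots> \<le> 1 / 2 ^ J" by (simp add: power_add field_simps)
      finally show ?thesis using J by linarith
    qed
    then show "\<exists>M. \<forall>m\<ge>M. \<forall>n\<ge>M. dist (level m t g) (level n t g) < r" by blast
  qed
  then show ?thesis unfolding branch_def by (simp add: Cauchy_convergent_iff convergent_LIMSEQ_iff)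
qed

lemma branch_dual:
  assumes t: "t \<in> {0..<1}"
  shows "branch t \<in> dual"
  unfolding dual_def
proof (intro CollectI conjI allI)
  fix g h
  have "(\<lambda>j. cmod (level j t g)) \<longlonglongrightarrow> cmod (branch t g)" by (intro tendsto_norm branch_limit t)
  then show "cmod (branch t g) = 1"
    using dualD(1)[OF level_dual[OF t]] LIMSEQ_unique[OF _ tendsto_const] by simp
  have "(\<lambda>j. level j t g * level j t h) \<longlonglongrightarrow> branch t g * branch t h" by (intro tendsto_mult branch_limit t)
  then have "(\<lambda>j. level j t (g + h)) \<longlonglongrightarrow> branch t g * branch t h"
    by (simp add: dualD(2)[OF level_dual[OF t]])
  then show "branch t (g + h) = branch t g * branch t h"
    using branch_limit[OF t] LIMSEQ_unique by blast
qed

lemma branch_near: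
  assumes t: "t \<in> {0..<1}" "t < 1 - 1 / 2 ^ Suc j" and e: "e \<in> E j"
  shows "cmod (branch t e - level j t e) \<le> 1 / 2 ^ (j + 3)"
proof (rule LIMSEQ_le_const2)
  show "(\<lambda>k. cmod (level k t e - level j t e)) \<longlonglongrightarrow> cmod (branch t e - level j t e)"
    by (intro tendsto_intros branch_limit t)
  have "cmod (level k t e - level j t e) \<le> 1 / 2 ^ (j + 3)" if "k \<ge> j" for k
  proof -
    have "cmod (level k t e - level j t e) \<le> 1 / 2 ^ (j + 3) - 1 / 2 ^ (k + 3)" by (rule level_diff[OF t e that])
    also have "\<dots> \<le> 1 / 2 ^ (j + 3)" by simp
    finally show ?thesis .
  qed
  then show "\<exists>N. \<forall>k\<ge>N. cmod (level k t e - level j t e) \<le> 1 / 2 ^ (j + 3)" by blast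
qed

lemma branch_coordinate_measurable: "(\<lambda>t. branch t g) \<in> borel_measurable unit_interval"
proof (rule borel_measurable_LIMSEQ_metric)
  show "(\<lambda>t. level j t g) \<in> borel_measurable unit_interval" for j
    unfolding level_def by (rule measurable_cell)
  show "(\<lambda>j. level j t g) \<longlonglongrightarrow> branch t g" if "t \<in> space unit_interval" for t
    using that by (intro branch_limit) simp
qed

definition dual_sigma :: "('g \<Rightarrow> complex) measure" where
  "dual_sigma = sigma dual {U. openin dual_topology U}"

definition limit_measure :: "('g \<Rightarrow> complex) measure" where
  "limit_measure = distr unit_interval dual_sigma branch"

lemma openin_dual_subset: "{U. openin dual_topology U} \<subseteq> Pow (dual :: ('g \<Rightarrow> complex) set)"
  by (auto simp: dual_topology_def openin_open)

lemma space_dual_sigma: "space dual_sigma = dual"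
  unfolding dual_sigma_def using openin_dual_subset by (simp add: space_measure_of)

lemma sets_dual_sigma: "sets dual_sigma = sigma_sets dual {U. openin dual_topology U}"
  unfolding dual_sigma_def using openin_dual_subset by (simp add: sets_measure_of)

lemma branch_measurable: "branch \<in> measurable unit_interval dual_sigma"
  unfolding dual_sigma_def
proof (rule measurable_measure_of[OF openin_dual_subset])
  show "branch \<in> space unit_interval \<rightarrow> dual" using branch_dual by simp
  fix U :: "('g \<Rightarrow> complex) set" assume "U \<in> {U. openin dual_topology U}"
  then have "openin dual_topology U" by simp
  then obtain V where V: "open V" "U = dual \<inter> V" using openin_dual by metis
  have "branch \<in> borel_measurable unit_interval"
    by (rule measurable_coordinatewise_then_product) (rule branch_coordinate_measurable)
  then have "branch -` V \<inter> space unit_interval \<in> sets unit_interval"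
    using measurable_sets[OF _ borel_open[OF V(1)]] by blast
  moreover have "branch -` U \<inter> space unit_interval = branch -` V \<inter> space unit_interval"
    using branch_dual V(2) by auto
  ultimately show "branch -` U \<inter> space unit_interval \<in> sets unit_interval" by simp
qed

lemma borel_prob_limit_measure: "borel_prob_on_dual limit_measure"
  unfolding borel_prob_on_dual_def limit_measure_def
  using prob_space.prob_space_distr[OF prob_space_unit_interval branch_measurable]
  by (simp add: space_dual_sigma sets_dual_sigma)

lemma evaluation_measurable: "(\<lambda>\<gamma>. \<gamma> s) \<in> borel_measurable dual_sigma"
proof (rule borel_measurableI)
  fix V :: "complex set" assume "open V"
  then have "open ((\<lambda>\<gamma>. \<gamma> s) -` V :: ('g \<Rightarrow> complex) set)"
    by (intro open_vimage continuous_on_product_coordinates)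
  then have "openin dual_topology (dual \<inter> (\<lambda>\<gamma>. \<gamma> s) -` V)"
    unfolding openin_dual by auto
  then show "(\<lambda>\<gamma>. \<gamma> s) -` V \<inter> space dual_sigma \<in> sets dual_sigma"
    unfolding space_dual_sigma sets_dual_sigma by (intro sigma_sets.Basic) (simp add: Int_commute)
qed

lemma fourier_limit_measure: "fourier limit_measure s = (\<integral>t. branch t s \<partial>unit_interval)"
  unfolding fourier_def limit_measure_def
  by (rule integral_distr[OF branch_measurable evaluation_measurable])

text \<open>The inequality holds also for sets that are not measurable, where the left-hand side is 0.\<close>

lemma emeasure_limit_measure:
  "emeasure limit_measure A \<le> emeasure unit_interval (branch -` A \<inter> {0..<1})"
  "A \<in> sets dual_sigma \<Longrightarrow> emeasure limit_measure A = emeasure unit_interval (branch -` A \<inter> {0..<1})"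
proof -
  show eq: "A \<in> sets dual_sigma \<Longrightarrow> emeasure limit_measure A = emeasure unit_interval (branch -` A \<inter> {0..<1})"
    unfolding limit_measure_def by (simp add: emeasure_distr[OF branch_measurable])
  show "emeasure limit_measure A \<le> emeasure unit_interval (branch -` A \<inter> {0..<1})"
  proof (cases "A \<in> sets dual_sigma")
    case False
    then have "emeasure limit_measure A = 0" by (intro emeasure_notin_sets) (simp add: limit_measure_def)
    then show ?thesis by simp
  qed (simp add: eq)
qed

text \<open>The exceptional branches are those that start after stage \<open>j\<close> and those whose character of
stage \<open>j\<close> is one of the few with a value at \<open>s\<close> far from 1.\<close>

lemma fourier_near_1:
  assumes s: "s \<in> E j"
    and few: "real (card {i. i < 2 ^ n j \<and> 1 / 2 ^ (j + 3) \<le> cmod (\<kappa> j i s - 1)}) \<le> 1 / 2 ^ (j + 3) * 2 ^ n j"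
  shows "cmod (fourier limit_measure s - 1) \<le> 2 / 2 ^ j"
proof -
  interpret prob_space unit_interval by (rule prob_space_unit_interval)
  define J where "J = {i. i < 2 ^ n j \<and> 1 / 2 ^ (j + 3) \<le> cmod (\<kappa> j i s - 1)}"
  define B1 where "B1 = {t\<in>{0..<1}. cell (n j) t \<in> J}"
  define B2 where "B2 = {1 - 1 / 2 ^ Suc j..<1::real}"
  have "finite J" by (simp add: J_def)
  note B1 = cell_set_measure[OF this, of "n j", folded B1_def]
  have B2: "B2 \<in> sets unit_interval" "measure unit_interval B2 = 1 / 2 ^ Suc j"
    unfolding B2_def by (rule dyadic_tail_measure)+
  define f :: "real \<Rightarrow> real" where "f t = 2 / 2 ^ (j + 3) + 2 * indicator (B1 \<union> B2) t" for t :: real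
  have bound: "cmod (branch t s - 1) \<le> f t" if t: "t \<in> {0..<1}" for t
  proof (cases "t \<in> B1 \<union> B2")
    case True
    have "cmod (branch t s - 1) \<le> cmod (branch t s) + cmod 1" by (rule norm_triangle_ineq4)
    then have "cmod (branch t s - 1) \<le> 2" using dualD(1)[OF branch_dual[OF t], of s] by simp
    moreover have "2 \<le> f t" using True by (simp add: f_def)
    ultimately show ?thesis by linarith
  next
    case False
    then have lt: "t < 1 - 1 / 2 ^ Suc j" using t by (auto simp: B2_def)
    have "cell (n j) t \<notin> J" using False t by (auto simp: B1_def)
    then have "cmod (level j t s - 1) < 1 / 2 ^ (j + 3)"
      using cell_less[OF t, of "n j"] by (auto simp: J_def level_def)
    moreover have "cmod (branch t s - 1) \<le> cmod (branch t s - level j t s) + cmod (level j t s - 1)" by norm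
    ultimately have "cmod (branch t s - 1) \<le> 1 / 2 ^ (j + 3) + 1 / 2 ^ (j + 3)"
      using branch_near[OF t lt s] by linarith
    then show ?thesis using False by (simp add: f_def)
  qed
  have intf: "integrable unit_interval f"
    unfolding f_def using B1(1) B2(1) by (intro Bochner_Integration.integrable_add integrable_mult_right integrable_real_indicator)
      (auto simp: emeasure_eq_measure)
  have intb: "integrable unit_interval (\<lambda>t. branch t s)"
    by (rule integrable_const_bound[of _ 1])
      (auto intro!: AE_I2 branch_coordinate_measurable simp: dualD(1)[OF branch_dual])
  have total: "measure unit_interval {0..<1} = 1" using prob_space by simp
  have "fourier limit_measure s - 1 = (\<integral>t. branch t s - 1 \<partial>unit_interval)"
    unfolding fourier_limit_measure using intb by (simp add: total)
  also have "cmod \<dots> \<le> (\<integral>t. cmod (branch t s - 1) \<partial>unit_interval)" by (rule integral_norm_bound)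
  also have "\<dots> \<le> (\<integral>t. f t \<partial>unit_interval)"
    using intb intf bound by (intro integral_mono integrable_norm Bochner_Integration.integrable_diff) auto
  finally have le_int: "cmod (fourier limit_measure s - 1) \<le> (\<integral>t. f t \<partial>unit_interval)" .
  have B12: "(B1 \<union> B2) \<inter> {0..<1} = B1 \<union> B2"
    using sets.sets_into_space[OF B1(1)] sets.sets_into_space[OF B2(1)] by auto
  have "(\<integral>t. f t \<partial>unit_interval) = 2 / 2 ^ (j + 3) + 2 * measure unit_interval (B1 \<union> B2)"
    unfolding f_def using B1(1) B2(1) by (simp add: total emeasure_eq_measure B12)
  also have "measure unit_interval (B1 \<union> B2) \<le> 1 / 2 ^ (j + 3) + 1 / 2 ^ Suc j"
  proof -
    have "real (card J) / 2 ^ n j \<le> 1 / 2 ^ (j + 3)" using few unfolding J_def[symmetric] by (simp add: field_simps)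
    then show ?thesis using measure_Un_le[OF B1(1) B2(1)] B1(2) B2(2) by linarith
  qed
  finally have "cmod (fourier limit_measure s - 1) \<le> 2 / 2 ^ (j + 3) + 2 * (1 / 2 ^ (j + 3) + 1 / 2 ^ Suc j)"
    using le_int by simp
  also have "\<dots> \<le> 2 / 2 ^ j" by (simp add: power_add field_simps)
  finally show ?thesis .
qed

text \<open>Branches that have started by stage \<open>j\<close> and lie in different cells of this stage are separated by
at least 1 on \<open>E j\<close> and move by at most \<open>1 / 8\<close> afterwards.  Hence a single character attracts at most
one cell, apart from the branches that start later.\<close>

lemma continuous_limit_measure: "continuous_measure limit_measure"
  unfolding continuous_measure_def
proof
  fix \<gamma> :: "'g \<Rightarrow> complex" assume "\<gamma> \<in> dual"
  interpret prob_space unit_interval by (rule prob_space_unit_interval)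
  have "emeasure limit_measure {\<gamma>} \<le> ennreal (2 / 2 ^ j)" for j
  proof -
    define A where "A = {t\<in>{0..<1}. t < 1 - 1 / 2 ^ Suc j \<and> branch t = \<gamma>}"
    define B2 where "B2 = {1 - 1 / 2 ^ Suc j..<1::real}"
    have B2: "B2 \<in> sets unit_interval" "measure unit_interval B2 = 1 / 2 ^ Suc j"
      unfolding B2_def by (rule dyadic_tail_measure)+
    have "\<exists>i0. A \<subseteq> {t\<in>{0..<1}. cell (n j) t \<in> {i0}}"
    proof (cases "A = {}")
      case False
      then obtain t0 where t0: "t0 \<in> A" by blast
      have "cell (n j) t = cell (n j) t0" if t: "t \<in> A" for t
      proof (rule ccontr)
        assume "cell (n j) t \<noteq> cell (n j) t0"
        then obtain w where w: "w \<in> E j" "1 \<le> cmod (level j t w - level j t0 w)"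
          using separated[of "cell (n j) t" j "cell (n j) t0"] t t0 unfolding level_def A_def
          by (auto simp: cell_less)
        have "cmod (\<gamma> w - level j t w) \<le> 1 / 2 ^ (j + 3)" "cmod (\<gamma> w - level j t0 w) \<le> 1 / 2 ^ (j + 3)"
          using branch_near[of t j w] branch_near[of t0 j w] w(1) t t0 unfolding A_def by auto
        moreover have "(1::real) / 2 ^ (j + 3) \<le> 1 / 8"
          by (simp add: power_add field_simps)
        moreover have "cmod (level j t w - level j t0 w) \<le> cmod (\<gamma> w - level j t w) + cmod (\<gamma> w - level j t0 w)" by norm
        ultimately show False using w(2) by linarith
      qed
      then show ?thesis by (intro exI[of _ "cell (n j) t0"]) (auto simp: A_def)
    qed auto
    then obtain i0 where i0: "A \<subseteq> {t\<in>{0..<1}. cell (n j) t \<in> {i0}}" by blast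
    define B1 where "B1 = {t\<in>{0..<1}. cell (n j) t \<in> {i0}}"
    note B1 = cell_set_measure[of "{i0}" "n j", folded B1_def]
    have "branch -` {\<gamma>} \<inter> {0..<1} \<subseteq> B1 \<union> B2" using i0 by (force simp: A_def B1_def B2_def)
    then have "emeasure unit_interval (branch -` {\<gamma>} \<inter> {0..<1}) \<le> emeasure unit_interval (B1 \<union> B2)"
      using B1(1) B2(1) by (intro emeasure_mono) auto
    also have "\<dots> = ennreal (measure unit_interval (B1 \<union> B2))" by (rule emeasure_eq_measure)
    also have "\<dots> \<le> ennreal (2 / 2 ^ j)"
    proof (rule ennreal_leI)
      have "(1::real) / 2 ^ n j \<le> 1 / 2 ^ j" using dyadic_threshold_mono[of j "n j"] n_gt[of j] by simp
      moreover have "measure unit_interval (B1 \<union> B2) \<le> 1 / 2 ^ n j + 1 / 2 ^ Suc j"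
        using measure_Un_le[OF B1(1) B2(1)] B1(2) B2(2) by simp
      moreover have "(1::real) / 2 ^ Suc j \<le> 1 / 2 ^ j" using dyadic_threshold_mono[of j "Suc j"] by simp
      ultimately show "measure unit_interval (B1 \<union> B2) \<le> 2 / 2 ^ j" by simp
    qed
    finally show ?thesis using emeasure_limit_measure(1) order_trans by blast
  qed
  moreover have "(\<lambda>j. ennreal (2 / 2 ^ j)) \<longlonglongrightarrow> ennreal 0"
  proof (rule tendsto_ennrealI)
    have "(\<lambda>j. 2 * (1 / 2 :: real) ^ j) \<longlonglongrightarrow> 2 * 0" by (intro tendsto_intros LIMSEQ_power_zero) auto
    then show "(\<lambda>j. 2 / 2 ^ j :: real) \<longlonglongrightarrow> 0" by (simp add: power_one_over)
  qed
  ultimately have "emeasure limit_measure {\<gamma>} \<le> ennreal 0" by (intro LIMSEQ_le_const) auto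
  then show "emeasure limit_measure {\<gamma>} = 0" by simp
qed

text \<open>The branches that start at stage \<open>m\<close> remain close to \<open>c m\<close> on \<open>E (m - 1)\<close>.  For large \<open>m\<close> this set
contains the finitely many coordinates that describe a basic neighbourhood inside \<open>U\<close>.\<close>

lemma full_support_limit_measure:
  assumes dense: "\<And>U m0. openin dual_topology U \<Longrightarrow> U \<noteq> {} \<Longrightarrow> \<exists>m\<ge>m0. c m \<in> U"
    and U: "openin dual_topology U" "U \<noteq> {}"
  shows "emeasure limit_measure U > 0"
proof -
  obtain x where x: "x \<in> U" using U(2) by blast
  obtain F \<delta> where F: "finite F" "\<delta> > 0"
    "\<And>\<gamma>. \<gamma> \<in> dual \<Longrightarrow> (\<And>g. g \<in> F \<Longrightarrow> cmod (\<gamma> g - x g) < \<delta>) \<Longrightarrow> \<gamma> \<in> U"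
    using dual_open_contains_box[OF U(1) x] by meson
  define V where "V = {\<gamma>\<in>dual. \<forall>g\<in>F. cmod (\<gamma> g - x g) < \<delta> / 2}"
  have "openin dual_topology V"
  proof -
    have "open (\<Inter>g\<in>F. {\<gamma> :: 'g \<Rightarrow> complex. cmod (\<gamma> g - x g) < \<delta> / 2})"
      using F(1) by (intro open_INT ballI open_Collect_less continuous_intros continuous_on_product_coordinates)
    moreover have "V = dual \<inter> (\<Inter>g\<in>F. {\<gamma>. cmod (\<gamma> g - x g) < \<delta> / 2})" by (auto simp: V_def)
    ultimately show ?thesis unfolding openin_dual by auto
  qed
  moreover have "x \<in> dual" using x openin_dual_subset U(1) by blast
  then have "x \<in> V" using F(2) by (simp add: V_def)
  ultimately have dV: "\<And>m0. \<exists>m\<ge>m0. c m \<in> V" using dense by blast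
  obtain j1 where "(1 / 2) ^ j1 < \<delta> / 2" using real_arch_pow_inv[of "\<delta> / 2" "1 / 2"] F(2) by auto
  then have j1: "1 / 2 ^ j1 < \<delta> / 2" by (simp add: power_one_over)
  obtain m where m: "m \<ge> Suc (max j1 (\<Sum>g\<in>F. to_nat g))" "c m \<in> V" using dV by blast
  then obtain j where j: "m = Suc j" by (cases m) auto
  have jl: "j \<ge> j1" "j \<ge> (\<Sum>g\<in>F. to_nat g)" using m(1) j by auto
  have FE: "g \<in> E j" if "g \<in> F" for g
  proof -
    have "to_nat g \<le> j" using member_le_sum[of g F to_nat] F(1) that jl(2) by auto
    then show ?thesis using E_le[of "to_nat g" j] E_enum[of "to_nat g"] by auto
  qed
  have bnds: "0 \<le> 1 - 1 / (2::real) ^ Suc j" "(1::real) - 1 / 2 ^ Suc j < 1 - 1 / 2 ^ Suc (Suc j)"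
    "(1::real) - 1 / 2 ^ Suc (Suc j) \<le> 1"
  proof -
    have one_le: "(1::real) \<le> 2 ^ Suc j" by (rule one_le_power) simp
    have "1 / (2::real) ^ Suc j \<le> 1 / 1"
      by (intro frac_le zero_le_one order_refl zero_less_one one_le)
    then show "0 \<le> 1 - 1 / (2::real) ^ Suc j" by linarith
    show "(1::real) - 1 / 2 ^ Suc j < 1 - 1 / 2 ^ Suc (Suc j)" by (simp add: field_simps)
    show "(1::real) - 1 / 2 ^ Suc (Suc j) \<le> 1" by simp
  qed
  define I where "I = {1 - 1 / 2 ^ Suc j..<1 - 1 / 2 ^ Suc (Suc j) :: real}"
  have inU: "branch t \<in> U" if "t \<in> I" for t
  proof -
    have t: "t \<in> {0..<1}" using that bnds(1,3) unfolding I_def atLeastLessThan_iff by linarith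
    show ?thesis
    proof (rule F(3)[OF branch_dual[OF t]])
      fix g assume g: "g \<in> F"
      have 1: "cmod (level m t g - c m g) < 1 / 2 ^ (j + 4)"
        unfolding j using level_Suc_new[OF t _ FE[OF g]] that by (simp add: I_def)
      have 2: "cmod (branch t g - level m t g) \<le> 1 / 2 ^ (m + 3)"
        using FE[OF g] E_mono[of j] that by (intro branch_near t) (auto simp: I_def j)
      have 3: "cmod (c m g - x g) < \<delta> / 2" using m(2) g by (simp add: V_def)
      have "(1::real) / 2 ^ (j + 4) + 1 / 2 ^ (m + 3) \<le> 1 / 2 ^ j" by (simp add: j power_add field_simps)
      also have "\<dots> \<le> 1 / 2 ^ j1" using dyadic_threshold_mono[OF jl(1)] by simp
      finally have 4: "(1::real) / 2 ^ (j + 4) + 1 / 2 ^ (m + 3) < \<delta> / 2" using j1 by linarith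
      have "cmod (branch t g - x g) \<le> cmod (branch t g - level m t g) + cmod (level m t g - c m g) + cmod (c m g - x g)"
        by norm
      then show "cmod (branch t g - x g) < \<delta>" using 1 2 3 4 by linarith
    qed
  qed
  have "0 < emeasure unit_interval I"
    unfolding I_def using interval_measure(3)[OF bnds(1) less_imp_le[OF bnds(2)] bnds(3)] bnds(2) by simp
  also have "\<dots> \<le> emeasure unit_interval (branch -` U \<inter> {0..<1})"
  proof (rule emeasure_mono)
    show "I \<subseteq> branch -` U \<inter> {0..<1}"
      using inU bnds unfolding I_def by (auto intro: order_trans less_le_trans)
    show "branch -` U \<inter> {0..<1} \<in> sets unit_interval"
      using measurable_sets[OF branch_measurable, of U] U(1) sets_dual_sigma by auto
  qed
  also have "\<dots> = emeasure limit_measure U"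
    using U(1) sets_dual_sigma by (intro emeasure_limit_measure(2)[symmetric]) auto
  finally show ?thesis .
qed

end

section \<open>The inductive construction\<close>

text \<open>The targets of stage \<open>j + 1\<close> are \<open>c (j + 1)\<close> for the branches that have not started by stage \<open>j\<close>, and
the parent in the tree for the others.\<close>

lemma stage_sequence:
  fixes S :: "'g::{ab_group_add,countable} set"
  assumes rh: "reasonably_homogeneous TYPE('g)" and S: "measure_expanding S" and c: "range c \<subseteq> dual"
  shows "\<exists>n \<kappa> E S0. (\<forall>j. stage S j (n j) (\<kappa> j) (E j) (S0 j)) \<and> character_tree n \<kappa> E c"
proof -
  define P where "P j = (\<lambda>(n, \<kappa>, E, S0). stage S j n \<kappa> E S0)" for j
  define Q where "Q j = (\<lambda>(n :: nat, \<kappa> :: nat \<Rightarrow> 'g \<Rightarrow> complex, E :: 'g set, S0 :: 'g set)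
    (n' :: nat, \<kappa>' :: nat \<Rightarrow> 'g \<Rightarrow> complex, E' :: 'g set, S0' :: 'g set). n < n' \<and> E \<subseteq> E' \<and>
      (\<forall>i<2 ^ n'. \<forall>e\<in>E. cmod (\<kappa>' i e - (if 1 - 1 / 2 ^ Suc j \<le> real i / 2 ^ n' then c (Suc j) e
        else \<kappa> (i div 2 ^ (n' - n)) e)) < 1 / 2 ^ (j + 4)))" for j
  have c: "c j \<in> dual" for j using c by auto
  have base: "\<exists>p. P 0 p"
  proof -
    obtain n where n: "\<forall>\<tau> E. (\<forall>i<2 ^ n. \<tau> i \<in> dual) \<longrightarrow> finite E \<longrightarrow>
      (\<exists>\<kappa> E' S0. stage S 0 n \<kappa> E' S0 \<and> E \<subseteq> E' \<and> (\<forall>i<2 ^ n. \<forall>e\<in>E. cmod (\<kappa> i e - \<tau> i e) < 1 / 2 ^ (0 + 3)))"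
      using stage_exists[OF rh S, of 0 0] by (elim exE conjE) (rule that)
    obtain \<kappa> E' S0 where "stage S 0 n \<kappa> E' S0" using n[rule_format, of "\<lambda>_. c 0" "{}"] c by auto
    then show ?thesis unfolding P_def by (intro exI[of _ "(n, \<kappa>, E', S0)"]) simp
  qed
  have step: "\<exists>q. P (Suc j) q \<and> Q j p q" if "P j p" for p j
  proof -
    obtain n \<kappa> E S0 where p: "p = (n, \<kappa>, E, S0)" by (metis prod_cases4)
    have st: "stage S j n \<kappa> E S0" using \<open>P j p\<close> by (simp add: P_def p)
    obtain n' where n': "n' > n" "\<forall>\<tau> E. (\<forall>i<2 ^ n'. \<tau> i \<in> dual) \<longrightarrow> finite E \<longrightarrow>
      (\<exists>\<kappa> E' S0. stage S (Suc j) n' \<kappa> E' S0 \<and> E \<subseteq> E' \<and>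
        (\<forall>i<2 ^ n'. \<forall>e\<in>E. cmod (\<kappa> i e - \<tau> i e) < 1 / 2 ^ (Suc j + 3)))"
      using stage_exists[OF rh S, of n "Suc j"] by (elim exE conjE) (rule that)
    define \<tau> where "\<tau> i = (if 1 - 1 / 2 ^ Suc j \<le> real i / 2 ^ n' then c (Suc j) else \<kappa> (i div 2 ^ (n' - n)))" for i
    have \<tau>: "\<tau> i \<in> dual" if "i < 2 ^ n'" for i
    proof -
      have "(2::nat) ^ n' = 2 ^ n * 2 ^ (n' - n)" using n'(1) by (simp add: power_add[symmetric])
      then have "i div 2 ^ (n' - n) < 2 ^ n" using that by (simp add: less_mult_imp_div_less)
      then show ?thesis using st c by (simp add: \<tau>_def stage_def)
    qed
    then have "\<forall>i<2 ^ n'. \<tau> i \<in> dual" by simp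
    moreover have "finite E" using st by (simp add: stage_def)
    ultimately obtain \<kappa>' E' S0' where
      new: "stage S (Suc j) n' \<kappa>' E' S0'" "E \<subseteq> E'" "\<forall>i<2 ^ n'. \<forall>e\<in>E. cmod (\<kappa>' i e - \<tau> i e) < 1 / 2 ^ (Suc j + 3)"
      using n'(2)[THEN spec, THEN spec, THEN mp, THEN mp, of \<tau> E] by metis
    have "cmod (\<kappa>' i e - (if 1 - 1 / 2 ^ Suc j \<le> real i / 2 ^ n' then c (Suc j) e
        else \<kappa> (i div 2 ^ (n' - n)) e)) < 1 / 2 ^ (j + 4)" if "i < 2 ^ n'" "e \<in> E" for i e
    proof -
      have "j + 4 = Suc j + 3" by simp
      then show ?thesis using new(3)[rule_format, OF that] unfolding \<tau>_def by (simp only: if_distribR split: if_splits)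
    qed
    then show ?thesis
      unfolding P_def Q_def p using new(1,2) n'(1)
      by (intro exI[of _ "(n', \<kappa>', E', S0')"]) simp
  qed
  obtain f where f: "\<And>j. P j (f j)" "\<And>j. Q j (f j) (f (Suc j))"
    using dependent_nat_choice[of P Q] base step by blast
  define n where "n j = fst (f j)" for j
  define \<kappa> where "\<kappa> j = fst (snd (f j))" for j
  define E where "E j = fst (snd (snd (f j)))" for j
  define S0 where "S0 j = snd (snd (snd (f j)))" for j
  have fj: "f j = (n j, \<kappa> j, E j, S0 j)" for j by (simp add: n_def \<kappa>_def E_def S0_def)
  have st: "stage S j (n j) (\<kappa> j) (E j) (S0 j)" for j using f(1)[of j] by (simp add: fj P_def)
  have "character_tree n \<kappa> E c"
  proof
    fix j i i' e
    show "j < n j" "i < 2 ^ n j \<Longrightarrow> \<kappa> j i \<in> dual" "from_nat j \<in> E j"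
      "i < 2 ^ n j \<Longrightarrow> i' < 2 ^ n j \<Longrightarrow> i \<noteq> i' \<Longrightarrow> \<exists>w\<in>E j. 1 \<le> cmod (\<kappa> j i w - \<kappa> j i' w)"
      using st[of j] unfolding stage_def by blast+
    show "n j < n (Suc j)" "E j \<subseteq> E (Suc j)"
      using f(2)[of j] by (simp_all add: fj Q_def)
    show "i < 2 ^ n (Suc j) \<Longrightarrow> e \<in> E j \<Longrightarrow>
      cmod (\<kappa> (Suc j) i e - (if 1 - 1 / 2 ^ Suc j \<le> real i / 2 ^ n (Suc j) then c (Suc j) e
        else \<kappa> j (i div 2 ^ (n (Suc j) - n j)) e)) < 1 / 2 ^ (j + 4)"
      using f(2)[of j] unfolding fj Q_def by blast
  qed
  then show ?thesis using st by blast
qed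

text \<open>A set of positive measure is large for all sufficiently late stages, and every translation is
eventually among those considered.\<close>

lemma measure_expanding_UN:
  fixes A :: "nat \<Rightarrow> 'g::{ab_group_add,countable} set"
  assumes A: "\<And>j k. k \<le> j \<Longrightarrow> density_recurrent (1 / 2 ^ (j + 3)) ((\<lambda>s. s + from_nat k) ` A j)"
  shows "measure_expanding (\<Union>j. A j)"
  unfolding measure_expanding_def set_of_recurrence_def recurrent_on_def
proof (intro allI impI ballI)
  fix h :: 'g and M :: "('g \<Rightarrow> bool) measure" and T :: "'g \<Rightarrow> ('g \<Rightarrow> bool) \<Rightarrow> ('g \<Rightarrow> bool)" and D
  assume sys: "G_system M T" and D: "D \<in> sets M" "emeasure M D > 0"
  interpret prob_space M by (rule G_systemD(1)[OF sys])
  have pos: "measure M D > 0" using D(2) by (simp add: emeasure_eq_measure)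
  obtain j0 where "(1 / 2) ^ j0 < measure M D" using real_arch_pow_inv[OF pos, of "1 / 2"] by auto
  then have j0: "1 / 2 ^ j0 < measure M D" by (simp add: power_one_over)
  define j where "j = j0 + to_nat h"
  have "(1::real) / 2 ^ (j + 3) \<le> 1 / 2 ^ j0"
    by (intro divide_left_mono power_increasing) (auto simp: j_def)
  then have "measure M D > 1 / 2 ^ (j + 3)" using j0 by linarith
  moreover have "density_recurrent (1 / 2 ^ (j + 3)) ((\<lambda>s. s + h) ` A j)"
    using A[of "to_nat h" j] by (simp add: j_def)
  ultimately obtain g where "g \<in> (\<lambda>s. s + h) ` A j" "emeasure M (D \<inter> T g ` D) > 0"
    using sys D(1) unfolding density_recurrent_def by blast
  then show "\<exists>g\<in>(\<lambda>s. s + h) ` (\<Union>j. A j). emeasure M (D \<inter> T g ` D) > 0" by blast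
qed

text \<open>In an infinite group some translate of a finite set avoids 0, and is then not a set of recurrence.\<close>

lemma measure_expanding_infinite:
  fixes S :: "'g::ab_group_add set"
  assumes "infinite (UNIV :: 'g set)" and S: "measure_expanding S"
  shows "infinite S"
proof
  assume fin: "finite S"
  then obtain h where h: "h \<notin> uminus ` S" using assms(1) by (metis ex_new_if_finite finite_imageI)
  have "0 \<notin> (\<lambda>s. s + h) ` S"
  proof
    assume "0 \<in> (\<lambda>s. s + h) ` S"
    then obtain s where "s \<in> S" "s + h = 0" by auto
    then have "h = - s" by (simp add: add.commute eq_neg_iff_add_eq_0)
    then show False using h \<open>s \<in> S\<close> by blast
  qed
  then have "\<not> set_of_recurrence ((\<lambda>s. s + h) ` S)"
    using fin by (intro finite_not_set_of_recurrence) auto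
  then show False using S unfolding measure_expanding_def by blast
qed

theorem proposition1p9:
  fixes S :: "'g::{ab_group_add, countable} set"
  assumes "reasonably_homogeneous TYPE('g)"
    and "measure_expanding S"
  shows "\<exists>S' (\<sigma> :: ('g \<Rightarrow> complex) measure).
    S' \<subseteq> S \<and> borel_prob_on_dual \<sigma> \<and> continuous_measure \<sigma> \<and>
    measure_expanding S' \<and>
    (\<exists>s :: nat \<Rightarrow> 'g. bij_betw s UNIV S' \<and> (\<lambda>n. fourier \<sigma> (s n)) \<longlonglongrightarrow> 1) \<and>
    (\<forall>U. openin dual_topology U \<and> U \<noteq> {} \<longrightarrow> emeasure \<sigma> U > 0)"
proof -
  obtain c :: "nat \<Rightarrow> 'g \<Rightarrow> complex" where c_dual: "range c \<subseteq> dual"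
    and c_dense: "\<forall>U. openin dual_topology U \<and> U \<noteq> {} \<longrightarrow> (\<forall>m0. \<exists>m\<ge>m0. c m \<in> U)"
    using dual_dense_sequence by (elim exE conjE) (rule that)
  obtain n \<kappa> E S0 where stages: "\<forall>j. stage S j (n j) (\<kappa> j) (E j) (S0 j)"
    and tree: "character_tree n \<kappa> E c"
    using stage_sequence[OF assms c_dual] by (elim exE conjE) (rule that)
  have st: "stage S j (n j) (\<kappa> j) (E j) (S0 j)" for j using stages by simp
  interpret character_tree n \<kappa> E c by (rule tree)
  define S' where "S' = (\<Union>j. S0 j)"
  have exp: "measure_expanding S'"
    unfolding S'_def by (rule measure_expanding_UN) (use st in \<open>simp add: stage_def\<close>)
  have "infinite (UNIV :: 'g set)" using assms(1) by (simp add: reasonably_homogeneous_def)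
  from measure_expanding_infinite[OF this exp] have inf: "infinite S'" .
  define s where "s = from_nat_into S'"
  have s: "bij_betw s UNIV S'" unfolding s_def by (rule bij_betw_from_nat_into) (auto simp: inf)
  have "(\<lambda>n. fourier limit_measure (s n)) \<longlonglongrightarrow> 1"
  proof (rule metric_LIMSEQ_I)
    fix r :: real assume "r > 0"
    then obtain J where "(1 / 2) ^ J < r / 2" using real_arch_pow_inv[of "r / 2" "1 / 2"] by auto
    then have J: "2 / 2 ^ J < r" by (simp add: power_one_over)
    define A where "A = (\<Union>j<J. S0 j)"
    have "finite A" unfolding A_def using st by (auto simp: stage_def)
    then have "finite (s -` A)" using s by (intro finite_vimageI) (auto simp: bij_betw_def)
    then obtain k where k: "\<forall>m\<in>s -` A. m < k"
      unfolding finite_nat_set_iff_bounded by (elim exE) (rule that)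
    have "dist (fourier limit_measure (s m)) 1 < r" if "m \<ge> k" for m
    proof -
      have "s m \<in> S'" using s by (auto simp: bij_betw_def)
      then obtain j where j: "s m \<in> S0 j" by (auto simp: S'_def)
      have "s m \<notin> A" using bspec[OF k, of m] that by auto
      then have "j \<ge> J" using j by (auto simp: A_def not_less[symmetric])
      have "cmod (fourier limit_measure (s m) - 1) \<le> 2 / 2 ^ j"
        using st[of j] j by (intro fourier_near_1) (auto simp: stage_def)
      also have "\<dots> \<le> 2 / 2 ^ J" using \<open>j \<ge> J\<close> by (intro divide_left_mono power_increasing) auto
      finally show ?thesis using J by (simp add: dist_norm)
    qed
    then show "\<exists>no. \<forall>m\<ge>no. dist (fourier limit_measure (s m)) 1 < r" by blast
  qed
  moreover have "S' \<subseteq> S"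
  proof -
    have "S0 j \<subseteq> S" for j using st[of j] by (simp add: stage_def)
    then show ?thesis by (simp add: S'_def UN_subset_iff)
  qed
  moreover have "\<forall>U. openin dual_topology U \<and> U \<noteq> {} \<longrightarrow> emeasure limit_measure U > 0"
  proof (intro allI impI, elim conjE)
    fix U :: "('g \<Rightarrow> complex) set" assume U: "openin dual_topology U" "U \<noteq> {}"
    show "emeasure limit_measure U > 0"
      by (rule full_support_limit_measure[OF _ U]) (use c_dense in simp)
  qed
  ultimately show ?thesis
    using borel_prob_limit_measure continuous_limit_measure exp s
    by (intro exI[of _ S'] exI[of _ limit_measure] conjI exI[of _ s]) simp_all
qed

end
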